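(* The Maximum Total Transitivity Decision Problem is NP-complete for bipartite graphs: given a bipartite graph $G$ (without isolated vertices) and an integer $k$, deciding whether $G$ has a total transitive partition of order at least $k$ is NP-complete.
   Context: All graphs are finite, simple, and have no isolated vertices. A total transitive partition of order $k$ of $G=(V,E)$ is a partition $\{V_1,\dots,V_k\}$ of $V$ into nonempty sets such that for all $1\leq i\leq j\leq k$, every vertex of $V_j$ has a neighbour in $V_i$ (for $i=j$: every vertex of $V_i$ is adjacent to another vertex of $V_i$). The Maximum Total Transitivity Decision Problem takes a graph $G$ and an integer $k$ and asks whether $G$ has a total transitive partition of order at least $k$. *)

theory Defs
  imports "HOL-Computational_Algebra.Polynomial" "HOL-Library.Disjoint_Sets"
begin

section \<open>Deterministic multi-tape Turing machines\<close>

text \<open>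
  HOL cannot quantify existentially over types, so the finite sets of states and of tape symbols
  of a machine are initial segments of the natural numbers. The symbol 0 is the blank, and the
  symbols 1 and 2 represent the bits. A tape is a two-way infinite sequence of cells together with
  the position of the head.
\<close>

datatype direction = Left | Stay | Right

record machine =
  num_tapes :: nat
  num_symbols :: nat
  num_states :: nat
  start :: nat
  halt :: nat
  trans :: "nat \<Rightarrow> nat list \<Rightarrow> nat \<times> (nat \<times> direction) list"

definition turing_machine :: "machine \<Rightarrow> bool" where
  "turing_machine M \<longleftrightarrow>
     num_tapes M \<ge> 1 \<and> num_symbols M \<ge> 3 \<and> start M < num_states M \<and> halt M < num_states M \<and>
     (\<forall>q < num_states M. \<forall>ss. length ss = num_tapes M \<and> set ss \<subseteq> {..<num_symbols M} \<longrightarrow>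
        fst (trans M q ss) < num_states M \<and>
        length (snd (trans M q ss)) = num_tapes M \<and>
        fst ` set (snd (trans M q ss)) \<subseteq> {..<num_symbols M})"

type_synonym tape = "(int \<Rightarrow> nat) \<times> int"
type_synonym config = "nat \<times> tape list"

definition read_tape :: "tape \<Rightarrow> nat" where
  "read_tape tp = fst tp (snd tp)"

fun shift :: "direction \<Rightarrow> int" where
  "shift Left = - 1"
| "shift Stay = 0"
| "shift Right = 1"

fun act :: "nat \<times> direction \<Rightarrow> tape \<Rightarrow> tape" where
  "act (s, d) (t, h) = (t(h := s), h + shift d)"

definition step :: "machine \<Rightarrow> config \<Rightarrow> config" where
  "step M c =
     (if fst c = halt M then c
      else let (q, as) = trans M (fst c) (map read_tape (snd c)) in (q, map2 act as (snd c)))"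

definition input_tape :: "nat list \<Rightarrow> tape" where
  "input_tape xs = (\<lambda>i. if 0 \<le> i \<and> nat i < length xs then xs ! nat i else 0, 0)"

definition init_config :: "machine \<Rightarrow> nat list \<Rightarrow> config" where
  "init_config M xs = (start M, input_tape xs # replicate (num_tapes M - 1) (input_tape []))"

text \<open>A tape holds the string that starts at the head and extends up to the first blank.\<close>

definition holds_string :: "tape \<Rightarrow> nat list \<Rightarrow> bool" where
  "holds_string tp ys \<longleftrightarrow>
     (\<forall>i < length ys. fst tp (snd tp + int i) = ys ! i) \<and> fst tp (snd tp + int (length ys)) = 0"

text \<open>
  The input is on the first tape and the output on the last one. As a halted machine no longer
  changes its configuration, this says that the machine halts after at most \<open>t\<close> steps.
\<close>

definition halts_with :: "machine \<Rightarrow> nat list \<Rightarrow> nat list \<Rightarrow> nat \<Rightarrow> bool" where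
  "halts_with M xs ys t \<longleftrightarrow>
     (let c = (step M ^^ t) (init_config M xs) in fst c = halt M \<and> holds_string (last (snd c)) ys)"


section \<open>P, NP and NP-completeness\<close>

definition symbols :: "bool list \<Rightarrow> nat list" where
  "symbols = map (\<lambda>b. if b then 2 else 1)"

definition poly_time_computable :: "(bool list \<Rightarrow> bool list) \<Rightarrow> bool" where
  "poly_time_computable f \<longleftrightarrow>
     (\<exists>M (p :: nat poly). turing_machine M \<and>
        (\<forall>x. halts_with M (symbols x) (symbols (f x)) (poly p (length x))))"

type_synonym language = "bool list set"

definition class_P :: "language set" where
  "class_P = {L. poly_time_computable (\<lambda>x. [x \<in> L])}"

text \<open>The self-delimiting pairing of bit strings: the bits of the first component are doubled.\<close>

definition pair :: "bool list \<Rightarrow> bool list \<Rightarrow> bool list" where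
  "pair x u = concat (map (\<lambda>b. [b, b]) x) @ [False, True] @ u"

definition class_NP :: "language set" where
  "class_NP =
     {L. \<exists>R \<in> class_P. \<exists>p :: nat poly.
        \<forall>x. x \<in> L \<longleftrightarrow> (\<exists>u. length u \<le> poly p (length x) \<and> pair x u \<in> R)}"

definition poly_reducible :: "language \<Rightarrow> language \<Rightarrow> bool" where
  "poly_reducible A B \<longleftrightarrow> (\<exists>f. poly_time_computable f \<and> (\<forall>x. x \<in> A \<longleftrightarrow> f x \<in> B))"

definition NP_hard :: "language \<Rightarrow> bool" where
  "NP_hard B \<longleftrightarrow> (\<forall>A \<in> class_NP. poly_reducible A B)"

definition NP_complete :: "language \<Rightarrow> bool" where
  "NP_complete B \<longleftrightarrow> B \<in> class_NP \<and> NP_hard B"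


section \<open>Graphs and total transitive partitions\<close>

definition simple_graph :: "'a set \<Rightarrow> 'a set set \<Rightarrow> bool" where
  "simple_graph V E \<longleftrightarrow> finite V \<and> (\<forall>e \<in> E. e \<subseteq> V \<and> card e = 2)"

definition no_isolated_vertices :: "'a set \<Rightarrow> 'a set set \<Rightarrow> bool" where
  "no_isolated_vertices V E \<longleftrightarrow> (\<forall>v \<in> V. \<exists>u \<in> V. {u, v} \<in> E)"

definition bipartite :: "'a set \<Rightarrow> 'a set set \<Rightarrow> bool" where
  "bipartite V E \<longleftrightarrow>
     (\<exists>A B. A \<union> B = V \<and> A \<inter> B = {} \<and> (\<forall>e \<in> E. \<exists>a \<in> A. \<exists>b \<in> B. e = {a, b}))"

text \<open>
  The parts are \<open>P 1, \<dots>, P k\<close>. In a simple graph \<open>{u, v} \<in> E\<close> entails \<open>u \<noteq> v\<close>, which covers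
  the case \<open>i = j\<close>. Nonemptiness of the parts is a component of \<^const>\<open>partition_on\<close>.
\<close>

definition total_transitive_partition ::
  "'a set \<Rightarrow> 'a set set \<Rightarrow> nat \<Rightarrow> (nat \<Rightarrow> 'a set) \<Rightarrow> bool" where
  "total_transitive_partition V E k P \<longleftrightarrow>
     partition_on V (P ` {1..k}) \<and> inj_on P {1..k} \<and>
     (\<forall>i j. 1 \<le> i \<and> i \<le> j \<and> j \<le> k \<longrightarrow> (\<forall>v \<in> P j. \<exists>u \<in> P i. {u, v} \<in> E))"


section \<open>The decision problem as a language\<close>

fun binary :: "nat \<Rightarrow> bool list" where
  "binary n = (if n = 0 then [] else odd n # binary (n div 2))"

declare binary.simps [simp del]

text \<open>
  A graph with vertex set \<open>{..<n}\<close> is encoded by \<open>n\<close> in unary, a delimiter, and the adjacency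
  matrix row by row; then follow the sign of \<open>k\<close> and its absolute value in binary, least
  significant bit first. Strings that encode no instance are not in the language.
\<close>

definition encode :: "nat \<Rightarrow> nat set set \<Rightarrow> int \<Rightarrow> bool list" where
  "encode n E k =
     replicate n True @ [False] @
     map (\<lambda>(i, j). {i, j} \<in> E) (List.product [0..<n] [0..<n]) @
     [k < 0] @ binary (nat \<bar>k\<bar>)"

definition max_total_transitivity_problem :: "(nat set \<Rightarrow> nat set set \<Rightarrow> bool) \<Rightarrow> language" where
  "max_total_transitivity_problem C =
     {encode n E k | n E k.
        simple_graph {..<n} E \<and> no_isolated_vertices {..<n} E \<and> C {..<n} E \<and>
        (\<exists>m P. int m \<ge> k \<and> total_transitive_partition {..<n} E m P)}"

lemma binary_inject: "binary m = binary n \<Longrightarrow> m = n"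
proof (induction m arbitrary: n rule: less_induct)
  case (less m)
  show ?case
  proof (cases "m = 0 \<or> n = 0")
    case True
    with less.prems show ?thesis
      by (auto simp: binary.simps[of m] binary.simps[of n] split: if_splits)
  next
    case False
    with less.prems have "odd m = odd n" "binary (m div 2) = binary (n div 2)"
      by (simp_all add: binary.simps[of m] binary.simps[of n])
    moreover from this False less.IH[of "m div 2" "n div 2"] have "m div 2 = n div 2"
      by simp
    ultimately show ?thesis
      by presburger
  qed
qed

text \<open>The encoding is injective on graphs, so membership in the language depends only on the
  encoded instance.\<close>

lemma encode_inject:
  assumes G: "simple_graph {..<n} E" and G': "simple_graph {..<n'} E'"
    and eq: "encode n E k = encode n' E' k'"
  shows "n = n' \<and> E = E' \<and> k = k'"
proof -
  have prefix: "a = b" if "replicate a True @ False # xs = replicate b True @ False # ys"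
    for a b xs ys
  proof -
    from that have "length (takeWhile id (replicate a True @ False # xs)) =
        length (takeWhile id (replicate b True @ False # ys))"
      by simp
    then show ?thesis
      by (simp add: takeWhile_append)
  qed
  have n: "n = n'"
    using eq unfolding encode_def append_Cons append_Nil by (rule prefix)
  with eq have adj: "map (\<lambda>(i, j). {i, j} \<in> E) (List.product [0..<n] [0..<n]) =
      map (\<lambda>(i, j). {i, j} \<in> E') (List.product [0..<n] [0..<n])"
    and sign: "(k < 0) = (k' < 0)" and bin: "binary (nat \<bar>k\<bar>) = binary (nat \<bar>k'\<bar>)"
    by (simp_all add: encode_def)
  from adj have iff: "{i, j} \<in> E \<longleftrightarrow> {i, j} \<in> E'" if "i < n" "j < n" for i j
    using that by (auto simp: map_eq_conv)
  have "e \<in> E \<longleftrightarrow> e \<in> E'" for e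
  proof -
    have "\<exists>i j. e = {i, j} \<and> i < n \<and> j < n" if "e \<in> E \<or> e \<in> E'"
    proof -
      from that G G' n have "e \<subseteq> {..<n}" "card e = 2"
        by (auto simp: simple_graph_def)
      then show ?thesis by (auto simp: card_2_iff)
    qed
    with iff show ?thesis by blast
  qed
  then have "E = E'" by blast
  moreover have "k = k'"
    using sign binary_inject[OF bin] by linarith
  ultimately show ?thesis using n by simp
qed

end

theory Submission imports Defs begin

text \<open>
  Satisfiability of a CNF formula with \<open>n\<close> variables becomes a bipartite graph whose one side
  consists of the \<open>2 * n\<close> literals. The other side has \<open>n + 1\<close> vertices adjacent to all
  literals, and for each clause and each pair of opposite literals a vertex adjacent to exactly the
  literals in it. Every vertex has a neighbour in the first part, so the literals in the first
  part meet all clauses and all pairs. In a total transitive partition of order at least \<open>n + 1\<close>,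
  adjacent vertices of the last part show that there are literals in all parts; hence at least
  \<open>n\<close> literals are outside the first part, which therefore contains exactly one of each pair: the
  true literals. Conversely, a satisfying assignment yields a partition of order \<open>n + 1\<close> in which
  the true literals and the clauses are in the first part.

  Polynomial time is handled through bounded arithmetic: what a formula with quantifiers bounded by
  polynomials in the input length says about the bits of the input can be decided by a program with
  finitely many counters, each of which is the head position on a tape. The verifier, and every
  single bit of the output of the reduction, is such a formula. An NP language is reduced to
  satisfiability by a tableau of implications along the run of the verifying machine, in which only
  the bits of the certificate are disjunctive.
\<close>

section \<open>Counter programs on Turing machines\<close>

text \<open>A vertex also needs a neighbour inside its own part, and this dictates the
  \<open>n + 1\<close> vertices adjacent to all literals: there is one for each part. A false
  literal and such a vertex then form a part of their own, and every literal has a neighbour in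
  every part. Clauses and pairs stay in the first part, where all they demand is a true literal.
  Almost all numbers that occur are polynomial in the input length, so counting in unary is
  affordable. The exception is the number of an instance, which can be exponential in the length of
  its encoding. It is never computed: the certificate supplies the values of the suffixes of its
  binary expansion, and these are only compared with the order of a partition, which is at most the
  number of vertices. Implications suffice in the tableau because an assignment that makes more
  atoms true than the run does is no easier to reconcile with the one negative demand at the end,
  that the symbol of rejection is not read.\<close>

datatype test = NonZero nat | InTrue | InAny

datatype prog =
    Skip | Inc nat | Dec nat | Emit bool
  | Seq prog prog | Cond test prog prog | While test prog

text \<open>Counter 0 doubles as the position of the input head, so a program reads a bit of the
  input by computing its index in that counter.\<close>

primrec check :: "bool list \<Rightarrow> (nat \<Rightarrow> nat) \<Rightarrow> test \<Rightarrow> bool" where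
  "check x c (NonZero k) \<longleftrightarrow> c k \<noteq> 0"
| "check x c InTrue \<longleftrightarrow> c 0 < length x \<and> x ! c 0"
| "check x c InAny \<longleftrightarrow> c 0 < length x"

text \<open>The number is an upper bound on the time rather than the exact time. The strict
  inequalities leave one step for the construct itself.\<close>

inductive exec ::
  "bool list \<Rightarrow> prog \<Rightarrow> (nat \<Rightarrow> nat) \<times> bool list \<Rightarrow> nat \<Rightarrow> (nat \<Rightarrow> nat) \<times> bool list \<Rightarrow> bool"
  for x where
  Skip: "exec x Skip s (Suc t) s"
| Inc: "exec x (Inc k) (c, out) (Suc t) (c(k := Suc (c k)), out)"
| Dec: "exec x (Dec k) (c, out) (Suc t) (c(k := c k - 1), out)"
| Emit: "exec x (Emit b) (c, out) (Suc t) (c, out @ [b])"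
| Seq: "exec x p s t s' \<Longrightarrow> exec x q s' t' s'' \<Longrightarrow> t + t' < u \<Longrightarrow> exec x (Seq p q) s u s''"
| Cond: "exec x (if check x (fst s) b then p else q) s t s' \<Longrightarrow> t < u \<Longrightarrow>
    exec x (Cond b p q) s u s'"
| While_False: "\<not> check x (fst s) b \<Longrightarrow> exec x (While b p) s (Suc t) s"
| While_True: "check x (fst s) b \<Longrightarrow> exec x p s t s' \<Longrightarrow> exec x (While b p) s' t' s'' \<Longrightarrow> t + t' < u \<Longrightarrow>
    exec x (While b p) s u s''"

primrec test_below :: "nat \<Rightarrow> test \<Rightarrow> bool" where
  "test_below K (NonZero k) \<longleftrightarrow> k < K"
| "test_below K InTrue \<longleftrightarrow> 0 < K"
| "test_below K InAny \<longleftrightarrow> 0 < K"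

primrec below :: "nat \<Rightarrow> prog \<Rightarrow> bool" where
  "below K Skip \<longleftrightarrow> True"
| "below K (Inc k) \<longleftrightarrow> k < K"
| "below K (Dec k) \<longleftrightarrow> k < K"
| "below K (Emit b) \<longleftrightarrow> True"
| "below K (Seq p q) \<longleftrightarrow> below K p \<and> below K q"
| "below K (Cond b p q) \<longleftrightarrow> test_below K b \<and> below K p \<and> below K q"
| "below K (While b p) \<longleftrightarrow> test_below K b \<and> below K p"

lemma test_below_mono: "test_below K b \<Longrightarrow> K \<le> K' \<Longrightarrow> test_below K' b"
  by (cases b) auto

lemma below_mono: "below K p \<Longrightarrow> K \<le> K' \<Longrightarrow> below K' p"
  by (induction p) (auto intro: test_below_mono)

lemma ex_test_below: "\<exists>K. test_below K b"
  by (cases b) auto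

lemma ex_below: "\<exists>K. below K p"
proof (induction p)
  case (Seq p q)
  then show ?case
    by (metis below.simps(5) below_mono max.cobounded1 max.cobounded2)
next
  case (Cond b p q)
  then obtain K1 K2 K3 where "test_below K1 b" "below K2 p" "below K3 q"
    using ex_test_below by blast
  then have "below (K1 + K2 + K3) (Cond b p q)"
    by (auto intro: below_mono test_below_mono)
  then show ?case by blast
next
  case (While b p)
  then obtain K1 K2 where "test_below K1 b" "below K2 p"
    using ex_test_below by blast
  then have "below (K1 + K2) (While b p)"
    by (auto intro: below_mono test_below_mono)
  then show ?case by blast
qed auto

section \<open>Compilation of counter programs to Turing machines\<close>

datatype phase = Start | Run "prog list" | Back | Halt

fun sym_test :: "nat list \<Rightarrow> test \<Rightarrow> bool" where
  "sym_test ss (NonZero k) \<longleftrightarrow> ss ! k < 3"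
| "sym_test ss InTrue \<longleftrightarrow> ss ! 0 mod 3 = 2"
| "sym_test ss InAny \<longleftrightarrow> ss ! 0 mod 3 \<noteq> 0"

definition idle :: "nat list \<Rightarrow> (nat \<times> direction) list" where
  "idle = map (\<lambda>s. (s, Stay))"

text \<open>
  Tapes below \<open>K\<close> are counters: their heads hold the values and only cell 0 is marked, by
  adding 3 to its symbol. Tape \<open>K\<close> is the output tape. The control state is the stack of
  programs that remain to be run.
\<close>

fun ptrans :: "nat \<Rightarrow> prog \<Rightarrow> phase \<Rightarrow> nat list \<Rightarrow> phase \<times> (nat \<times> direction) list" where
  "ptrans K p Start ss =
     (Run [p], map (\<lambda>i. (if i < K then ss ! i mod 3 + 3 else ss ! i, Stay)) [0..<length ss])"
| "ptrans K p (Run []) ss = (Back, (idle ss)[K := (ss ! K, Left)])"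
| "ptrans K p (Run (Skip # ps)) ss = (Run ps, idle ss)"
| "ptrans K p (Run (Inc k # ps)) ss = (Run ps, (idle ss)[k := (ss ! k, Right)])"
| "ptrans K p (Run (Dec k # ps)) ss =
     (Run ps, (idle ss)[k := (ss ! k, if ss ! k < 3 then Left else Stay)])"
| "ptrans K p (Run (Emit b # ps)) ss = (Run ps, (idle ss)[K := (if b then 2 else 1, Right)])"
| "ptrans K p (Run (Seq q r # ps)) ss = (Run (q # r # ps), idle ss)"
| "ptrans K p (Run (Cond b q r # ps)) ss = (Run ((if sym_test ss b then q else r) # ps), idle ss)"
| "ptrans K p (Run (While b q # ps)) ss =
     (Run (if sym_test ss b then q # While b q # ps else ps), idle ss)"
| "ptrans K p Back ss =
     (if ss ! K = 0 then (Halt, (idle ss)[K := (ss ! K, Right)])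
      else (Back, (idle ss)[K := (ss ! K, Left)]))"
| "ptrans K p Halt ss = (Halt, idle ss)"

text \<open>A superset of the control stacks that can occur while \<open>p\<close> runs on top of
  the continuation \<open>ps\<close>. It is finite because a loop body always runs on the same
  continuation, namely the loop followed by \<open>ps\<close>; this is what makes the set of machine
  states finite.\<close>

primrec stacks :: "prog \<Rightarrow> prog list \<Rightarrow> prog list set" where
  "stacks Skip ps = {Skip # ps}"
| "stacks (Inc k) ps = {Inc k # ps}"
| "stacks (Dec k) ps = {Dec k # ps}"
| "stacks (Emit b) ps = {Emit b # ps}"
| "stacks (Seq p q) ps = {Seq p q # ps} \<union> stacks p (q # ps) \<union> stacks q ps"
| "stacks (Cond b p q) ps = {Cond b p q # ps} \<union> stacks p ps \<union> stacks q ps"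
| "stacks (While b p) ps = {While b p # ps} \<union> stacks p (While b p # ps)"

lemma stacks_self: "p # ps \<in> stacks p ps"
  by (cases p) auto

lemma finite_stacks: "finite (stacks p ps)"
  by (induction p arbitrary: ps) auto

lemma stacks_closed:
  "qs \<in> stacks p ps \<Longrightarrow> fst (ptrans K r (Run qs) ss) \<in> Run ` insert ps (stacks p ps)"
proof (induction p arbitrary: ps)
  case (Seq p q)
  consider "qs = Seq p q # ps" | "qs \<in> stacks p (q # ps)" | "qs \<in> stacks q ps"
    using Seq.prems by auto
  then show ?case
    using Seq.IH(1)[of "q # ps"] Seq.IH(2)[of ps] stacks_self[of p "q # ps"] stacks_self[of q ps]
    by cases auto
next
  case (Cond b p q)
  consider "qs = Cond b p q # ps" | "qs \<in> stacks p ps" | "qs \<in> stacks q ps"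
    using Cond.prems by auto
  then show ?case
    using Cond.IH(1)[of ps] Cond.IH(2)[of ps] stacks_self[of p ps] stacks_self[of q ps]
    by cases auto
next
  case (While b p)
  consider "qs = While b p # ps" | "qs \<in> stacks p (While b p # ps)"
    using While.prems by auto
  then show ?case
    using While.IH[of "While b p # ps"] stacks_self[of p "While b p # ps"]
    by cases auto
qed auto

definition phases :: "prog \<Rightarrow> phase set" where
  "phases p = {Start, Back, Halt} \<union> Run ` insert [] (stacks p [])"

lemma finite_phases: "finite (phases p)"
  by (simp add: phases_def finite_stacks)

lemma phases_closed:
  assumes "ph \<in> phases p"
  shows "fst (ptrans K p ph ss) \<in> phases p"
proof -
  consider "ph \<in> {Start, Back, Halt, Run []}" | qs where "ph = Run qs" "qs \<in> stacks p []"
    using assms by (auto simp: phases_def)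
  then show ?thesis
  proof cases
    case 1
    then show ?thesis by (cases "ss ! K = 0") (auto simp: phases_def stacks_self)
  next
    case 2
    then show ?thesis using stacks_closed[of qs p "[]" K p ss] by (auto simp: phases_def)
  qed
qed

text \<open>Six symbols are the blank and the two bits, together with the marked copies that
  identify cell 0 of a counter tape.\<close>

lemma ptrans_wf:
  assumes "length ss = Suc K" "set ss \<subseteq> {..<6}"
  shows "length (snd (ptrans K p ph ss)) = Suc K"
    and "fst ` set (snd (ptrans K p ph ss)) \<subseteq> {..<6}"
proof -
  show "length (snd (ptrans K p ph ss)) = Suc K"
    using assms by (cases "(K, p, ph, ss)" rule: ptrans.cases) (auto simp: idle_def)
  have nth: "ss ! i < 6" if "i < Suc K" for i
    using subsetD[OF assms(2) nth_mem[of i ss]] assms(1) that by simp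
  have upd: "fst ` set ((idle ss)[k := (s, d)]) \<subseteq> {..<6}" if "s < 6 \<or> \<not> k < Suc K" for k s d
  proof (cases "k < Suc K")
    case True
    have "fst ` set ((idle ss)[k := (s, d)]) \<subseteq> fst ` insert (s, d) (set (idle ss))"
      by (intro image_mono set_update_subset_insert)
    also have "\<dots> \<subseteq> {..<6}" using that True assms by (auto simp: idle_def)
    finally show ?thesis .
  next
    case False
    then show ?thesis using assms by (auto simp: idle_def list_update_beyond)
  qed
  have upd': "fst ` set ((idle ss)[k := (ss ! k, d)]) \<subseteq> {..<6}" for k d
    by (rule upd) (use nth in auto)
  have idl: "fst ` set (idle ss) \<subseteq> {..<6}" using assms by (auto simp: idle_def)
  have mod3: "n mod 3 + 3 < 6" for n :: nat
    using mod_less_divisor[of 3 n] by linarith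
  show "fst ` set (snd (ptrans K p ph ss)) \<subseteq> {..<6}"
  proof (cases "(K, p, ph, ss)" rule: ptrans.cases)
    case (1 K' p' ss')
    then show ?thesis using nth mod3 assms(1) by auto
  next
    case (10 K' p' ss')
    then show ?thesis using upd'[of K Left] upd'[of K Right] by (cases "ss ! K = 0") simp_all
  qed (simp_all add: idl upd upd')
qed

definition pstep :: "nat \<Rightarrow> prog \<Rightarrow> phase \<times> tape list \<Rightarrow> phase \<times> tape list" where
  "pstep K p = (\<lambda>(ph, tps). let (ph', as) = ptrans K p ph (map read_tape tps) in (ph', map2 act as tps))"

lemma act_stay: "act (read_tape tp, Stay) tp = tp"
  by (cases tp) (simp add: read_tape_def)

lemma map2_act_idle: "map2 act (idle (map read_tape tps)) tps = tps"
  by (rule nth_equalityI) (auto simp: idle_def act_stay)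

lemma map2_act_idle_update:
  "k < length tps \<Longrightarrow> map2 act ((idle (map read_tape tps))[k := a]) tps = tps[k := act a (tps ! k)]"
  by (rule nth_equalityI) (auto simp: idle_def act_stay nth_list_update)

definition counter_tape :: "bool list \<Rightarrow> nat \<Rightarrow> int \<Rightarrow> nat" where
  "counter_tape x k = (let t = fst (input_tape (if k = 0 then symbols x else [])) in t(0 := t 0 + 3))"

definition tapes :: "nat \<Rightarrow> bool list \<Rightarrow> (nat \<Rightarrow> nat) \<times> bool list \<Rightarrow> tape list" where
  "tapes K x s = map (\<lambda>k. (counter_tape x k, int (fst s k))) [0..<K] @
     [(fst (input_tape (symbols (snd s))), int (length (snd s)))]"

lemma length_tapes [simp]: "length (tapes K x s) = Suc K"
  by (simp add: tapes_def)

lemma nth_tapes_counter: "k < K \<Longrightarrow> tapes K x s ! k = (counter_tape x k, int (fst s k))"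
  by (simp add: tapes_def nth_append)

lemma nth_tapes_output: "tapes K x s ! K = (fst (input_tape (symbols (snd s))), int (length (snd s)))"
  by (simp add: tapes_def nth_append)

lemma tapes_eqI:
  assumes "length tps = Suc K"
    and "\<And>k. k < K \<Longrightarrow> tps ! k = (counter_tape x k, int (fst s k))"
    and "tps ! K = (fst (input_tape (symbols (snd s))), int (length (snd s)))"
  shows "tps = tapes K x s"
proof (rule nth_equalityI)
  show "length tps = length (tapes K x s)" using assms by simp
  fix i assume "i < length tps"
  then show "tps ! i = tapes K x s ! i"
    using assms by (cases "i = K") (auto simp: nth_tapes_counter nth_tapes_output)
qed

lemma counter_tape_nonzero: "counter_tape x k (int n) < 3 \<longleftrightarrow> n \<noteq> 0"
  by (auto simp: counter_tape_def Let_def input_tape_def symbols_def)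

lemma counter_tape_input:
  "counter_tape x 0 (int n) mod 3 = (if n < length x then if x ! n then 2 else 1 else 0)"
  by (auto simp: counter_tape_def Let_def input_tape_def symbols_def)

lemma sym_test_tapes:
  "test_below K b \<Longrightarrow> sym_test (map read_tape (tapes K x s)) b \<longleftrightarrow> check x (fst s) b"
  by (cases b)
    (auto simp: nth_tapes_counter read_tape_def counter_tape_nonzero counter_tape_input)

text \<open>The continuation \<open>ps\<close> is arbitrary in the induction, because the first half
  of a \<open>Seq\<close> and the body of a \<open>While\<close> run on longer stacks. Unfolding a
  construct costs one machine step, for which the strict time bounds of \<open>exec\<close> leave
  room.\<close>

lemma exec_pstep:
  "exec x p s t s' \<Longrightarrow> below K p \<Longrightarrow>
     \<exists>u\<le>t. (pstep K r ^^ u) (Run (p # ps), tapes K x s) = (Run ps, tapes K x s')"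
proof (induction arbitrary: ps rule: exec.induct)
  case (Skip s t)
  have "(pstep K r ^^ 1) (Run (Skip # ps), tapes K x s) = (Run ps, tapes K x s)"
    by (simp add: pstep_def map2_act_idle)
  then show ?case by (intro exI[of _ 1]) simp
next
  case (Inc k c out t)
  have "(tapes K x (c, out))[k := act (read_tape (tapes K x (c, out) ! k), Right) (tapes K x (c, out) ! k)] =
      tapes K x (c(k := Suc (c k)), out)"
    by (rule tapes_eqI) (use Inc in \<open>auto simp: nth_list_update nth_tapes_counter nth_tapes_output read_tape_def\<close>)
  then have "(pstep K r ^^ 1) (Run (Inc k # ps), tapes K x (c, out)) = (Run ps, tapes K x (c(k := Suc (c k)), out))"
    using Inc by (simp add: pstep_def map2_act_idle_update)
  then show ?case by (intro exI[of _ 1]) simp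
next
  case (Dec k c out t)
  let ?d = "if counter_tape x k (int (c k)) < 3 then Left else Stay"
  have "(tapes K x (c, out))[k := act (read_tape (tapes K x (c, out) ! k), ?d) (tapes K x (c, out) ! k)] =
      tapes K x (c(k := c k - 1), out)"
    by (rule tapes_eqI)
      (use Dec in \<open>auto simp: nth_list_update nth_tapes_counter nth_tapes_output read_tape_def counter_tape_nonzero\<close>)
  moreover have "map read_tape (tapes K x (c, out)) ! k = counter_tape x k (int (c k))"
    using Dec by (simp add: nth_tapes_counter read_tape_def)
  ultimately have "(pstep K r ^^ 1) (Run (Dec k # ps), tapes K x (c, out)) = (Run ps, tapes K x (c(k := c k - 1), out))"
    using Dec by (simp add: pstep_def map2_act_idle_update nth_tapes_counter read_tape_def)
  then show ?case by (intro exI[of _ 1]) simp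
next
  case (Emit b c out t)
  have "(fst (input_tape (symbols out)))(int (length out) := if b then 2 else 1) =
      fst (input_tape (symbols (out @ [b])))"
    by (rule ext) (auto simp: input_tape_def symbols_def nth_append)
  then have "(tapes K x (c, out))[K := act (if b then 2 else 1, Right) (tapes K x (c, out) ! K)] =
      tapes K x (c, out @ [b])"
    by (intro tapes_eqI) (auto simp: nth_list_update nth_tapes_counter nth_tapes_output)
  then have "(pstep K r ^^ 1) (Run (Emit b # ps), tapes K x (c, out)) = (Run ps, tapes K x (c, out @ [b]))"
    by (simp add: pstep_def map2_act_idle_update)
  then show ?case by (intro exI[of _ 1]) simp
next
  case (Seq p s t s' q t' s'' u)
  obtain v where v: "v \<le> t" "(pstep K r ^^ v) (Run (p # q # ps), tapes K x s) = (Run (q # ps), tapes K x s')"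
    using Seq by fastforce
  obtain v' where v': "v' \<le> t'" "(pstep K r ^^ v') (Run (q # ps), tapes K x s') = (Run ps, tapes K x s'')"
    using Seq by fastforce
  have "(pstep K r ^^ (v' + v + 1)) (Run (Seq p q # ps), tapes K x s) = (Run ps, tapes K x s'')"
    unfolding funpow_add using v(2) v'(2) by (simp add: pstep_def map2_act_idle)
  then show ?case using v(1) v'(1) Seq.hyps by (intro exI[of _ "v' + v + 1"]) simp
next
  case (Cond s b p q t s' u)
  obtain v where v: "v \<le> t" "(pstep K r ^^ v) (Run ((if check x (fst s) b then p else q) # ps), tapes K x s) = (Run ps, tapes K x s')"
    using Cond.IH[of ps] Cond.prems by (cases "check x (fst s) b") auto
  have "(pstep K r ^^ (v + 1)) (Run (Cond b p q # ps), tapes K x s) = (Run ps, tapes K x s')"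
    unfolding funpow_add using v(2) Cond.prems by (simp add: pstep_def map2_act_idle sym_test_tapes)
  then show ?case using v(1) Cond.hyps by (intro exI[of _ "v + 1"]) simp
next
  case (While_False s b p t)
  have "(pstep K r ^^ 1) (Run (While b p # ps), tapes K x s) = (Run ps, tapes K x s)"
    using While_False by (simp add: pstep_def map2_act_idle sym_test_tapes)
  then show ?case by (intro exI[of _ 1]) simp
next
  case (While_True s b p t s' t' s'' u)
  obtain v where v: "v \<le> t" "(pstep K r ^^ v) (Run (p # While b p # ps), tapes K x s) = (Run (While b p # ps), tapes K x s')"
    using While_True by fastforce
  obtain v' where v': "v' \<le> t'" "(pstep K r ^^ v') (Run (While b p # ps), tapes K x s') = (Run ps, tapes K x s'')"
    using While_True by fastforce
  have "(pstep K r ^^ (v' + v + 1)) (Run (While b p # ps), tapes K x s) = (Run ps, tapes K x s'')"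
    unfolding funpow_add using v(2) v'(2) While_True by (simp add: pstep_def map2_act_idle sym_test_tapes)
  then show ?case using v(1) v'(1) While_True.hyps by (intro exI[of _ "v' + v + 1"]) simp
qed


text \<open>The output has to begin at the head, so the head walks left over the nonblank cells up
  to the blank in cell -1 and takes one step back to the right.\<close>

lemma pstep_rewind:
  assumes len: "length tps = Suc K" and K: "tps ! K = (w, int n - 1)"
    and nz: "\<And>i. i < n \<Longrightarrow> w (int i) \<noteq> 0" and z: "w (-1) = 0"
  shows "(pstep K r ^^ Suc n) (Back, tps) = (Halt, tps[K := (w, 0)])"
  using len K nz
proof (induction n arbitrary: tps)
  case 0
  then show ?case using z by (simp add: pstep_def map2_act_idle_update read_tape_def fun_upd_idem)
next
  case (Suc n)
  have "pstep K r (Back, tps) = (Back, tps[K := (w, int n - 1)])"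
    using Suc.prems Suc.prems(3)[of n]
    by (simp add: pstep_def map2_act_idle_update read_tape_def fun_upd_idem)
  then have "(pstep K r ^^ Suc (Suc n)) (Back, tps) = (pstep K r ^^ Suc n) (Back, tps[K := (w, int n - 1)])"
    by (simp add: funpow_swap1)
  also have "\<dots> = (Halt, tps[K := (w, 0)])"
    using Suc.IH[of "tps[K := (w, int n - 1)]"] Suc.prems by simp
  finally show ?case .
qed

text \<open>The three additional steps mark the counter tapes, leave the blank behind the output,
  and turn around at the blank in front of it.\<close>

lemma pstep_output:
  assumes ex: "exec x p (\<lambda>_. 0, []) t (c, out)" and K: "below K p" "0 < K"
  shows "\<exists>u \<le> t + length out + 3. \<exists>tps.
     (pstep K p ^^ u) (Start, input_tape (symbols x) # replicate K (input_tape [])) = (Halt, tps) \<and>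
     holds_string (last tps) (symbols out)"
proof -
  let ?w = "fst (input_tape (symbols out))"
  have start_nth: "map2 act (snd (ptrans K p Start (map read_tape tps))) tps ! k =
      act (if k < K then read_tape (tps ! k) mod 3 + 3 else read_tape (tps ! k), Stay) (tps ! k)"
    if "k < length tps" for k and tps :: "tape list"
    using that by (simp del: upt_Suc)
  let ?t0 = "input_tape (symbols x) # replicate K (input_tape [])"
  have nth: "?t0 ! k = input_tape (if k = 0 then symbols x else [])" if "k < Suc K" for k
    using that by (cases k) auto
  have "pstep K p (Start, ?t0) = (Run [p], tapes K x (\<lambda>_. 0, []))"
  proof -
    have "map2 act (snd (ptrans K p Start (map read_tape ?t0))) ?t0 = tapes K x (\<lambda>_. 0, [])"
    proof (rule tapes_eqI)
      show "length (map2 act (snd (ptrans K p Start (map read_tape ?t0))) ?t0) = Suc K" by simp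
      fix k assume k: "k < K"
      then have "map2 act (snd (ptrans K p Start (map read_tape ?t0))) ?t0 ! k =
          act (read_tape (?t0 ! k) mod 3 + 3, Stay) (?t0 ! k)"
        by (subst start_nth) auto
      also have "\<dots> = (counter_tape x k, 0)"
        using k unfolding nth[OF less_SucI[OF k]] read_tape_def counter_tape_def
        by (auto simp: Let_def input_tape_def symbols_def)
      finally show "map2 act (snd (ptrans K p Start (map read_tape ?t0))) ?t0 ! k =
          (counter_tape x k, int (fst (\<lambda>_. 0, []) k))" by simp
    next
      have "map2 act (snd (ptrans K p Start (map read_tape ?t0))) ?t0 ! K =
          act (read_tape (?t0 ! K), Stay) (?t0 ! K)"
        by (subst start_nth) auto
      also have "\<dots> = input_tape []" unfolding act_stay using K nth[of K] by simp
      finally show "map2 act (snd (ptrans K p Start (map read_tape ?t0))) ?t0 ! K =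
          (fst (input_tape (symbols (snd (\<lambda>_. 0, [])))), int (length (snd (\<lambda>_. 0, []))))"
        by (simp add: input_tape_def symbols_def)
    qed
    then show ?thesis by (simp only: pstep_def ptrans.simps Let_def case_prod_conv fst_conv snd_conv)
  qed
  then have 1: "(pstep K p ^^ 1) (Start, ?t0) = (Run [p], tapes K x (\<lambda>_. 0, []))" by simp
  obtain u where u: "u \<le> t"
    and 2: "(pstep K p ^^ u) (Run [p], tapes K x (\<lambda>_. 0, [])) = (Run [], tapes K x (c, out))"
    using exec_pstep[OF ex K(1), of p "[]"] by blast
  \<comment> \<open>For an empty output this head is in cell -1, which is exactly the blank where
    the rewinding stops.\<close>
  let ?t1 = "(tapes K x (c, out))[K := (?w, int (length out) - 1)]"
  have upd: "?w(int (length out) := ?w (int (length out))) = ?w" by (rule fun_upd_triv)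
  have 3: "(pstep K p ^^ 1) (Run [], tapes K x (c, out)) = (Back, ?t1)"
    by (simp add: pstep_def map2_act_idle_update nth_tapes_output read_tape_def upd)
  have 4: "(pstep K p ^^ Suc (length out)) (Back, ?t1) = (Halt, ?t1[K := (?w, 0)])"
    by (rule pstep_rewind) (auto simp: input_tape_def symbols_def)
  have "(pstep K p ^^ (Suc (length out) + (1 + (u + 1)))) (Start, ?t0) = (Halt, ?t1[K := (?w, 0)])"
    unfolding funpow_add o_apply 1 2 3 4 ..
  moreover have "holds_string (last (?t1[K := (?w, 0)])) (symbols out)"
    by (subst last_conv_nth) (auto simp: holds_string_def input_tape_def simp flip: length_0_conv)
  ultimately show ?thesis
    using u by (intro exI[of _ "Suc (length out) + (1 + (u + 1))"] conjI) auto
qed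

text \<open>The phases are numbered by a bijection \<open>h\<close> from their finite set. The bound
  \<open>r\<close> on the length of the output pays for rewinding, and a halted machine stays as it
  is, so a run that ends early has the same configuration at the exact value of the
  polynomial.\<close>

theorem poly_time_computable_exec:
  fixes q r :: "nat poly"
  assumes ex: "\<And>x. \<exists>c. exec x p (\<lambda>_. 0, []) (poly q (length x)) (c, f x)"
    and len: "\<And>x. length (f x) \<le> poly r (length x)"
  shows "poly_time_computable f"
proof -
  obtain K0 where "below K0 p" using ex_below by blast
  then have K: "below (Suc K0) p" "0 < Suc K0" by (auto intro: below_mono)
  define K where "K = Suc K0"
  note K = K[folded K_def]
  obtain h where h: "bij_betw h (phases p) {0..<card (phases p)}"
    using ex_bij_betw_finite_nat[OF finite_phases] by blast
  then have inj: "inj_on h (phases p)" and less: "\<And>ph. ph \<in> phases p \<Longrightarrow> h ph < card (phases p)"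
    and surj: "\<And>n. n < card (phases p) \<Longrightarrow> inv_into (phases p) h n \<in> phases p"
    using bij_betwE[OF h] bij_betw_imp_surj_on[OF h]
    by (auto simp: bij_betw_def intro: inv_into_into)
  define M where "M = \<lparr>num_tapes = Suc K, num_symbols = 6, num_states = card (phases p),
      start = h Start, halt = h Halt,
      trans = \<lambda>n ss. let (ph, as) = ptrans K p (inv_into (phases p) h n) ss in (h ph, as)\<rparr>"
  have mem: "Start \<in> phases p" "Halt \<in> phases p" by (auto simp: phases_def)
  have tm: "turing_machine M"
    unfolding turing_machine_def M_def
    using ptrans_wf[of _ K p] phases_closed[of _ p K] less mem surj
    by (auto simp: Let_def case_prod_beta)
  have step: "step M (h ph, tps) = (let (ph', tps') = pstep K p (ph, tps) in (h ph', tps')) \<and>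
      fst (pstep K p (ph, tps)) \<in> phases p" if "ph \<in> phases p" for ph tps
  proof (cases "ph = Halt")
    case True
    then show ?thesis using mem
      by (simp add: step_def M_def pstep_def map2_act_idle)
  next
    case False
    then have "h ph \<noteq> h Halt" using inj that mem by (auto dest: inj_onD)
    then show ?thesis using inj that phases_closed[of ph p K "map read_tape tps"]
      by (auto simp: step_def M_def pstep_def Let_def case_prod_beta)
  qed
  have steps: "(step M ^^ n) (h ph, tps) = (let (ph', tps') = (pstep K p ^^ n) (ph, tps) in (h ph', tps')) \<and>
      fst ((pstep K p ^^ n) (ph, tps)) \<in> phases p" if "ph \<in> phases p" for ph tps n
  proof (induction n)
    case (Suc n)
    obtain ph' tps' where "(pstep K p ^^ n) (ph, tps) = (ph', tps')" by fastforce
    then show ?case using Suc step[of ph' tps'] by simp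
  qed (use that in simp)
  have halted: "(step M ^^ n) (h Halt, tps) = (h Halt, tps)" for n tps
    by (induction n) (simp_all add: step_def M_def)
  have "halts_with M (symbols x) (symbols (f x)) (poly (q + r + [:3:]) (length x))" for x
  proof -
    obtain c where "exec x p (\<lambda>_. 0, []) (poly q (length x)) (c, f x)" using ex by blast
    from pstep_output[OF this K] obtain u tps where u: "u \<le> poly q (length x) + length (f x) + 3"
      and run: "(pstep K p ^^ u) (Start, input_tape (symbols x) # replicate K (input_tape [])) = (Halt, tps)"
      and out: "holds_string (last tps) (symbols (f x))" by blast
    have init: "init_config M (symbols x) = (h Start, input_tape (symbols x) # replicate K (input_tape []))"
      by (simp add: init_config_def M_def)
    have *: "(step M ^^ u) (init_config M (symbols x)) = (h Halt, tps)"
      using steps[OF mem(1), of u "input_tape (symbols x) # replicate K (input_tape [])"] run init by simp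
    have "u \<le> poly (q + r + [:3:]) (length x)" using u len[of x] by simp
    then have "poly (q + r + [:3:]) (length x) = (poly (q + r + [:3:]) (length x) - u) + u" by simp
    then have "(step M ^^ poly (q + r + [:3:]) (length x)) (init_config M (symbols x)) = (h Halt, tps)"
      using * halted by (metis funpow_add o_apply)
    then show ?thesis using out by (simp add: halts_with_def M_def)
  qed
  with tm show ?thesis unfolding poly_time_computable_def by blast
qed

section \<open>Bounded arithmetic in polynomial time\<close>

lemma exec_weaken: "exec x p s t s' \<Longrightarrow> s' = s'' \<Longrightarrow> t \<le> u \<Longrightarrow> exec x p s u s''"
  by (cases rule: exec.cases, assumption) (auto intro: exec.intros exec.Dec[simplified] elim!: Suc_le_D[THEN exE])

lemma exec_conv: "exec x p s t s' \<Longrightarrow> s = s0 \<Longrightarrow> s' = s'' \<Longrightarrow> t \<le> u \<Longrightarrow> exec x p s0 u s''"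
  by (blast intro: exec_weaken)

lemma exec_Skip1: "exec x Skip s 1 s"
  using exec.Skip[of x s 0] by simp

lemma exec_Inc1: "exec x (Inc k) (c, out) 1 (c(k := Suc (c k)), out)"
  using exec.Inc[of x k c out 0] by simp

lemma exec_Dec1: "exec x (Dec k) (c, out) 1 (c(k := c k - 1), out)"
  using exec.Dec[of x k c out 0] by simp

lemma exec_Emit1: "exec x (Emit b) (c, out) 1 (c, out @ [b])"
  using exec.Emit[of x b c out 0] by simp

lemma exec_Seq1: "exec x p s t s' \<Longrightarrow> exec x q s' t' s'' \<Longrightarrow> exec x (Seq p q) s (Suc (t + t')) s''"
  by (rule exec.Seq) auto

lemma exec_Cond1:
  "(check x (fst s) b \<Longrightarrow> exec x p s t s') \<Longrightarrow> (\<not> check x (fst s) b \<Longrightarrow> exec x q s t s') \<Longrightarrow>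
     exec x (Cond b p q) s (Suc t) s'"
  by (rule exec.Cond[where t = t]) auto

text \<open>A loop is described by the sequence \<open>f\<close> of its states. Each application
  only has to supply the closed form of the state after \<open>i\<close> rounds.\<close>

lemma exec_loop:
  assumes body: "\<And>i. i < N \<Longrightarrow> exec x p (f i) T (f (Suc i))"
    and check: "\<And>i. i < N \<Longrightarrow> check x (fst (f i)) b" "\<not> check x (fst (f N)) b"
  shows "exec x (While b p) (f 0) (Suc (N * Suc T)) (f N)"
proof -
  have "exec x (While b p) (f (N - m)) (Suc (m * Suc T)) (f N)" if "m \<le> N" for m
    using that
  proof (induction m)
    case 0
    then show ?case using check(2) by (auto intro: exec.While_False)
  next
    case (Suc m)
    then have "exec x p (f (N - Suc m)) T (f (N - m))"
      using body[of "N - Suc m"] by (simp add: Suc_diff_Suc)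
    with Suc check(1)[of "N - Suc m"] show ?case
      using exec.While_True[of x "f (N - Suc m)" b p T "f (N - m)" "Suc (m * Suc T)"] by simp
  qed
  from this[of N] show ?thesis by simp
qed

text \<open>Counter 0 is the input head, odd counters hold the variables of formulas, and the other
  even ones are scratch space; freshness thus becomes a matter of parity.\<close>

definition var :: "nat \<Rightarrow> nat" where "var i = 2 * i + 1"
definition tmp :: "nat \<Rightarrow> nat" where "tmp i = 2 * i + 2"

lemma counter_distinct [simp]:
  "var i = var j \<longleftrightarrow> i = j" "tmp i = tmp j \<longleftrightarrow> i = j" "var i \<noteq> tmp j" "tmp j \<noteq> var i"
  "var i \<noteq> 0" "0 \<noteq> var i" "tmp i \<noteq> 0" "0 \<noteq> tmp i"
  unfolding var_def tmp_def by presburger+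

definition clear :: "nat \<Rightarrow> prog" where
  "clear k = While (NonZero k) (Dec k)"

lemma exec_clear: "exec x (clear k) (c, out) (Suc (c k * 2)) (c(k := 0), out)"
proof -
  let ?f = "\<lambda>i. (c(k := c k - i), out)"
  have "exec x (While (NonZero k) (Dec k)) (?f 0) (Suc (c k * Suc 1)) (?f (c k))"
  proof (rule exec_loop)
    fix i
    show "exec x (Dec k) (?f i) 1 (?f (Suc i))"
      by (rule exec_weaken[OF exec_Dec1]) auto
  qed auto
  then show ?thesis unfolding clear_def by (rule exec_conv) auto
qed

text \<open>A counter can only be read by counting it down. It is therefore moved to
  \<open>m\<close> while \<open>r\<close> grows, and then restored from \<open>m\<close>.\<close>

definition copy :: "nat \<Rightarrow> nat \<Rightarrow> nat \<Rightarrow> prog" where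
  "copy k r m =
     Seq (While (NonZero k) (Seq (Dec k) (Seq (Inc m) (Inc r))))
       (While (NonZero m) (Seq (Dec m) (Inc k)))"

lemma exec_copy:
  assumes "k \<noteq> r" "k \<noteq> m" "r \<noteq> m" "c m = 0"
  shows "exec x (copy k r m) (c, out) (c k * 10 + 3) (c(r := c r + c k), out)"
proof -
  let ?f = "\<lambda>i. (c(k := c k - i, m := i, r := c r + i), out)"
  let ?g = "\<lambda>i. (c(k := i, m := c k - i, r := c r + c k), out)"
  have 1: "exec x (While (NonZero k) (Seq (Dec k) (Seq (Inc m) (Inc r)))) (?f 0) (Suc (c k * Suc 5)) (?f (c k))"
  proof (rule exec_loop)
    fix i
    show "exec x (Seq (Dec k) (Seq (Inc m) (Inc r))) (?f i) 5 (?f (Suc i))"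
      by (rule exec_weaken[OF exec_Seq1[OF exec_Dec1 exec_Seq1[OF exec_Inc1 exec_Inc1]]])
        (use assms in \<open>auto simp: fun_eq_iff\<close>)
  qed (use assms in auto)
  have 2: "exec x (While (NonZero m) (Seq (Dec m) (Inc k))) (?g 0) (Suc (c k * Suc 3)) (?g (c k))"
  proof (rule exec_loop)
    fix i assume "i < c k"
    then show "exec x (Seq (Dec m) (Inc k)) (?g i) 3 (?g (Suc i))"
      by (intro exec_weaken[OF exec_Seq1[OF exec_Dec1 exec_Inc1]])
        (use assms in \<open>auto simp: fun_eq_iff\<close>)
  qed (use assms in auto)
  have eq: "?f 0 = (c, out)" "?f (c k) = ?g 0" "?g (c k) = (c(r := c r + c k), out)"
    using assms by (auto simp: fun_eq_iff)
  show ?thesis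
    unfolding copy_def using 1 2 unfolding eq
    by (intro exec.Seq) auto
qed

section \<open>Evaluation of terms\<close>

datatype trm = Cst nat | Var nat | Add trm trm | Mul trm trm

primrec tval :: "(nat \<Rightarrow> nat) \<Rightarrow> trm \<Rightarrow> nat" where
  "tval e (Cst k) = k"
| "tval e (Var i) = e i"
| "tval e (Add t u) = tval e t + tval e u"
| "tval e (Mul t u) = tval e t * tval e u"

text \<open>The value is added to \<open>r\<close> instead of being assigned, so a sum is a sequence
  and a product is a repetition of the second factor. All scratch counters from \<open>tmp n\<close>
  on are free.\<close>

primrec add_trm :: "trm \<Rightarrow> nat \<Rightarrow> nat \<Rightarrow> prog" where
  "add_trm (Cst k) r n = (Seq (Inc r) ^^ k) Skip"
| "add_trm (Var i) r n = copy (var i) r (tmp n)"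
| "add_trm (Add t u) r n = Seq (add_trm t r n) (add_trm u r n)"
| "add_trm (Mul t u) r n =
     Seq (add_trm t (tmp n) (Suc n))
       (While (NonZero (tmp n)) (Seq (Dec (tmp n)) (add_trm u r (Suc n))))"

text \<open>In the following polynomials in the input length, \<open>M\<close> bounds the variables.\<close>

primrec trm_bound :: "nat poly \<Rightarrow> trm \<Rightarrow> nat poly" where
  "trm_bound M (Cst k) = [:k:]"
| "trm_bound M (Var i) = M"
| "trm_bound M (Add t u) = trm_bound M t + trm_bound M u"
| "trm_bound M (Mul t u) = trm_bound M t * trm_bound M u"

lemma tval_le_trm_bound: "(\<And>i. e i \<le> poly M n) \<Longrightarrow> tval e t \<le> poly (trm_bound M t) n"
  by (induction t) (auto intro: add_mono mult_le_mono)

primrec trm_time :: "nat poly \<Rightarrow> trm \<Rightarrow> nat poly" where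
  "trm_time M (Cst k) = [:1 + k * 2:]"
| "trm_time M (Var i) = M * [:10:] + [:3:]"
| "trm_time M (Add t u) = trm_time M t + trm_time M u + 1"
| "trm_time M (Mul t u) = trm_time M t + trm_bound M t * (trm_time M u + [:3:]) + [:2:]"

lemma exec_Inc_power: "exec x ((Seq (Inc r) ^^ k) Skip) (c, out) (1 + k * 2) (c(r := c r + k), out)"
proof (induction k arbitrary: c)
  case 0
  then show ?case using exec_Skip1 by simp
next
  case (Suc k)
  show ?case
    by (simp, rule exec_weaken[OF exec_Seq1[OF exec_Inc1 Suc]]) auto
qed

lemma exec_add_trm:
  assumes "\<And>j. n \<le> j \<Longrightarrow> c (tmp j) = 0" "\<And>j. n \<le> j \<Longrightarrow> r \<noteq> tmp j" "\<And>i. r \<noteq> var i"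
    and "\<And>i. c (var i) \<le> poly M (length x)"
  shows "exec x (add_trm t r n) (c, out) (poly (trm_time M t) (length x))
     (c(r := c r + tval (\<lambda>i. c (var i)) t), out)"
  using assms
proof (induction t arbitrary: r n c)
  case (Cst k)
  show ?case unfolding add_trm.simps by (rule exec_weaken[OF exec_Inc_power]) auto
next
  case (Var i)
  have "exec x (copy (var i) r (tmp n)) (c, out) (c (var i) * 10 + 3) (c(r := c r + c (var i)), out)"
    by (rule exec_copy) (use Var.prems(1)[of n] Var.prems(2)[of n] Var.prems(3)[of i] in auto)
  then show ?case unfolding add_trm.simps by (rule exec_weaken) (use Var.prems(4)[of i] in \<open>auto simp: fun_eq_iff\<close>)
next
  case (Add t u)
  let ?c = "c(r := c r + tval (\<lambda>i. c (var i)) t)"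
  have e: "(\<lambda>i. ?c (var i)) = (\<lambda>i. c (var i))" using Add.prems(3) by (auto simp: fun_eq_iff dest: sym)
  have "exec x (add_trm u r n) (?c, out) (poly (trm_time M u) (length x))
     (?c(r := ?c r + tval (\<lambda>i. ?c (var i)) u), out)"
    by (rule Add.IH(2)) (use Add.prems Add.prems(2,3)[THEN not_sym] in auto)
  note this[unfolded e]
  from exec_Seq1[OF Add.IH(1)[OF Add.prems] this] show ?case
    unfolding add_trm.simps by (rule exec_weaken) (auto simp: add.assoc)
next
  case (Mul t u)
  let ?e = "\<lambda>i. c (var i)"
  let ?A = "tval ?e t" and ?B = "tval ?e u"
  let ?f = "\<lambda>i. (c(tmp n := ?A - i, r := c r + i * ?B), out)"
  have rn: "r \<noteq> tmp n" using Mul.prems(2) by auto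
  have "exec x (add_trm t (tmp n) (Suc n)) (c, out) (poly (trm_time M t) (length x))
      (c(tmp n := c (tmp n) + ?A), out)"
    by (rule Mul.IH(1)) (use Mul.prems in auto)
  then have 1: "exec x (add_trm t (tmp n) (Suc n)) (c, out) (poly (trm_time M t) (length x)) (?f 0)"
    by (rule exec_weaken) (use Mul.prems rn in auto)
  have "exec x (While (NonZero (tmp n)) (Seq (Dec (tmp n)) (add_trm u r (Suc n)))) (?f 0)
      (Suc (?A * Suc (poly (trm_time M u) (length x) + 2))) (?f ?A)"
  proof (rule exec_loop)
    fix i assume i: "i < ?A"
    let ?c = "c(tmp n := ?A - Suc i, r := c r + i * ?B)"
    have e: "(\<lambda>i. ?c (var i)) = (\<lambda>i. c (var i))" using Mul.prems(3) by (auto simp: fun_eq_iff dest: sym)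
    have "exec x (add_trm u r (Suc n)) (?c, out) (poly (trm_time M u) (length x))
        (?c(r := ?c r + tval (\<lambda>i. ?c (var i)) u), out)"
      by (rule Mul.IH(2)) (use Mul.prems Mul.prems(2,3)[THEN not_sym] in auto)
    note * = this[unfolded e]
    have "exec x (Dec (tmp n)) (?f i) 1 (?c, out)"
      by (rule exec_weaken[OF exec_Dec1]) (use rn in \<open>auto simp: fun_eq_iff\<close>)
    from exec_Seq1[OF this *]
    show "exec x (Seq (Dec (tmp n)) (add_trm u r (Suc n))) (?f i) (poly (trm_time M u) (length x) + 2) (?f (Suc i))"
      by (rule exec_weaken) auto
  qed (use rn in auto)
  note 2 = exec_Seq1[OF 1 this]
  have "?A \<le> poly (trm_bound M t) (length x)"
    by (rule tval_le_trm_bound[OF Mul.prems(4)])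
  then have "?A * Suc (poly (trm_time M u) (length x) + 2) \<le>
      poly (trm_bound M t) (length x) * (poly (trm_time M u) (length x) + 3)"
    by (intro mult_le_mono) auto
  then show ?case unfolding add_trm.simps
    by (intro exec_weaken[OF 2]) (use Mul.prems rn in \<open>auto simp: fun_eq_iff\<close>)
qed


section \<open>Evaluation of formulas with bounded quantifiers\<close>

datatype fm = Bit trm | Less trm trm | Neg fm | Conj fm fm | Ex trm fm

text \<open>Bound variables are de Bruijn levels: \<open>d\<close> is the variable that the next
  quantifier binds.\<close>

primrec holds :: "bool list \<Rightarrow> fm \<Rightarrow> nat \<Rightarrow> (nat \<Rightarrow> nat) \<Rightarrow> bool" where
  "holds x (Bit t) d e \<longleftrightarrow> tval e t < length x \<and> x ! tval e t"
| "holds x (Less t u) d e \<longleftrightarrow> tval e t < tval e u"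
| "holds x (Neg p) d e \<longleftrightarrow> \<not> holds x p d e"
| "holds x (Conj p q) d e \<longleftrightarrow> holds x p d e \<and> holds x q d e"
| "holds x (Ex t p) d e \<longleftrightarrow> (\<exists>a < tval e t. holds x p (Suc d) (e(d := a)))"

text \<open>The truth value is added to \<open>r\<close> as 0 or 1. For \<open>Bit\<close> the index
  is computed in counter 0, which puts the input head on that bit. For \<open>Less\<close> both
  values are counted down together with truncated subtraction, and something is left of the second
  one exactly if it is larger. For \<open>Ex\<close> the counter \<open>tmp (n + 1)\<close>
  accumulates the number of witnesses.\<close>

primrec add_fm :: "fm \<Rightarrow> nat \<Rightarrow> nat \<Rightarrow> nat \<Rightarrow> prog" where
  "add_fm (Bit t) d r n = Seq (add_trm t 0 n) (Seq (Cond InTrue (Inc r) Skip) (clear 0))"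
| "add_fm (Less t u) d r n =
     Seq (add_trm t (tmp n) (n + 2)) (Seq (add_trm u (tmp (n + 1)) (n + 2))
       (Seq (While (NonZero (tmp n)) (Seq (Dec (tmp n)) (Dec (tmp (n + 1)))))
         (Cond (NonZero (tmp (n + 1))) (Seq (Inc r) (clear (tmp (n + 1)))) Skip)))"
| "add_fm (Neg p) d r n =
     Seq (add_fm p d (tmp n) (n + 1)) (Cond (NonZero (tmp n)) (Dec (tmp n)) (Inc r))"
| "add_fm (Conj p q) d r n =
     Seq (add_fm p d (tmp n) (n + 1))
       (Cond (NonZero (tmp n)) (Seq (Dec (tmp n)) (add_fm q d r n)) Skip)"
| "add_fm (Ex t p) d r n =
     Seq (add_trm t (tmp n) (n + 2))
       (Seq (While (NonZero (tmp n))
           (Seq (Dec (tmp n)) (Seq (add_fm p (Suc d) (tmp (n + 1)) (n + 2)) (Inc (var d)))))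
         (Seq (clear (var d)) (Cond (NonZero (tmp (n + 1))) (Seq (Inc r) (clear (tmp (n + 1)))) Skip)))"

text \<open>Inside a quantifier the bound on the variables grows by that of the range, since the new
  variable takes values below it.\<close>

primrec fm_time :: "fm \<Rightarrow> nat poly \<Rightarrow> nat poly" where
  "fm_time (Bit t) M = trm_time M t + trm_bound M t * [:2:] + [:9:]"
| "fm_time (Less t u) M =
     trm_time M t + trm_time M u + trm_bound M t * [:4:] + trm_bound M u * [:2:] + [:9:]"
| "fm_time (Neg p) M = fm_time p M + [:4:]"
| "fm_time (Conj p q) M = fm_time p M + fm_time q M + [:5:]"
| "fm_time (Ex t p) M =
     trm_time M t + trm_bound M t * (fm_time p (M + trm_bound M t) + [:9:]) + [:12:]"

lemma exec_cond_clear: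
  "r \<noteq> k \<Longrightarrow> exec x (Cond (NonZero k) (Seq (Inc r) (clear k)) Skip) (c, out) (c k * 2 + 4)
     (c(k := 0, r := c r + of_bool (c k \<noteq> 0)), out)"
proof (rule exec_weaken[OF exec_Cond1])
  assume "r \<noteq> k" "check x (fst (c, out)) (NonZero k)"
  then show "exec x (Seq (Inc r) (clear k)) (c, out) (c k * 2 + 3)
     (c(k := 0, r := c r + of_bool (c k \<noteq> 0)), out)"
    by (intro exec_weaken[OF exec_Seq1[OF exec_Inc1 exec_clear]]) (auto simp: fun_eq_iff)
next
  assume "\<not> check x (fst (c, out)) (NonZero k)"
  then show "exec x Skip (c, out) (c k * 2 + 3) (c(k := 0, r := c r + of_bool (c k \<noteq> 0)), out)"
    by (intro exec_weaken[OF exec_Skip1]) (auto simp: fun_eq_iff)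
qed auto

text \<open>The conclusion that nothing but \<open>r\<close> changes restores the premises that the
  free counters are 0, which is what allows evaluation to be repeated in the loop of a quantifier.
  The bound \<open>M\<close> is generalised since it increases there.\<close>

lemma exec_add_fm:
  assumes "\<And>j. n \<le> j \<Longrightarrow> c (tmp j) = 0" "\<And>i. d \<le> i \<Longrightarrow> c (var i) = 0" "c 0 = 0" "r = tmp k" "k < n"
    and "\<And>i. c (var i) \<le> poly M (length x)"
  shows "exec x (add_fm p d r n) (c, out) (poly (fm_time p M) (length x))
     (c(r := c r + of_bool (holds x p d (\<lambda>i. c (var i)))), out)"
  using assms
proof (induction p arbitrary: r k n c d M)
  case (Bit t)
  let ?a = "tval (\<lambda>i. c (var i)) t"
  let ?c = "c(0 := ?a)"
  let ?c' = "?c(r := ?c r + of_bool (check x ?c InTrue))"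
  have 1: "exec x (add_trm t 0 n) (c, out) (poly (trm_time M t) (length x)) (?c, out)"
    by (rule exec_weaken[OF exec_add_trm]) (use Bit.prems in auto)
  have 2: "exec x (Cond InTrue (Inc r) Skip) (?c, out) 2 (?c', out)"
  proof (rule exec_weaken[OF exec_Cond1])
    show "exec x (Inc r) (?c, out) 1 (?c', out)" if "check x (fst (?c, out)) InTrue"
      by (rule exec_weaken[OF exec_Inc1]) (use that in \<open>auto simp: fun_eq_iff\<close>)
    show "exec x Skip (?c, out) 1 (?c', out)" if "\<not> check x (fst (?c, out)) InTrue"
      by (rule exec_weaken[OF exec_Skip1]) (use that in \<open>auto simp: fun_eq_iff\<close>)
  qed auto
  have 3: "exec x (clear 0) (?c', out) (Suc (?c' 0 * 2)) (?c'(0 := 0), out)"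
    by (rule exec_clear)
  have "?a \<le> poly (trm_bound M t) (length x)"
    by (rule tval_le_trm_bound[OF Bit.prems(6)])
  then show ?case unfolding add_fm.simps
    by (intro exec_weaken[OF exec_Seq1[OF 1 exec_Seq1[OF 2 3]]])
      (use Bit.prems in \<open>auto simp: fun_eq_iff\<close>)
next
  case (Less t u)
  let ?e = "\<lambda>i. c (var i)"
  let ?a = "tval ?e t" and ?b = "tval ?e u"
  let ?f = "\<lambda>i. (c(tmp n := ?a - i, tmp (n + 1) := ?b - i), out)"
  have 1: "exec x (add_trm t (tmp n) (n + 2)) (c, out) (poly (trm_time M t) (length x)) (c(tmp n := ?a), out)"
    by (rule exec_weaken[OF exec_add_trm]) (use Less.prems in auto)
  have 2: "exec x (add_trm u (tmp (n + 1)) (n + 2)) (c(tmp n := ?a), out) (poly (trm_time M u) (length x)) (?f 0)"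
    by (rule exec_weaken[OF exec_add_trm]) (use Less.prems in auto)
  have 3: "exec x (While (NonZero (tmp n)) (Seq (Dec (tmp n)) (Dec (tmp (n + 1))))) (?f 0)
      (Suc (?a * Suc 3)) (?f ?a)"
  proof (rule exec_loop)
    fix i
    show "exec x (Seq (Dec (tmp n)) (Dec (tmp (n + 1)))) (?f i) 3 (?f (Suc i))"
      by (rule exec_weaken[OF exec_Seq1[OF exec_Dec1 exec_Dec1]]) (auto simp: fun_eq_iff)
  qed auto
  have 4: "exec x (Cond (NonZero (tmp (n + 1))) (Seq (Inc r) (clear (tmp (n + 1)))) Skip) (?f ?a)
      (?b * 2 + 4) (c(r := c r + of_bool (?a < ?b)), out)"
    by (rule exec_weaken[OF exec_cond_clear]) (use Less.prems in \<open>auto simp: fun_eq_iff\<close>)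
  have "?a \<le> poly (trm_bound M t) (length x)" "?b \<le> poly (trm_bound M u) (length x)"
    by (rule tval_le_trm_bound[OF Less.prems(6)])+
  then show ?case unfolding add_fm.simps
    by (intro exec_weaken[OF exec_Seq1[OF 1 exec_Seq1[OF 2 exec_Seq1[OF 3 4]]]]) auto
next
  case (Neg p)
  let ?h = "holds x p d (\<lambda>i. c (var i))"
  have 1: "exec x (add_fm p d (tmp n) (n + 1)) (c, out) (poly (fm_time p M) (length x))
      (c(tmp n := of_bool ?h), out)"
    by (rule exec_weaken[OF Neg.IH[where k = n and M = M]]) (use Neg.prems in auto)
  have 2: "exec x (Cond (NonZero (tmp n)) (Dec (tmp n)) (Inc r)) (c(tmp n := of_bool ?h), out) 2
      (c(r := c r + of_bool (\<not> ?h)), out)"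
  proof (rule exec_weaken[OF exec_Cond1])
    show "exec x (Dec (tmp n)) (c(tmp n := of_bool ?h), out) 1 (c(r := c r + of_bool (\<not> ?h)), out)"
      if "check x (fst (c(tmp n := of_bool ?h), out)) (NonZero (tmp n))"
      by (rule exec_weaken[OF exec_Dec1]) (use that Neg.prems in \<open>auto simp: fun_eq_iff\<close>)
    show "exec x (Inc r) (c(tmp n := of_bool ?h), out) 1 (c(r := c r + of_bool (\<not> ?h)), out)"
      if "\<not> check x (fst (c(tmp n := of_bool ?h), out)) (NonZero (tmp n))"
      by (rule exec_weaken[OF exec_Inc1]) (use that Neg.prems in \<open>auto simp: fun_eq_iff\<close>)
  qed auto
  show ?case unfolding add_fm.simps
    by (rule exec_weaken[OF exec_Seq1[OF 1 2]]) auto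
next
  case (Conj p q)
  let ?h = "holds x p d (\<lambda>i. c (var i))" and ?h' = "holds x q d (\<lambda>i. c (var i))"
  have 1: "exec x (add_fm p d (tmp n) (n + 1)) (c, out) (poly (fm_time p M) (length x))
      (c(tmp n := of_bool ?h), out)"
    by (rule exec_weaken[OF Conj.IH(1)[where k = n and M = M]]) (use Conj.prems in auto)
  have 2: "exec x (add_fm q d r n) (c, out) (poly (fm_time q M) (length x)) (c(r := c r + of_bool ?h'), out)"
    by (rule exec_weaken[OF Conj.IH(2)]) (use Conj.prems in auto)
  have c: "c(tmp n := 0) = c" using Conj.prems by (auto simp: fun_eq_iff)
  have 3: "exec x (Cond (NonZero (tmp n)) (Seq (Dec (tmp n)) (add_fm q d r n)) Skip)
      (c(tmp n := of_bool ?h), out) (poly (fm_time q M) (length x) + 3)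
      (c(r := c r + of_bool (?h \<and> ?h')), out)"
  proof (rule exec_weaken[OF exec_Cond1])
    assume "check x (fst (c(tmp n := of_bool ?h), out)) (NonZero (tmp n))"
    then have h: ?h by (auto split: if_splits)
    have "exec x (Dec (tmp n)) (c(tmp n := of_bool ?h), out) 1 (c, out)"
      by (rule exec_weaken[OF exec_Dec1]) (use h c in auto)
    from exec_Seq1[OF this 2]
    show "exec x (Seq (Dec (tmp n)) (add_fm q d r n)) (c(tmp n := of_bool ?h), out)
      (poly (fm_time q M) (length x) + 2) (c(r := c r + of_bool (?h \<and> ?h')), out)"
      by (rule exec_weaken) (use h in auto)
  next
    assume "\<not> check x (fst (c(tmp n := of_bool ?h), out)) (NonZero (tmp n))"
    then have h: "\<not> ?h" by auto
    show "exec x Skip (c(tmp n := of_bool ?h), out)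
      (poly (fm_time q M) (length x) + 2) (c(r := c r + of_bool (?h \<and> ?h')), out)"
      by (rule exec_weaken[OF exec_Skip1]) (use h c in auto)
  qed auto
  show ?case unfolding add_fm.simps
    by (rule exec_weaken[OF exec_Seq1[OF 1 3]]) auto
next
  case (Ex t p)
  let ?e = "\<lambda>i. c (var i)"
  let ?a = "tval ?e t"
  let ?M = "M + trm_bound M t"
  let ?T = "poly (fm_time p ?M) (length x)"
  let ?h = "\<lambda>a. holds x p (Suc d) (?e(d := a))"
  let ?s = "\<lambda>i. \<Sum>a<i. of_bool (?h a)"
  \<comment> \<open>\<open>?s i\<close> counts the witnesses among the first \<open>i\<close>
    candidates.\<close>
  let ?f = "\<lambda>i. (c(tmp n := ?a - i, var d := i, tmp (n + 1) := ?s i), out)"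
  have a: "?a \<le> poly (trm_bound M t) (length x)"
    by (rule tval_le_trm_bound[OF Ex.prems(6)])
  have 1: "exec x (add_trm t (tmp n) (n + 2)) (c, out) (poly (trm_time M t) (length x)) (?f 0)"
    by (rule exec_weaken[OF exec_add_trm]) (use Ex.prems in \<open>auto simp: fun_eq_iff\<close>)
  have 2: "exec x (While (NonZero (tmp n))
      (Seq (Dec (tmp n)) (Seq (add_fm p (Suc d) (tmp (n + 1)) (n + 2)) (Inc (var d))))) (?f 0)
      (Suc (?a * Suc (?T + 4))) (?f ?a)"
  proof (rule exec_loop)
    fix i assume i: "i < ?a"
    let ?c = "c(tmp n := ?a - Suc i, var d := i, tmp (n + 1) := ?s i)"
    have e: "(\<lambda>j. ?c (var j)) = ?e(d := i)" by (auto simp: fun_eq_iff)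
    have "exec x (add_fm p (Suc d) (tmp (n + 1)) (n + 2)) (?c, out) ?T
        (?c(tmp (n + 1) := ?c (tmp (n + 1)) + of_bool (holds x p (Suc d) (\<lambda>j. ?c (var j)))), out)"
    proof (rule Ex.IH)
      fix j
      have "?c (var j) \<le> max i (c (var j))" by auto
      also have "\<dots> \<le> poly ?M (length x)" using Ex.prems(6)[of j] a i by simp
      finally show "?c (var j) \<le> poly ?M (length x)" .
    qed (use Ex.prems in auto)
    note A = this[unfolded e]
    have B: "exec x (Dec (tmp n)) (?f i) 1 (?c, out)"
      by (rule exec_weaken[OF exec_Dec1]) (auto simp: fun_eq_iff)
    show "exec x (Seq (Dec (tmp n)) (Seq (add_fm p (Suc d) (tmp (n + 1)) (n + 2)) (Inc (var d))))
        (?f i) (?T + 4) (?f (Suc i))"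
      by (rule exec_weaken[OF exec_Seq1[OF B exec_Seq1[OF A exec_Inc1]]]) (auto simp: fun_eq_iff)
  qed auto
  let ?c = "c(tmp n := 0, var d := 0, tmp (n + 1) := ?s ?a)"
  have 3: "exec x (clear (var d)) (?f ?a) (Suc (?a * 2)) (?c, out)"
    by (rule exec_weaken[OF exec_clear]) (auto simp: fun_eq_iff)
  have 4: "exec x (Cond (NonZero (tmp (n + 1))) (Seq (Inc r) (clear (tmp (n + 1)))) Skip) (?c, out)
      (?s ?a * 2 + 4) (c(r := c r + of_bool (\<exists>a<?a. ?h a)), out)"
  proof (rule exec_weaken[OF exec_cond_clear])
    show "(?c(tmp (n + 1) := 0, r := ?c r + of_bool (?c (tmp (n + 1)) \<noteq> 0)), out) =
        (c(r := c r + of_bool (\<exists>a<?a. ?h a)), out)"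
      using Ex.prems by (auto simp: fun_eq_iff)
  qed (use Ex.prems in auto)
  have s: "?s ?a \<le> ?a"
    using sum_mono[of "{..<?a}" "\<lambda>a. of_bool (?h a)" "\<lambda>_. 1::nat"] by simp
  have "?a * (?T + 9) \<le> poly (trm_bound M t) (length x) * (?T + 9)"
    using a by (rule mult_le_mono1)
  then show ?case unfolding add_fm.simps
    by (intro exec_weaken[OF exec_Seq1[OF 1 exec_Seq1[OF 2 exec_Seq1[OF 3 4]]]])
      (use s in \<open>auto simp: algebra_simps\<close>)
qed


section \<open>Output of bits and of numbers in binary\<close>

definition emit_flag :: "nat \<Rightarrow> prog" where
  "emit_flag k = Cond (NonZero k) (Seq (Dec k) (Emit True)) (Emit False)"

lemma exec_emit_flag:
  "c k = of_bool b \<Longrightarrow> exec x (emit_flag k) (c, out) 4 (c(k := 0), out @ [b])"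
  unfolding emit_flag_def
proof (rule exec_weaken[OF exec_Cond1])
  assume c: "c k = of_bool b"
  show "exec x (Seq (Dec k) (Emit True)) (c, out) 3 (c(k := 0), out @ [b])"
    if "check x (fst (c, out)) (NonZero k)"
    by (rule exec_weaken[OF exec_Seq1[OF exec_Dec1 exec_Emit1]]) (use c that in auto)
  show "exec x (Emit False) (c, out) 3 (c(k := 0), out @ [b])"
    if "\<not> check x (fst (c, out)) (NonZero k)"
    by (rule exec_weaken[OF exec_Emit1]) (use c that in auto)
qed auto

text \<open>The counters \<open>tmp 1\<close> and \<open>tmp 2\<close> receive the quotient and the remainder modulo 2.\<close>

definition emit_binary :: prog where
  "emit_binary =
     While (NonZero (tmp 0))
       (Seq (While (NonZero (tmp 0))
           (Seq (Dec (tmp 0))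
             (Cond (NonZero (tmp 0)) (Seq (Dec (tmp 0)) (Inc (tmp 1))) (Inc (tmp 2)))))
         (Seq (emit_flag (tmp 2)) (Seq (copy (tmp 1) (tmp 0) (tmp 3)) (clear (tmp 1)))))"


text \<open>One halving costs at most a linear expression in the fixed bound \<open>K\<close>. There
  are at most \<open>k\<close> of them, a crude count that is enough for a polynomial because
  \<open>k\<close> is given in unary.\<close>

lemma exec_emit_binary:
  assumes "k \<le> K" "c (tmp 0) = k" "c (tmp 1) = 0" "c (tmp 2) = 0" "c (tmp 3) = 0"
  shows "exec x emit_binary (c, out) (Suc (k * Suc (20 * K + 30))) (c(tmp 0 := 0), out @ binary k)"
  using assms
proof (induction k arbitrary: c out rule: less_induct)
  case (less k)
  show ?case
  proof (cases "k = 0")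
    case True
    then have "c(tmp 0 := 0) = c" using less.prems by auto
    then show ?thesis
      using True less.prems unfolding emit_binary_def
      by (intro exec_weaken[OF exec.While_False[where t = 0]]) (auto simp: binary.simps[of 0])
  next
    case False
    \<comment> \<open>The state after \<open>i\<close> subtractions of 2. For odd \<open>k\<close>
      the last round finds only 1, which goes to the remainder instead of the quotient; hence the
      minimum and the truth value.\<close>
    let ?f = "\<lambda>i. (c(tmp 0 := k - 2 * i, tmp 1 := min i (k div 2), tmp 2 := of_bool (2 * i > k)), out)"
    let ?N = "(k + 1) div 2"
    let ?c = "c(tmp 0 := 0, tmp 1 := k div 2)"
    have 1: "exec x (While (NonZero (tmp 0)) (Seq (Dec (tmp 0))
             (Cond (NonZero (tmp 0)) (Seq (Dec (tmp 0)) (Inc (tmp 1))) (Inc (tmp 2))))) (?f 0)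
        (Suc (?N * Suc 6)) (?f ?N)"
    proof (rule exec_loop)
      fix i assume i: "i < ?N"
      let ?d = "c(tmp 0 := k - 2 * i - 1, tmp 1 := i, tmp 2 := 0)"
      have 1: "exec x (Dec (tmp 0)) (?f i) 1 (?d, out)"
        by (rule exec_weaken[OF exec_Dec1]) (use i in \<open>auto simp: fun_eq_iff\<close>)
      have 2: "exec x (Cond (NonZero (tmp 0)) (Seq (Dec (tmp 0)) (Inc (tmp 1))) (Inc (tmp 2))) (?d, out)
          4 (?f (Suc i))"
      proof (rule exec_weaken[OF exec_Cond1])
        assume "check x (fst (?d, out)) (NonZero (tmp 0))"
        then have "2 * i + 2 \<le> k" by auto
        then show "exec x (Seq (Dec (tmp 0)) (Inc (tmp 1))) (?d, out) 3 (?f (Suc i))"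
          by (intro exec_weaken[OF exec_Seq1[OF exec_Dec1 exec_Inc1]]) (auto simp: fun_eq_iff)
      next
        assume "\<not> check x (fst (?d, out)) (NonZero (tmp 0))"
        then have "k = 2 * i + 1" using i by auto
        then show "exec x (Inc (tmp 2)) (?d, out) 3 (?f (Suc i))"
          by (intro exec_weaken[OF exec_Inc1]) (auto simp: fun_eq_iff)
      qed auto
      show "exec x (Seq (Dec (tmp 0)) (Cond (NonZero (tmp 0)) (Seq (Dec (tmp 0)) (Inc (tmp 1))) (Inc (tmp 2))))
          (?f i) 6 (?f (Suc i))"
        by (rule exec_weaken[OF exec_Seq1[OF 1 2]]) auto
    qed auto
    have 2: "exec x (emit_flag (tmp 2)) (?f ?N) 4 (?c, out @ [odd k])"
      by (rule exec_weaken[OF exec_emit_flag[of _ _ "odd k"]])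
        (use less.prems in \<open>auto simp: fun_eq_iff elim: oddE\<close>)
    have 3: "exec x (copy (tmp 1) (tmp 0) (tmp 3)) (?c, out @ [odd k]) (k div 2 * 10 + 3)
        (?c(tmp 0 := k div 2), out @ [odd k])"
      by (rule exec_weaken[OF exec_copy]) (use less.prems in auto)
    have 4: "exec x (clear (tmp 1)) (?c(tmp 0 := k div 2), out @ [odd k]) (Suc (k div 2 * 2))
        (c(tmp 0 := k div 2), out @ [odd k])"
      by (rule exec_weaken[OF exec_clear]) (use less.prems in \<open>auto simp: fun_eq_iff\<close>)
    have 5: "exec x emit_binary (c(tmp 0 := k div 2), out @ [odd k])
        (Suc ((k div 2) * Suc (20 * K + 30)))
        (c(tmp 0 := k div 2, tmp 0 := 0), (out @ [odd k]) @ binary (k div 2))"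
      by (rule less.IH) (use less.prems False in auto)
    have f0: "?f 0 = (c, out)" using less.prems by (auto simp: fun_eq_iff)
    have "k div 2 + 1 \<le> k" using False by auto
    then have "(k div 2 + 1) * Suc (20 * K + 30) \<le> k * Suc (20 * K + 30)" by (rule mult_le_mono1)
    moreover have "?N * 7 \<le> K * 7" "k div 2 \<le> K" using less.prems(1) False by auto
    ultimately have "Suc (Suc (?N * Suc 6) + Suc (4 + Suc ((k div 2 * 10 + 3) + Suc (k div 2 * 2))))
        + Suc ((k div 2) * Suc (20 * K + 30)) < Suc (k * Suc (20 * K + 30))"
      unfolding add_mult_distrib by simp
    moreover have "binary k = odd k # binary (k div 2)"
      using False by (subst binary.simps) simp
    ultimately show ?thesis
      using less.prems False unfolding emit_binary_def
      by (intro exec_conv[OF exec.While_True[OF _ exec_Seq1[OF 1 exec_Seq1[OF 2 exec_Seq1[OF 3 4]]]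
              5[unfolded emit_binary_def] lessI]])
        (auto simp: fun_eq_iff)
  qed
qed

text \<open>Variable 0 receives the length of the input and variable 1 the index of the current
  output bit, so the quantifiers of \<open>p\<close> start at level 2.\<close>

definition emit_prog :: "trm \<Rightarrow> fm \<Rightarrow> trm \<Rightarrow> prog" where
  "emit_prog l p q =
     Seq (While InAny (Seq (Inc 0) (Inc (var 0)))) (Seq (clear 0)
       (Seq (add_trm l (tmp 0) 1)
         (Seq (While (NonZero (tmp 0)) (Seq (Dec (tmp 0)) (Seq (add_fm p 2 (tmp 1) 2) (Seq (emit_flag (tmp 1)) (Inc (var 1))))))
           (Seq (clear (var 1)) (Seq (add_trm q (tmp 0) 1) emit_binary)))))"

lemma length_binary_le: "length (binary n) \<le> n"
proof (induction n rule: less_induct)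
  case (less n)
  show ?case
  proof (cases "n = 0")
    case False
    then have "length (binary n) = Suc (length (binary (n div 2)))" by (subst binary.simps) simp
    also have "\<dots> \<le> Suc (n div 2)" using less[of "n div 2"] False by simp
    finally show ?thesis using False by linarith
  qed (simp add: binary.simps[of 0])
qed

text \<open>Bits given by a formula followed by a number in binary are the shape of
  \<open>encode\<close>. A decision is the special case of a single bit followed by the number 0,
  whose expansion is empty.\<close>

theorem poly_time_computable_emit:
  fixes l q :: trm and p :: fm
  defines "e \<equiv> \<lambda>x. (\<lambda>_. 0)(0 := length x)"
  shows "poly_time_computable (\<lambda>x :: bool list.
     map (\<lambda>i. holds x p 2 ((e x)(1 := i))) [0..<tval (e x) l] @ binary (tval (e x) q))"
    (is "poly_time_computable ?f")
proof -
  let ?M = "[:0, 1:] :: nat poly"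
  let ?L = "trm_bound ?M l" and ?Q = "trm_bound ?M q"
  let ?P = "fm_time p (?M + ?L)"
  let ?T = "?M * [:8:] + trm_time ?M l + ?L * (?P + [:30:]) + trm_time ?M q + ?Q * (?Q * [:20:] + [:40:]) + [:30:]"
  have bound: "e x i \<le> poly ?M (length x)" for x i by (simp add: e_def)
  have L: "tval (e x) l \<le> poly ?L (length x)" for x by (rule tval_le_trm_bound[OF bound])
  have Q: "tval (e x) q \<le> poly ?Q (length x)" for x by (rule tval_le_trm_bound[OF bound])
  have "exec x (emit_prog l p q) (\<lambda>_. 0, []) (poly ?T (length x)) ((\<lambda>_. 0)(var 0 := length x), ?f x)" for x
  proof -
    let ?n = "length x"
    let ?c = "(\<lambda>_. 0)(var 0 := ?n)"
    let ?l = "tval (e x) l" and ?q = "tval (e x) q"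
    let ?P = "poly (fm_time p (?M + ?L)) ?n"
    have e: "(\<lambda>i. ?c (var i)) = e x" by (auto simp: e_def)
    let ?f1 = "\<lambda>i. ((\<lambda>_. 0)(0 := i, var 0 := i), [])"
    have 1: "exec x (While InAny (Seq (Inc 0) (Inc (var 0)))) (?f1 0) (Suc (?n * Suc 3)) (?f1 ?n)"
    proof (rule exec_loop)
      show "exec x (Seq (Inc 0) (Inc (var 0))) (?f1 i) 3 (?f1 (Suc i))" for i
        by (rule exec_weaken[OF exec_Seq1[OF exec_Inc1 exec_Inc1]]) (auto simp: fun_eq_iff)
    qed auto
    have 2: "exec x (clear 0) (?f1 ?n) (Suc (?n * 2)) (?c, [])"
      by (rule exec_weaken[OF exec_clear]) (auto simp: fun_eq_iff)
    let ?f = "\<lambda>i. (?c(tmp 0 := ?l - i, var 1 := i), map (\<lambda>i. holds x p 2 ((e x)(1 := i))) [0..<i])"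
    have "exec x (add_trm l (tmp 0) 1) (?c, []) (poly (trm_time ?M l) ?n)
        (?c(tmp 0 := ?c (tmp 0) + tval (\<lambda>i. ?c (var i)) l), [])"
      by (rule exec_add_trm) auto
    then have 3: "exec x (add_trm l (tmp 0) 1) (?c, []) (poly (trm_time ?M l) ?n) (?f 0)"
      unfolding e by (rule exec_weaken) (auto simp: fun_eq_iff)
    have 4: "exec x (While (NonZero (tmp 0)) (Seq (Dec (tmp 0)) (Seq (add_fm p 2 (tmp 1) 2) (Seq (emit_flag (tmp 1)) (Inc (var 1))))))
        (?f 0) (Suc (?l * Suc (?P + 10))) (?f ?l)"
    proof (rule exec_loop)
      fix i assume i: "i < ?l"
      let ?out = "map (\<lambda>i. holds x p 2 ((e x)(1 := i))) [0..<i]"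
      let ?d = "?c(tmp 0 := ?l - Suc i, var 1 := i)"
      let ?h = "holds x p 2 ((e x)(1 := i))"
      have ed: "(\<lambda>j. ?d (var j)) = (e x)(1 := i)" by (auto simp: e_def)
      have A: "exec x (Dec (tmp 0)) (?f i) 1 (?d, ?out)"
        by (rule exec_weaken[OF exec_Dec1]) (auto simp: fun_eq_iff)
      have "exec x (add_fm p 2 (tmp 1) 2) (?d, ?out) ?P
          (?d(tmp 1 := ?d (tmp 1) + of_bool (holds x p 2 (\<lambda>j. ?d (var j)))), ?out)"
        by (rule exec_add_fm) (use i L[of x] in auto)
      then have B: "exec x (add_fm p 2 (tmp 1) 2) (?d, ?out) ?P (?d(tmp 1 := of_bool ?h), ?out)"
        unfolding ed by (rule exec_weaken) (auto simp: fun_eq_iff)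
      have C: "exec x (emit_flag (tmp 1)) (?d(tmp 1 := of_bool ?h), ?out) 4 (?d, ?out @ [?h])"
        by (rule exec_weaken[OF exec_emit_flag[of _ _ ?h]]) (auto simp: fun_eq_iff)
      show "exec x (Seq (Dec (tmp 0)) (Seq (add_fm p 2 (tmp 1) 2) (Seq (emit_flag (tmp 1)) (Inc (var 1)))))
          (?f i) (?P + 10) (?f (Suc i))"
        by (rule exec_weaken[OF exec_Seq1[OF A exec_Seq1[OF B exec_Seq1[OF C exec_Inc1]]]])
          (auto simp: fun_eq_iff)
    qed auto
    let ?out = "map (\<lambda>i. holds x p 2 ((e x)(1 := i))) [0..<?l]"
    have 5: "exec x (clear (var 1)) (?f ?l) (Suc (?l * 2)) (?c, ?out)"
      by (rule exec_weaken[OF exec_clear]) (auto simp: fun_eq_iff)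
    have "exec x (add_trm q (tmp 0) 1) (?c, ?out) (poly (trm_time ?M q) ?n)
        (?c(tmp 0 := ?c (tmp 0) + tval (\<lambda>i. ?c (var i)) q), ?out)"
      by (rule exec_add_trm) auto
    then have 6: "exec x (add_trm q (tmp 0) 1) (?c, ?out) (poly (trm_time ?M q) ?n) (?c(tmp 0 := ?q), ?out)"
      unfolding e by (rule exec_weaken) (auto simp: fun_eq_iff)
    have "exec x emit_binary (?c(tmp 0 := ?q), ?out) (Suc (?q * Suc (20 * ?q + 30)))
       (?c(tmp 0 := ?q, tmp 0 := 0), ?out @ binary ?q)"
      by (rule exec_emit_binary) auto
    then have 7: "exec x emit_binary (?c(tmp 0 := ?q), ?out) (Suc (?q * Suc (20 * ?q + 30))) (?c, ?out @ binary ?q)"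
      by (rule exec_weaken) (auto simp: fun_eq_iff)
    have "?l * (?P + 30) \<le> poly ?L ?n * (?P + 30)" using L by (rule mult_le_mono1)
    moreover have "?q * (?q * 20 + 40) \<le> poly ?Q ?n * (poly ?Q ?n * 20 + 40)"
      using Q[of x] by (intro mult_le_mono) auto
    ultimately show ?thesis
      unfolding emit_prog_def
      by (intro exec_conv[OF exec_Seq1[OF 1 exec_Seq1[OF 2 exec_Seq1[OF 3 exec_Seq1[OF 4
              exec_Seq1[OF 5 exec_Seq1[OF 6 7]]]]]]])
        (auto simp: fun_eq_iff algebra_simps)
  qed
  moreover have "length (?f x) \<le> poly (?L + ?Q) (length x)" for x
    using L[of x] Q[of x] length_binary_le[of "tval (e x) q"] by simp
  ultimately show ?thesis by (intro poly_time_computable_exec) blast+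
qed

section \<open>Definable functions and predicates\<close>

definition trm_definable :: "(bool list \<Rightarrow> (nat \<Rightarrow> nat) \<Rightarrow> nat) \<Rightarrow> bool" where
  "trm_definable f \<longleftrightarrow> (\<exists>t. \<forall>x e. e 0 = length x \<longrightarrow> tval e t = f x e)"

text \<open>A semantic form of the formulas: the rules collected in \<open>definable\<close> follow
  the structure of a HOL expression, so no formula has to be written down. Only environments with
  the input length in variable 0 count, and \<open>d\<close> is the level of the next
  quantifier.\<close>

definition fm_definable :: "nat \<Rightarrow> (bool list \<Rightarrow> (nat \<Rightarrow> nat) \<Rightarrow> bool) \<Rightarrow> bool" where
  "fm_definable d P \<longleftrightarrow> (\<exists>p. \<forall>x e. e 0 = length x \<longrightarrow> holds x p d e = P x e)"

definition has_bit :: "bool list \<Rightarrow> nat \<Rightarrow> bool" where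
  "has_bit x i \<longleftrightarrow> i < length x \<and> x ! i"

named_theorems definable

lemma trm_const [definable]: "trm_definable (\<lambda>x e. k)"
  unfolding trm_definable_def by (rule exI[of _ "Cst k"]) simp

lemma trm_var [definable]: "trm_definable (\<lambda>x e. e i)"
  unfolding trm_definable_def by (rule exI[of _ "Var i"]) simp

lemma trm_length [definable]: "trm_definable (\<lambda>x e. length x)"
  unfolding trm_definable_def by (rule exI[of _ "Var 0"]) simp

lemma trm_add [definable]: "trm_definable f \<Longrightarrow> trm_definable g \<Longrightarrow> trm_definable (\<lambda>x e. f x e + g x e)"
  unfolding trm_definable_def by (metis tval.simps(3))

lemma trm_mult [definable]: "trm_definable f \<Longrightarrow> trm_definable g \<Longrightarrow> trm_definable (\<lambda>x e. f x e * g x e)"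
  unfolding trm_definable_def by (metis tval.simps(4))

lemma trm_Suc [definable]: "trm_definable f \<Longrightarrow> trm_definable (\<lambda>x e. Suc (f x e))"
  using trm_add[OF _ trm_const[of 1], of f] by simp

lemma trm_poly [definable]: "trm_definable f \<Longrightarrow> trm_definable (\<lambda>x e. poly p (f x e))"
  by (induction p) (auto intro!: definable)

lemma fm_less [definable]:
  "trm_definable f \<Longrightarrow> trm_definable g \<Longrightarrow> fm_definable d (\<lambda>x e. f x e < g x e)"
  unfolding trm_definable_def fm_definable_def by (metis holds.simps(2))

lemma fm_has_bit [definable]: "trm_definable f \<Longrightarrow> fm_definable d (\<lambda>x e. has_bit x (f x e))"
  unfolding trm_definable_def fm_definable_def has_bit_def by (metis (no_types) holds.simps(1))

lemma fm_not [definable]: "fm_definable d P \<Longrightarrow> fm_definable d (\<lambda>x e. \<not> P x e)"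
  unfolding fm_definable_def by (metis holds.simps(3))

lemma fm_conj [definable]:
  "fm_definable d P \<Longrightarrow> fm_definable d Q \<Longrightarrow> fm_definable d (\<lambda>x e. P x e \<and> Q x e)"
  unfolding fm_definable_def by (metis holds.simps(4))

lemma fm_disj [definable]:
  "fm_definable d P \<Longrightarrow> fm_definable d Q \<Longrightarrow> fm_definable d (\<lambda>x e. P x e \<or> Q x e)"
  using fm_not[OF fm_conj[OF fm_not[of d P] fm_not[of d Q]]] by simp

lemma fm_imp [definable]:
  "fm_definable d P \<Longrightarrow> fm_definable d Q \<Longrightarrow> fm_definable d (\<lambda>x e. P x e \<longrightarrow> Q x e)"
  using fm_disj[OF fm_not[of d P], of Q] by simp

lemma fm_iff [definable]:
  "fm_definable d P \<Longrightarrow> fm_definable d Q \<Longrightarrow> fm_definable d (\<lambda>x e. P x e \<longleftrightarrow> Q x e)"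
  using fm_conj[OF fm_imp[of d P Q] fm_imp[of d Q P]] by (simp add: iff_conv_conj_imp)

lemma fm_bool [definable]: "fm_definable d (\<lambda>x e. b)"
proof -
  have "fm_definable d (\<lambda>x e. 0 < k)" for k :: nat by (intro definable)
  from this[of "of_bool b"] show ?thesis by simp
qed

lemma fm_eq [definable]:
  "trm_definable f \<Longrightarrow> trm_definable g \<Longrightarrow> fm_definable d (\<lambda>x e. f x e = g x e)"
  using fm_conj[OF fm_not[OF fm_less[of f g d]] fm_not[OF fm_less[of g f d]]]
  by (simp add: not_less eq_iff conj_commute)

lemma fm_le [definable]:
  "trm_definable f \<Longrightarrow> trm_definable g \<Longrightarrow> fm_definable d (\<lambda>x e. f x e \<le> g x e)"
  using fm_not[OF fm_less[of g f d]] by (simp add: not_less)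

text \<open>The last premise says that \<open>P\<close> does not depend on the variable that is about to be bound.\<close>

lemma fm_ex [definable]:
  assumes "trm_definable f" "fm_definable (Suc d) (\<lambda>x e. P x e (e d))" "0 < d"
    and "\<And>x e a. P x (e(d := a)) a \<longleftrightarrow> P x e a"
  shows "fm_definable d (\<lambda>x e. \<exists>a < f x e. P x e a)"
proof -
  obtain t p where t: "\<And>x e. e 0 = length x \<Longrightarrow> tval e t = f x e"
    and p: "\<And>x e. e 0 = length x \<Longrightarrow> holds x p (Suc d) e = P x e (e d)"
    using assms(1,2) unfolding trm_definable_def fm_definable_def by blast
  have "holds x (Ex t p) d e = (\<exists>a < f x e. P x e a)" if "e 0 = length x" for x e
    using that assms(3) by (simp add: t p assms(4))
  then show ?thesis unfolding fm_definable_def by blast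
qed

lemma fm_all [definable]:
  assumes "trm_definable f" "fm_definable (Suc d) (\<lambda>x e. P x e (e d))" "0 < d"
    and "\<And>x e a. P x (e(d := a)) a \<longleftrightarrow> P x e a"
  shows "fm_definable d (\<lambda>x e. \<forall>a < f x e. P x e a)"
proof -
  have "fm_definable d (\<lambda>x e. \<not> (\<exists>a < f x e. \<not> P x e a))"
    by (intro fm_not fm_ex assms) (simp add: assms(4))
  then show ?thesis by simp
qed

text \<open>The list does not depend on the input, so this quantifier unfolds into a finite
  disjunction and takes up no variable.\<close>

lemma fm_bex_list:
  "(\<And>y. y \<in> set ys \<Longrightarrow> fm_definable d (P y)) \<Longrightarrow> fm_definable d (\<lambda>x e. \<exists>y \<in> set ys. P y x e)"
  by (induction ys) (auto intro!: definable)

lemma poly_time_computable_definable: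
  assumes "trm_definable (\<lambda>x e. l x)" "trm_definable (\<lambda>x e. q x)"
    and "fm_definable 2 (\<lambda>x e. P x (e 1))"
  shows "poly_time_computable (\<lambda>x. map (P x) [0..<l x] @ binary (q x))"
proof -
  obtain tl tq p where l: "\<And>x e. e 0 = length x \<Longrightarrow> tval e tl = l x"
    and q: "\<And>x e. e 0 = length x \<Longrightarrow> tval e tq = q x"
    and p: "\<And>x e. e 0 = length x \<Longrightarrow> holds x p 2 e = P x (e 1)"
    using assms unfolding trm_definable_def fm_definable_def by blast
  show ?thesis
    using poly_time_computable_emit[of p tl tq] by (simp add: l q p)
qed

lemma class_P_definable:
  assumes "fm_definable 2 (\<lambda>x e. P x)"
  shows "{x. P x} \<in> class_P"
  using poly_time_computable_definable[OF trm_const[of 1] trm_const[of 0] assms]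
  by (simp add: class_P_def binary.simps)

section \<open>Membership in NP\<close>

definition adjacent :: "(nat \<Rightarrow> bool) \<Rightarrow> nat \<Rightarrow> nat \<Rightarrow> nat \<Rightarrow> bool" where
  "adjacent X n i j \<longleftrightarrow> X (n + 1 + i * n + j)"

text \<open>
  The certificate \<open>U\<close> consists of the sides of the vertices, the characteristic matrix of the
  parts, and a table of the values of the suffixes of the binary expansion of \<open>k\<close>, in unary.
\<close>

definition in_part :: "(nat \<Rightarrow> bool) \<Rightarrow> nat \<Rightarrow> nat \<Rightarrow> nat \<Rightarrow> bool" where
  "in_part U n i c \<longleftrightarrow> U (n + i * n + c)"

definition suffix_value :: "(nat \<Rightarrow> bool) \<Rightarrow> nat \<Rightarrow> nat \<Rightarrow> nat \<Rightarrow> bool" where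
  "suffix_value U n i v \<longleftrightarrow> U (n + n * n + i * (n + 1) + v)"

text \<open>Here \<open>k\<close> is the order of the partition, with parts numbered from 0, whereas
  the number of the instance is present only through its \<open>l\<close> digits. Requiring the last
  digit to be 1, and some digit after a negative sign, excludes leading zeros and a negative zero,
  which \<open>encode\<close> does not produce. Restricting the suffix values to at most
  \<open>k\<close> is the comparison of that number with the order. Every quantifier is bounded and
  no subtraction occurs, in keeping with the definable expressions.\<close>

definition certificate :: "(nat \<Rightarrow> bool) \<Rightarrow> (nat \<Rightarrow> bool) \<Rightarrow> nat \<Rightarrow> bool" where
  "certificate X U N \<longleftrightarrow>
     (\<exists>n<N. (\<forall>i<n. X i) \<and> \<not> X n \<and>
       (\<forall>i<n. \<forall>j<n. adjacent X n i j \<longrightarrow> adjacent X n j i \<and> i \<noteq> j \<and> (U i \<longleftrightarrow> \<not> U j)) \<and>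
       (\<forall>i<n. \<exists>j<n. adjacent X n i j) \<and>
       (\<exists>l<N. n + 1 + n * n + 1 + l = N \<and>
         (\<forall>i<l. l = Suc i \<longrightarrow> X (n + 1 + n * n + 1 + i)) \<and> (X (n + 1 + n * n) \<longrightarrow> l \<noteq> 0) \<and>
         (\<exists>k<Suc n.
           (X (n + 1 + n * n) \<or> suffix_value U n l 0 \<and>
             (\<forall>i<l. \<forall>v<Suc k. suffix_value U n (Suc i) v \<longrightarrow>
               (\<exists>v'<Suc k. v' = 2 * v + of_bool (X (n + 1 + n * n + 1 + i)) \<and> suffix_value U n i v'))) \<and>
           (\<forall>i<n. \<exists>c<k. in_part U n i c \<and> (\<forall>c'<k. in_part U n i c' \<longrightarrow> c' = c)) \<and>
           (\<forall>c<k. \<exists>i<n. in_part U n i c) \<and>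
           (\<forall>c<k. \<forall>c'<Suc c. \<forall>i<n. in_part U n i c \<longrightarrow> (\<exists>j<n. in_part U n j c' \<and> adjacent X n i j)))))"

text \<open>\<open>N\<close> is the length of the first component, recognised by the first two bits
  that are not equal.\<close>

definition verifier :: "bool list \<Rightarrow> bool" where
  "verifier w \<longleftrightarrow> (\<exists>N<length w.
     (\<forall>i<N. has_bit w (2 * i) \<longleftrightarrow> has_bit w (2 * i + 1)) \<and> \<not> has_bit w (2 * N) \<and> has_bit w (2 * N + 1) \<and>
     certificate (\<lambda>i. i < N \<and> has_bit w (2 * i)) (\<lambda>i. has_bit w (2 * N + 2 + i)) N)"

lemma eq_add_of_bool: "v = 2 * u + of_bool b \<longleftrightarrow> b \<and> v = 2 * u + 1 \<or> \<not> b \<and> v = 2 * u" for u v :: nat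
  by (cases b) auto

lemma fm_verifier: "fm_definable 2 (\<lambda>w e. verifier w)"
  unfolding verifier_def certificate_def adjacent_def in_part_def suffix_value_def eq_add_of_bool
  by (intro definable; simp)

lemma length_encode: "length (encode n E k) = n + 1 + n * n + 1 + length (binary (nat \<bar>k\<bar>))"
  by (simp add: encode_def)

lemma matrix_index_less: "i < n \<Longrightarrow> j < n \<Longrightarrow> i * n + j < n * (n :: nat)"
proof -
  assume "i < n" "j < n"
  then have "i * n + j < Suc i * n" by simp
  also have "\<dots> \<le> n * n" using \<open>i < n\<close> by (intro mult_le_mono1) simp
  finally show ?thesis .
qed

lemma nth_encode:
  shows "i < n \<Longrightarrow> encode n E k ! i"
    and "\<not> encode n E k ! n"
    and "i < n \<Longrightarrow> j < n \<Longrightarrow> encode n E k ! (n + 1 + i * n + j) \<longleftrightarrow> {i, j} \<in> E"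
    and "encode n E k ! (n + 1 + n * n) \<longleftrightarrow> k < 0"
    and "encode n E k ! (n + 1 + n * n + 1 + i) = binary (nat \<bar>k\<bar>) ! i"
proof -
  let ?A = "map (\<lambda>(i, j). {i, j} \<in> E) (List.product [0..<n] [0..<n])"
  have len: "length ?A = n * n" by simp
  show "i < n \<Longrightarrow> encode n E k ! i" by (simp add: encode_def nth_append)
  show "\<not> encode n E k ! n" by (simp add: encode_def nth_append)
  show "encode n E k ! (n + 1 + n * n) \<longleftrightarrow> k < 0"
    using len by (simp add: encode_def nth_append del: length_map)
  show "encode n E k ! (n + 1 + n * n + 1 + i) = binary (nat \<bar>k\<bar>) ! i"
    using len by (simp add: encode_def nth_append del: length_map)
  assume ij: "i < n" "j < n"
  note less = matrix_index_less[OF ij]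
  have "encode n E k ! (n + 1 + i * n + j) = ?A ! (i * n + j)"
    using less len by (simp add: encode_def nth_append del: length_map)
  also have "\<dots> \<longleftrightarrow> {i, j} \<in> E"
    using less ij by (simp add: product_nth)
  finally show "encode n E k ! (n + 1 + i * n + j) \<longleftrightarrow> {i, j} \<in> E" .
qed

lemma encode_eqI:
  assumes len: "length x = n + 1 + n * n + 1 + length (binary (nat \<bar>k\<bar>))"
    and "\<And>i. i < n \<Longrightarrow> x ! i" "\<not> x ! n"
    and adj: "\<And>i j. i < n \<Longrightarrow> j < n \<Longrightarrow> x ! (n + 1 + i * n + j) \<longleftrightarrow> {i, j} \<in> E"
    and "x ! (n + 1 + n * n) \<longleftrightarrow> k < 0"
    and bin: "\<And>i. i < length (binary (nat \<bar>k\<bar>)) \<Longrightarrow> x ! (n + 1 + n * n + 1 + i) = binary (nat \<bar>k\<bar>) ! i"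
  shows "x = encode n E k"
proof (rule nth_equalityI)
  show "length x = length (encode n E k)" using len by (simp add: length_encode)
  fix z assume z: "z < length x"
  consider "z < n" | "z = n" | "n < z" "z < n + 1 + n * n" | "z = n + 1 + n * n"
    | "z > n + 1 + n * n" by linarith
  then show "x ! z = encode n E k ! z"
  proof cases
    case 3
    define y where "y = z - (n + 1)"
    have y: "z = n + 1 + y div n * n + y mod n" "y < n * n" using 3 by (auto simp: y_def)
    then have "y div n < n" "y mod n < n" by (auto simp: less_mult_imp_div_less intro!: mod_less_divisor gr0I)
    then show ?thesis unfolding y(1) by (simp only: adj nth_encode(3))
  next
    case 5
    define y where "y = z - (n + 1 + n * n + 1)"
    have y: "z = n + 1 + n * n + 1 + y" using 5 by (auto simp: y_def)
    then have "y < length (binary (nat \<bar>k\<bar>))" using z len by linarith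
    then show ?thesis unfolding y nth_encode(5) by (rule bin)
  qed (use assms nth_encode in auto)
qed

section \<open>Binary expansions\<close>

primrec bval :: "bool list \<Rightarrow> nat" where
  "bval [] = 0"
| "bval (b # bs) = 2 * bval bs + of_bool b"

lemma binary_0: "binary 0 = []"
  by (simp add: binary.simps)

lemma binary_pos: "n \<noteq> 0 \<Longrightarrow> binary n = odd n # binary (n div 2)"
  by (simp add: binary.simps)

lemma bval_binary: "bval (binary n) = n"
  by (induction n rule: less_induct) (case_tac "x = 0"; auto simp: binary_0 binary_pos elim: oddE)

lemma binary_eq_Nil: "binary n = [] \<longleftrightarrow> n = 0"
  by (cases "n = 0") (auto simp: binary_0 binary_pos)

lemma last_binary: "n \<noteq> 0 \<Longrightarrow> last (binary n)"
proof (induction n rule: less_induct)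
  case (less n)
  show ?case
  proof (cases "n = 1")
    case True
    then show ?thesis by (simp add: binary_pos binary_0)
  next
    case False
    with less.prems have "last (binary (n div 2))" by (intro less.IH) auto
    then show ?thesis using False less.prems by (subst binary_pos) (auto simp: binary_eq_Nil)
  qed
qed

lemma bval_pos: "bs \<noteq> [] \<Longrightarrow> last bs \<Longrightarrow> 0 < bval bs"
  by (induction bs) (auto split: if_splits)

text \<open>The least significant bit comes first, so a list without leading zeros is one that is
  empty or ends in \<open>True\<close>.\<close>

lemma binary_bval: "(bs \<noteq> [] \<Longrightarrow> last bs) \<Longrightarrow> binary (bval bs) = bs"
proof (induction bs)
  case (Cons b bs)
  have "bval (b # bs) \<noteq> 0" using bval_pos[of "b # bs"] Cons.prems by fastforce
  moreover have "binary (bval bs) = bs" using Cons by (cases "bs = []") auto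
  ultimately show ?case by (cases b) (simp_all add: binary_pos)
qed (simp add: binary_0)

text \<open>Representatives of disjoint nonempty parts are distinct. This bounds the number of
  columns in the matrix of the certificate.\<close>

lemma total_transitive_partition_le_card:
  assumes "total_transitive_partition V E k P" "finite V"
  shows "k \<le> card V"
proof -
  have part: "partition_on V (P ` {1..k})" and inj: "inj_on P {1..k}"
    using assms by (auto simp: total_transitive_partition_def)
  have "\<exists>v. v \<in> P c" if "c \<in> {1..k}" for c
    using partition_onD3[OF part] that by fastforce
  then obtain f where f: "\<And>c. c \<in> {1..k} \<Longrightarrow> f c \<in> P c" by metis
  have "inj_on f {1..k}"
  proof (rule inj_onI)
    fix c c' assume c: "c \<in> {1..k}" "c' \<in> {1..k}" "f c = f c'"
    then have "P c \<inter> P c' \<noteq> {}" using f by (metis disjoint_iff)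
    then have "P c = P c'" using disjointD[OF partition_onD2[OF part], of "P c" "P c'"] c by auto
    then show "c = c'" using inj c by (auto dest: inj_onD)
  qed
  moreover have "f ` {1..k} \<subseteq> V" using f partition_onD1[OF part] by auto
  ultimately show ?thesis using card_inj_on_le[of f "{1..k}" V] assms(2) by simp
qed

text \<open>The string is recognised as an encoding by rebuilding the edges from its matrix and the
  number from its digits. If the sign is negative, every order is large enough; otherwise the suffix
  table shows that the number is at most \<open>k\<close>.\<close>

lemma certificate_sound:
  assumes "certificate (has_bit x) U (length x)"
  shows "x \<in> max_total_transitivity_problem bipartite"
proof -
  from assms obtain n l k where nN: "n < length x" and one: "\<forall>i<n. has_bit x i" and nn: "\<not> has_bit x n"
    and adj': "\<forall>i<n. \<forall>j<n. adjacent (has_bit x) n i j \<longrightarrow>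
        adjacent (has_bit x) n j i \<and> i \<noteq> j \<and> (U i \<longleftrightarrow> \<not> U j)"
    and noiso: "\<forall>i<n. \<exists>j<n. adjacent (has_bit x) n i j"
    and l: "n + 1 + n * n + 1 + l = length x"
    and canon: "\<forall>i<l. l = Suc i \<longrightarrow> has_bit x (n + 1 + n * n + 1 + i)"
    and neg: "has_bit x (n + 1 + n * n) \<longrightarrow> l \<noteq> 0"
    and val: "has_bit x (n + 1 + n * n) \<or> suffix_value U n l 0 \<and>
             (\<forall>i<l. \<forall>v<Suc k. suffix_value U n (Suc i) v \<longrightarrow>
               (\<exists>v'<Suc k. v' = 2 * v + of_bool (has_bit x (n + 1 + n * n + 1 + i)) \<and> suffix_value U n i v'))"
    and ex1: "\<forall>i<n. \<exists>c<k. in_part U n i c \<and> (\<forall>c'<k. in_part U n i c' \<longrightarrow> c' = c)"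
    and nonempty: "\<forall>c<k. \<exists>i<n. in_part U n i c"
    and trans: "\<forall>c<k. \<forall>c'<Suc c. \<forall>i<n. in_part U n i c \<longrightarrow>
       (\<exists>j<n. in_part U n j c' \<and> adjacent (has_bit x) n i j)"
    unfolding certificate_def by - (elim exE conjE, rule that)
  have adj: "adjacent (has_bit x) n j i" "i \<noteq> j" "U i \<longleftrightarrow> \<not> U j"
    if "i < n" "j < n" "adjacent (has_bit x) n i j" for i j
    using adj' that by blast+
  define E where "E = {{i, j} | i j. i < n \<and> j < n \<and> adjacent (has_bit x) n i j}"
  define bs where "bs = drop (n + 1 + n * n + 1) x"
  define K where "K = (if has_bit x (n + 1 + n * n) then - int (bval bs) else int (bval bs))"
  have E: "{i, j} \<in> E \<longleftrightarrow> adjacent (has_bit x) n i j" if "i < n" "j < n" for i j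
    using that adj unfolding E_def by (auto simp: doubleton_eq_iff)
  have lbs: "length bs = l" using l by (simp add: bs_def)
  have nbs: "bs ! i = has_bit x (n + 1 + n * n + 1 + i)" if "i < l" for i
    using l that by (simp add: bs_def has_bit_def)
  have last: "last bs" if "bs \<noteq> []"
    using that lbs canon[rule_format, of "l - 1"] nbs[of "l - 1"] by (auto simp: last_conv_nth)
  have bin: "binary (nat \<bar>K\<bar>) = bs" using binary_bval last by (simp add: K_def)
  have "x = encode n E K"
  proof (rule encode_eqI, unfold bin)
    show "x ! i" if "i < n" for i using one that by (simp add: has_bit_def)
    show "\<not> x ! n" using nn nN by (simp add: has_bit_def)
    show "x ! (n + 1 + i * n + j) \<longleftrightarrow> {i, j} \<in> E" if "i < n" "j < n" for i j
      unfolding E[OF that] using matrix_index_less[OF that] l by (simp add: adjacent_def has_bit_def)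
    show "x ! (n + 1 + n * n) \<longleftrightarrow> K < 0"
    proof (cases "has_bit x (n + 1 + n * n)")
      case True
      then have "0 < bval bs" using neg lbs last bval_pos by fastforce
      then show ?thesis using True by (simp add: K_def has_bit_def)
    next
      case False
      then show ?thesis using l by (simp add: K_def has_bit_def)
    qed
  qed (use l lbs in \<open>simp_all add: bs_def\<close>)
  moreover have "simple_graph {..<n} E"
    unfolding simple_graph_def
  proof (intro conjI ballI)
    fix e assume "e \<in> E"
    then obtain i j where "e = {i, j}" "i < n" "j < n" "i \<noteq> j" using adj(2) by (auto simp: E_def)
    then show "e \<subseteq> {..<n}" "card e = 2" by auto
  qed auto
  moreover have "no_isolated_vertices {..<n} E"
    unfolding no_isolated_vertices_def using noiso E by (auto simp: insert_commute)
  moreover have "bipartite {..<n} E"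
    unfolding bipartite_def
  proof (intro exI conjI ballI)
    fix e assume "e \<in> E"
    then obtain i j where "e = {i, j}" "i < n" "j < n" "U i \<longleftrightarrow> \<not> U j"
      using adj(3) unfolding E_def by blast
    then show "\<exists>a \<in> {i. i < n \<and> U i}. \<exists>b \<in> {i. i < n \<and> \<not> U i}. e = {a, b}"
      by (cases "U i") (auto simp: insert_commute)
  qed auto
  \<comment> \<open>Parts are numbered from 1, columns of the matrix from 0.\<close>
  moreover have "total_transitive_partition {..<n} E k (\<lambda>c. {i. i < n \<and> in_part U n i (c - 1)})"
    unfolding total_transitive_partition_def partition_on_def disjoint_def
  proof (intro conjI allI impI ballI)
    let ?P = "\<lambda>c. {i. i < n \<and> in_part U n i (c - 1)}"
    have disj: "c = c'" if "c \<in> {1..k}" "c' \<in> {1..k}" "i \<in> ?P c" "i \<in> ?P c'" for c c' i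
    proof -
      from that have "i < n" "c - 1 < k" "c' - 1 < k" "in_part U n i (c - 1)" "in_part U n i (c' - 1)" by auto
      then have "c - 1 = c' - 1" using ex1[rule_format, of i] by metis
      then show ?thesis using that by auto
    qed
    have ne: "?P c \<noteq> {}" if "c \<in> {1..k}" for c
      using nonempty[rule_format, of "c - 1"] that by auto
    show "{} \<notin> ?P ` {1..k}" using ne by blast
    show "inj_on ?P {1..k}"
    proof (rule inj_onI)
      fix c c' assume c: "c \<in> {1..k}" "c' \<in> {1..k}" "?P c = ?P c'"
      obtain i where "i \<in> ?P c" using ne[OF c(1)] by blast
      with c show "c = c'" by (intro disj[of c c' i]) auto
    qed
    show "p \<inter> q = {}" if "p \<in> ?P ` {1..k}" "q \<in> ?P ` {1..k}" "p \<noteq> q" for p q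
      using that disj by blast
    show "\<Union> (?P ` {1..k}) = {..<n}"
    proof (intro equalityI subsetI)
      fix i assume "i \<in> {..<n}"
      then obtain c where "c < k" "in_part U n i c" using ex1 by auto
      then show "i \<in> \<Union> (?P ` {1..k})" using \<open>i \<in> {..<n}\<close> by (intro UN_I[of "Suc c"]) auto
    qed auto
    fix c' c i assume c: "1 \<le> c' \<and> c' \<le> c \<and> c \<le> k" and i: "i \<in> ?P c"
    obtain j where "j < n" "in_part U n j (c' - 1)" "adjacent (has_bit x) n i j"
    proof -
      have "c - 1 < k" "c' - 1 < Suc (c - 1)" "i < n" "in_part U n i (c - 1)" using c i by auto
      then show thesis using trans that by blast
    qed
    then show "\<exists>u \<in> ?P c'. {u, i} \<in> E" using i E[of i j] by (intro bexI[of _ j]) (auto simp: insert_commute)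
  qed
  moreover have "int k \<ge> K"
  proof (cases "has_bit x (n + 1 + n * n)")
    case True
    then show ?thesis by (simp add: K_def)
  next
    case False
    with val have 0: "suffix_value U n l 0"
      and double: "\<And>i v. i < l \<Longrightarrow> v \<le> k \<Longrightarrow> suffix_value U n (Suc i) v \<Longrightarrow>
         2 * v + of_bool (has_bit x (n + 1 + n * n + 1 + i)) \<le> k \<and>
         suffix_value U n i (2 * v + of_bool (has_bit x (n + 1 + n * n + 1 + i)))"
      by (auto simp: less_Suc_eq_le)
    \<comment> \<open>The induction goes down from the empty suffix, as each value is determined by
      that of the next shorter suffix.\<close>
    have "bval (drop i bs) \<le> k \<and> suffix_value U n i (bval (drop i bs))" if "i \<le> l" for i
      using that
    proof (induction i rule: inc_induct)
      case base
      then show ?case using 0 lbs by simp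
    next
      case (step i)
      have "drop i bs = bs ! i # drop (Suc i) bs" using step lbs by (simp add: Cons_nth_drop_Suc)
      then show ?case using double[of i "bval (drop (Suc i) bs)"] step nbs[of i] by simp
    qed
    from this[of 0] False show ?thesis by (simp add: K_def)
  qed
  ultimately show ?thesis unfolding max_total_transitivity_problem_def by blast
qed


lemma bval_drop_le: "bval (drop i bs) \<le> bval bs"
proof (induction bs arbitrary: i)
  case (Cons b bs)
  show ?case
  proof (cases i)
    case (Suc j)
    then show ?thesis using Cons[of j] by simp
  qed simp
qed simp

text \<open>The polynomial is \<open>N + 2 * N * N\<close> for the input length \<open>N\<close>:
  the sides take \<open>n\<close> bits, and the matrix of the parts and the table of suffix values
  take at most \<open>N * N\<close> bits each.\<close>

lemma certificate_complete:
  assumes G: "simple_graph {..<n} E" "no_isolated_vertices {..<n} E" "bipartite {..<n} E"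
    and P: "total_transitive_partition {..<n} E m P" and k: "int m \<ge> k"
  defines "x \<equiv> encode n E k"
  shows "\<exists>u. length u \<le> poly [:0, 1, 2:] (length x) \<and> certificate (has_bit x) (has_bit u) (length x)"
proof -
  obtain A B where AB: "A \<union> B = {..<n}" "A \<inter> B = {}" "\<And>e. e \<in> E \<Longrightarrow> \<exists>a \<in> A. \<exists>b \<in> B. e = {a, b}"
    using G(3) by (auto simp: bipartite_def)
  define bs where "bs = binary (nat \<bar>k\<bar>)"
  define l where "l = length bs"
  define N where "N = length x"
  \<comment> \<open>The three regions of the certificate. The row of a suffix has cells for the
    values up to \<open>n\<close> only and is empty if the value is larger; this can happen only for
    negative \<open>k\<close>, where the table is not consulted.\<close>
  define f where "f z = (if z < n then z \<in> A
      else if z < n + n * n then (z - n) div n \<in> P (Suc ((z - n) mod n))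
      else bval (drop ((z - n - n * n) div (n + 1)) bs) = (z - n - n * n) mod (n + 1))" for z
  define L where "L = n + n * n + (l + 1) * (n + 1)"
  define u where "u = map f [0..<L]"
  let ?U = "has_bit u"
  have m: "m \<le> n" using total_transitive_partition_le_card[OF P] by simp
  have N: "N = n + 1 + n * n + 1 + l" by (simp add: N_def x_def length_encode l_def bs_def)
  have x: "has_bit x i \<longleftrightarrow> i < N \<and> encode n E k ! i" for i by (simp add: has_bit_def N_def x_def)
  have adj: "adjacent (has_bit x) n i j \<longleftrightarrow> {i, j} \<in> E" if "i < n" "j < n" for i j
    unfolding adjacent_def x nth_encode(3)[OF that] using matrix_index_less[OF that] N by simp
  have xb: "has_bit x (n + 1 + n * n + 1 + i) \<longleftrightarrow> i < l \<and> bs ! i" for i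
    unfolding x nth_encode(5) bs_def[symmetric] using N by simp
  have xs: "has_bit x (n + 1 + n * n) \<longleftrightarrow> k < 0"
    unfolding x nth_encode(4) using N by simp
  have U: "?U z \<longleftrightarrow> z < L \<and> f z" for z by (auto simp: has_bit_def u_def)
  have UA: "?U i \<longleftrightarrow> i \<in> A" if "i < n" for i using that by (simp add: U f_def L_def)
  have UP: "in_part ?U n i c \<longleftrightarrow> i \<in> P (Suc c)" if "i < n" "c < n" for i c
    unfolding in_part_def using matrix_index_less[OF that] that
    by (simp add: U f_def L_def add.assoc[of n])
  have UV: "suffix_value ?U n i v \<longleftrightarrow> bval (drop i bs) = v" if "i \<le> l" "v \<le> n" for i v
  proof -
    have "i * (n + 1) + v < (i + 1) * (n + 1)" using that by simp
    also have "\<dots> \<le> (l + 1) * (n + 1)" using that by (intro mult_le_mono1) simp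
    finally have less: "n + n * n + (i * (n + 1) + v) < L" by (simp add: L_def)
    have "(i * (n + 1) + v) div (n + 1) = i" "(i * (n + 1) + v) mod (n + 1) = v"
      using that by (subst div_mult_self3 mod_mult_self3; simp)+
    then have "f (n + n * n + (i * (n + 1) + v)) \<longleftrightarrow> bval (drop i bs) = v"
      unfolding f_def by (simp del: mult_Suc_right)
    with less show ?thesis unfolding suffix_value_def U by (simp add: add.assoc)
  qed
  have part: "partition_on {..<n} (P ` {1..m})" and inj: "inj_on P {1..m}"
    and trans: "\<And>i j v. 1 \<le> i \<Longrightarrow> i \<le> j \<Longrightarrow> j \<le> m \<Longrightarrow> v \<in> P j \<Longrightarrow> \<exists>u \<in> P i. {u, v} \<in> E"
    using P by (auto simp: total_transitive_partition_def)
  have sub: "P c \<subseteq> {..<n}" if "c \<in> {1..m}" for c using partition_onD1[OF part] that by auto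
  have c1: "\<forall>i<n. has_bit x i" "\<not> has_bit x n" using N by (auto simp: x nth_encode)
  have c2: "\<forall>i<n. \<forall>j<n. adjacent (has_bit x) n i j \<longrightarrow>
      adjacent (has_bit x) n j i \<and> i \<noteq> j \<and> (?U i \<longleftrightarrow> \<not> ?U j)"
  proof (intro allI impI)
    fix i j assume ij: "i < n" "j < n" "adjacent (has_bit x) n i j"
    then have e: "{i, j} \<in> E" by (simp add: adj)
    have "adjacent (has_bit x) n j i" using ij e by (simp add: adj insert_commute)
    moreover have "i \<noteq> j" using e G(1) by (force simp: simple_graph_def)
    moreover have "?U i \<longleftrightarrow> \<not> ?U j"
      using AB(3)[OF e] AB(2) ij by (auto simp: UA doubleton_eq_iff)
    ultimately show "adjacent (has_bit x) n j i \<and> i \<noteq> j \<and> (?U i \<longleftrightarrow> \<not> ?U j)" by blast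
  qed
  have c3: "\<forall>i<n. \<exists>j<n. adjacent (has_bit x) n i j"
  proof (intro allI impI)
    fix i assume "i < n"
    then obtain j where "j < n" "{j, i} \<in> E" using G(2) unfolding no_isolated_vertices_def by blast
    then show "\<exists>j<n. adjacent (has_bit x) n i j"
      using \<open>i < n\<close> by (intro exI[of _ j]) (simp add: adj insert_commute)
  qed
  have c4: "\<forall>i<l. l = Suc i \<longrightarrow> has_bit x (n + 1 + n * n + 1 + i)"
  proof (intro allI impI)
    fix i assume i: "i < l" "l = Suc i"
    then have "bs \<noteq> []" "i = length bs - 1" by (auto simp: l_def)
    then have "bs ! i" using last_binary[of "nat \<bar>k\<bar>"] by (cases "k = 0") (auto simp: bs_def last_conv_nth binary_0)
    then show "has_bit x (n + 1 + n * n + 1 + i)" using i by (simp only: xb)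
  qed
  have c5: "has_bit x (n + 1 + n * n) \<longrightarrow> l \<noteq> 0"
    unfolding xs by (simp add: l_def bs_def binary_eq_Nil)
  have c6: "has_bit x (n + 1 + n * n) \<or> suffix_value ?U n l 0 \<and>
      (\<forall>i<l. \<forall>v<Suc m. suffix_value ?U n (Suc i) v \<longrightarrow>
        (\<exists>v'<Suc m. v' = 2 * v + of_bool (has_bit x (n + 1 + n * n + 1 + i)) \<and> suffix_value ?U n i v'))"
  proof (cases "k < 0")
    case False
    then have bm: "bval bs \<le> m" using k by (simp add: bs_def bval_binary)
    show ?thesis
    proof (intro disjI2 conjI allI impI)
      show "suffix_value ?U n l 0" by (simp add: UV l_def)
      fix i v assume iv: "i < l" "v < Suc m" "suffix_value ?U n (Suc i) v"
      then have v: "bval (drop (Suc i) bs) = v" using UV[of "Suc i" v] m by simp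
      have "drop i bs = bs ! i # drop (Suc i) bs" using iv by (simp add: Cons_nth_drop_Suc l_def)
      then have "bval (drop i bs) = 2 * v + of_bool (has_bit x (n + 1 + n * n + 1 + i))"
        using v iv unfolding xb by simp
      moreover have "bval (drop i bs) \<le> m" using bval_drop_le bm by (rule order_trans)
      ultimately show "\<exists>v'<Suc m. v' = 2 * v + of_bool (has_bit x (n + 1 + n * n + 1 + i)) \<and> suffix_value ?U n i v'"
        using UV[of i "bval (drop i bs)"] iv m by (intro exI[of _ "bval (drop i bs)"]) auto
    qed
  qed (use xs in blast)
  have c7: "\<forall>i<n. \<exists>c<m. in_part ?U n i c \<and> (\<forall>c'<m. in_part ?U n i c' \<longrightarrow> c' = c)"
  proof (intro allI impI)
    fix i assume i: "i < n"
    then obtain c where c: "c \<in> {1..m}" "i \<in> P c" using partition_onD1[OF part] by blast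
    have "c' = c - 1" if "c' < m" "in_part ?U n i c'" for c'
    proof -
      have c': "i \<in> P (Suc c')" "Suc c' \<in> {1..m}" using that UP[of i c'] i m by auto
      then have "P (Suc c') = P c"
        using disjointD[OF partition_onD2[OF part], of "P (Suc c')" "P c"] c by auto
      then show ?thesis using inj_onD[OF inj, of "Suc c'" c] c' c by simp
    qed
    then show "\<exists>c<m. in_part ?U n i c \<and> (\<forall>c'<m. in_part ?U n i c' \<longrightarrow> c' = c)"
      using c UP[of i "c - 1"] i m by (intro exI[of _ "c - 1"]) auto
  qed
  have c8: "\<forall>c<m. \<exists>i<n. in_part ?U n i c"
  proof (intro allI impI)
    fix c assume c: "c < m"
    then have "P (Suc c) \<in> P ` {1..m}" by simp
    then have "P (Suc c) \<noteq> {}" using partition_onD3[OF part] by metis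
    then obtain i where "i \<in> P (Suc c)" by blast
    moreover from this have "i < n" using sub[of "Suc c"] c by auto
    ultimately show "\<exists>i<n. in_part ?U n i c" using UP[of i c] c m by auto
  qed
  have c9: "\<forall>c<m. \<forall>c'<Suc c. \<forall>i<n. in_part ?U n i c \<longrightarrow>
      (\<exists>j<n. in_part ?U n j c' \<and> adjacent (has_bit x) n i j)"
  proof (intro allI impI)
    fix c c' i assume c: "c < m" "c' < Suc c" "i < n" "in_part ?U n i c"
    then have "i \<in> P (Suc c)" using UP[of i c] m by simp
    then obtain j where j: "j \<in> P (Suc c')" "{j, i} \<in> E" using trans[of "Suc c'" "Suc c" i] c by auto
    then have "j < n" using sub[of "Suc c'"] c by auto
    then show "\<exists>j<n. in_part ?U n j c' \<and> adjacent (has_bit x) n i j"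
      using j c m UP[of j c'] by (intro exI[of _ j]) (auto simp: adj insert_commute)
  qed
  have c0: "n < N" "l < N" "n + 1 + n * n + 1 + l = N" "m < Suc n" using N m by auto
  have "certificate (has_bit x) ?U N"
    unfolding certificate_def
    by (rule exI[of _ n], intro conjI c0 c1 c2 c3, rule exI[of _ l], intro conjI c0 c4 c5,
        rule exI[of _ m], intro conjI c0 c6 c7 c8 c9)
  moreover have "length u \<le> poly [:0, 1, 2:] N"
  proof -
    have "n \<le> N" "l + 1 \<le> N" "n + 1 \<le> N" using N by simp_all
    then have "n * n \<le> N * N" "(l + 1) * (n + 1) \<le> N * N" "n \<le> N" by (blast intro: mult_le_mono)+
    then show ?thesis by (simp add: u_def L_def algebra_simps)
  qed
  ultimately show ?thesis unfolding N_def by blast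
qed

section \<open>Parsing of pairs\<close>

lemma length_pair: "length (pair x u) = 2 * length x + 2 + length u"
  by (induction x) (auto simp: pair_def)

lemma nth_pair_doubled: "i < length x \<Longrightarrow> pair x u ! (2 * i) = x ! i \<and> pair x u ! (2 * i + 1) = x ! i"
proof (induction x arbitrary: i)
  case (Cons b x)
  have "pair (b # x) u = b # b # pair x u" by (simp add: pair_def)
  then show ?case using Cons by (cases i) auto
qed simp

lemma nth_pair_rest:
  "pair x u ! (2 * length x) = False" "pair x u ! (2 * length x + 1) = True"
  "pair x u ! (2 * length x + 2 + i) = u ! i"
  by (induction x) (auto simp: pair_def)

text \<open>Bits before the delimiter agree in twos and those of the delimiter do not, so the
  \<open>N\<close> in the definition of \<open>verifier\<close> can only be the length of
  \<open>x\<close>.\<close>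

lemma verifier_pair: "verifier (pair x u) \<longleftrightarrow> certificate (has_bit x) (has_bit u) (length x)"
proof -
  let ?w = "pair x u"
  have w: "has_bit ?w (2 * i) \<longleftrightarrow> has_bit x i" "has_bit ?w (2 * i + 1) \<longleftrightarrow> has_bit x i" if "i < length x" for i
    using nth_pair_doubled[OF that] that by (auto simp: has_bit_def length_pair)
  have d: "\<not> has_bit ?w (2 * length x)" "has_bit ?w (2 * length x + 1)"
    by (auto simp: has_bit_def length_pair nth_pair_rest[simplified])
  have u: "has_bit ?w (2 * length x + 2 + i) \<longleftrightarrow> has_bit u i" for i
    unfolding has_bit_def nth_pair_rest length_pair by simp
  have N: "N = length x" if "\<And>i. i < N \<Longrightarrow> has_bit ?w (2 * i) \<longleftrightarrow> has_bit ?w (2 * i + 1)"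
    "\<not> has_bit ?w (2 * N)" "has_bit ?w (2 * N + 1)" for N
    using that d w by (cases N "length x" rule: linorder_cases) blast+
  have X: "(\<lambda>i. i < length x \<and> has_bit ?w (2 * i)) = has_bit x"
    using w by (auto simp: fun_eq_iff has_bit_def)
  have U: "(\<lambda>i. has_bit ?w (2 * length x + 2 + i)) = has_bit u" using u by (rule ext)
  have "verifier ?w \<longleftrightarrow> certificate (\<lambda>i. i < length x \<and> has_bit ?w (2 * i))
      (\<lambda>i. has_bit ?w (2 * length x + 2 + i)) (length x)"
    (is "_ \<longleftrightarrow> ?c")
  proof
    assume "verifier ?w"
    then obtain M where M: "\<forall>i<M. has_bit ?w (2 * i) \<longleftrightarrow> has_bit ?w (2 * i + 1)"
        "\<not> has_bit ?w (2 * M)" "has_bit ?w (2 * M + 1)"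
      and c: "certificate (\<lambda>i. i < M \<and> has_bit ?w (2 * i)) (\<lambda>i. has_bit ?w (2 * M + 2 + i)) M"
      unfolding verifier_def by blast
    have "M = length x" using M by (intro N) blast+
    then show ?c using c by simp
  next
    assume ?c
    then show "verifier ?w"
      unfolding verifier_def using d w length_pair[of x u] by (intro exI[of _ "length x"] conjI) simp_all
  qed
  then show ?thesis unfolding X U .
qed

theorem max_total_transitivity_in_NP: "max_total_transitivity_problem bipartite \<in> class_NP"
proof -
  have "x \<in> max_total_transitivity_problem bipartite \<longleftrightarrow>
      (\<exists>u. length u \<le> poly [:0, 1, 2:] (length x) \<and> pair x u \<in> {w. verifier w})" for x
    using certificate_sound[of x] certificate_complete
    by (auto simp: verifier_pair max_total_transitivity_problem_def)
  then show ?thesis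
    unfolding class_NP_def using class_P_definable[OF fm_verifier] by blast
qed

section \<open>From satisfiability to total transitivity\<close>

text \<open>
  A CNF formula with variables \<open>v < n\<close> and clauses \<open>J < m\<close>: the literals of \<open>v\<close> are \<open>2 * v\<close>
  (positive) and \<open>2 * v + 1\<close> (negative), and \<open>C I J\<close> says that literal \<open>I\<close> occurs in clause \<open>J\<close>.
\<close>

definition satisfies :: "nat \<Rightarrow> nat \<Rightarrow> (nat \<Rightarrow> nat \<Rightarrow> bool) \<Rightarrow> (nat \<Rightarrow> bool) \<Rightarrow> bool" where
  "satisfies n m C s \<longleftrightarrow> (\<forall>J<m. \<exists>v<n. C (2 * v) J \<and> s v \<or> C (2 * v + 1) J \<and> \<not> s v)"

text \<open>
  The literals come first in the numbering of the vertices, then the vertices adjacent to all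
  literals, the pairs of opposite literals, and the clauses.
\<close>

definition arc :: "nat \<Rightarrow> nat \<Rightarrow> (nat \<Rightarrow> nat \<Rightarrow> bool) \<Rightarrow> nat \<Rightarrow> nat \<Rightarrow> bool" where
  "arc n m C a w \<longleftrightarrow> a < 2 * n \<and>
     (2 * n \<le> w \<and> w < 3 * n + 1 \<or>
      (\<exists>v<n. w = 3 * n + 1 + v \<and> (a = 2 * v \<or> a = 2 * v + 1)) \<or>
      (\<exists>J<m. w = 4 * n + 1 + J \<and> C a J))"

definition cnf_edges :: "nat \<Rightarrow> nat \<Rightarrow> (nat \<Rightarrow> nat \<Rightarrow> bool) \<Rightarrow> nat set set" where
  "cnf_edges n m C = {{a, w} | a w. arc n m C a w}"

context
  fixes n m :: nat and C :: "nat \<Rightarrow> nat \<Rightarrow> bool"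
begin

abbreviation "cnf_order \<equiv> 4 * n + 1 + m"
abbreviation "cnf_graph \<equiv> cnf_edges n m C"

lemma arc_less: "arc n m C a w \<Longrightarrow> a < 2 * n \<and> 2 * n \<le> w \<and> w < cnf_order"
  by (auto simp: arc_def)

lemma in_cnf_edges: "{u, v} \<in> cnf_graph \<longleftrightarrow> arc n m C u v \<or> arc n m C v u"
  unfolding cnf_edges_def by (auto simp: doubleton_eq_iff)

lemma vertex_cases:
  assumes "u < cnf_order"
  obtains "u < 2 * n" | "2 * n \<le> u" "u < 3 * n + 1" | v where "v < n" "u = 3 * n + 1 + v"
  | J where "J < m" "u = 4 * n + 1 + J"
proof -
  consider "u < 2 * n" | "2 * n \<le> u" "u < 3 * n + 1" | "3 * n + 1 \<le> u" "u < 4 * n + 1" | "4 * n + 1 \<le> u"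
    by linarith
  then show thesis
  proof cases
    case 3
    then show ?thesis using that(3)[of "u - (3 * n + 1)"] by simp
  next
    case 4
    then show ?thesis using that(4)[of "u - (4 * n + 1)"] assms by simp
  qed (use that in auto)
qed

lemma simple_graph_cnf: "simple_graph {..<cnf_order} cnf_graph"
  unfolding simple_graph_def
proof (intro conjI ballI)
  fix e assume "e \<in> cnf_graph"
  then obtain a w where "e = {a, w}" "arc n m C a w" by (auto simp: cnf_edges_def)
  then show "e \<subseteq> {..<cnf_order}" "card e = 2" using arc_less[of a w] by auto
qed simp

lemma bipartite_cnf: "bipartite {..<cnf_order} cnf_graph"
  unfolding bipartite_def
proof (intro exI conjI ballI)
  fix e assume "e \<in> cnf_graph"
  then obtain a w where "e = {a, w}" "arc n m C a w" by (auto simp: cnf_edges_def)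
  then show "\<exists>a \<in> {..<2 * n}. \<exists>w \<in> {2 * n..<cnf_order}. e = {a, w}"
    using arc_less[of a w] by (intro bexI[of _ a] bexI[of _ w]) auto
qed auto

lemma no_isolated_vertices_cnf:
  assumes "0 < n" and ne: "\<And>J. J < m \<Longrightarrow> \<exists>I<2 * n. C I J"
  shows "no_isolated_vertices {..<cnf_order} cnf_graph"
  unfolding no_isolated_vertices_def
proof
  fix u assume "u \<in> {..<cnf_order}"
  then have "u < cnf_order" by simp
  then show "\<exists>v\<in>{..<cnf_order}. {v, u} \<in> cnf_graph"
    unfolding in_cnf_edges
  proof (cases rule: vertex_cases)
    case 1
    then show "\<exists>v\<in>{..<cnf_order}. arc n m C v u \<or> arc n m C u v" by (intro bexI[of _ "2 * n"]) (auto simp: arc_def)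
  next
    case 2
    then show "\<exists>v\<in>{..<cnf_order}. arc n m C v u \<or> arc n m C u v"
      using assms(1) by (intro bexI[of _ 0]) (auto simp: arc_def)
  next
    case (3 v)
    then show "\<exists>v\<in>{..<cnf_order}. arc n m C v u \<or> arc n m C u v" by (intro bexI[of _ "2 * v"]) (auto simp: arc_def)
  next
    case (4 J)
    then obtain I where "I < 2 * n" "C I J" using ne by blast
    then show "\<exists>v\<in>{..<cnf_order}. arc n m C v u \<or> arc n m C u v" using 4 by (intro bexI[of _ I]) (auto simp: arc_def)
  qed
qed

text \<open>For \<open>2 \<le> i\<close> part \<open>i\<close> is a single edge: the false literal
  of variable \<open>i - 2\<close> and the vertex \<open>2 * n + i - 1\<close>, which is adjacent to
  all literals. Everything else is in part 1, including the vertex \<open>2 * n\<close>. A literal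
  has such a vertex as a neighbour in every part, and such a vertex has a literal in every part;
  since \<open>n\<close> is positive, there is a true literal for part 1.\<close>

lemma satisfies_imp_partition:
  assumes n: "0 < n" and s: "satisfies n m C s"
  shows "\<exists>P. total_transitive_partition {..<cnf_order} cnf_graph (n + 1) P"
proof -
  define tl where "tl v = (if s v then 2 * v else 2 * v + 1)" for v
  define fl where "fl v = (if s v then 2 * v + 1 else 2 * v)" for v
  define c where "c u = (if u < 2 * n then if u = fl (u div 2) then u div 2 + 2 else 1
      else if u < 3 * n + 1 then u - 2 * n + 1 else 1)" for u
  have tl: "tl v < 2 * n" "c (tl v) = 1" and fl: "fl v < 2 * n" "c (fl v) = v + 2" if "v < n" for v
    using that by (auto simp: tl_def fl_def c_def)
  have c_range: "c u \<in> {1..n + 1}" if "u < cnf_order" for u by (auto simp: c_def)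
  define P where "P i = {u. u < cnf_order \<and> c u = i}" for i
  have b: "2 * n + (i - 1) \<in> P i" if "i \<in> {1..n + 1}" for i
    using that n by (auto simp: P_def c_def)
  have "partition_on {..<cnf_order} (P ` {1..n + 1})"
  proof (rule partition_onI)
    show "\<Union> (P ` {1..n + 1}) = {..<cnf_order}" using c_range by (auto simp: P_def)
    show "{} \<notin> P ` {1..n + 1}" using b by blast
    show "disjnt p q" if "p \<in> P ` {1..n + 1}" "q \<in> P ` {1..n + 1}" "p \<noteq> q" for p q
      using that by (auto simp: P_def disjnt_def)
  qed
  moreover have "inj_on P {1..n + 1}"
  proof (rule inj_onI)
    fix i j assume ij: "i \<in> {1..n + 1}" "j \<in> {1..n + 1}" "P i = P j"
    have "2 * n + (i - 1) \<in> P j" using b[OF ij(1)] unfolding ij(3) .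
    with b[OF ij(1)] show "i = j" unfolding P_def by simp
  qed
  moreover have "\<exists>v \<in> P i. {v, u} \<in> cnf_graph" if "1 \<le> i" "i \<le> j" "j \<le> n + 1" "u \<in> P j" for i j u
  proof -
    have u: "u < cnf_order" "c u = j" using that by (auto simp: P_def)
    from u(1) show ?thesis
      unfolding in_cnf_edges
    proof (cases rule: vertex_cases)
      case 1
      then show "\<exists>v\<in>P i. arc n m C v u \<or> arc n m C u v"
        using b[of i] that by (intro bexI[of _ "2 * n + (i - 1)"]) (auto simp: arc_def)
    next
      case 2
      show "\<exists>v\<in>P i. arc n m C v u \<or> arc n m C u v"
      proof (cases "i = 1")
        case True
        then show ?thesis using tl[of 0] n 2 by (intro bexI[of _ "tl 0"]) (auto simp: arc_def P_def)
      next
        case False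
        then have i: "i - 2 < n" "i - 2 + 2 = i" using that by auto
        then show ?thesis
          using fl[OF i(1)] 2 by (intro bexI[of _ "fl (i - 2)"]) (auto simp: arc_def P_def)
      qed
    next
      case (3 v)
      then have "i = 1" using u that by (simp add: c_def)
      then show "\<exists>v\<in>P i. arc n m C v u \<or> arc n m C u v"
        using tl[of v] 3 by (intro bexI[of _ "tl v"]) (auto simp: arc_def P_def tl_def)
    next
      case (4 J)
      then have "i = 1" using u that by (simp add: c_def)
      obtain v where "v < n" "C (tl v) J" using s 4 by (auto simp: satisfies_def tl_def)
      then show "\<exists>v\<in>P i. arc n m C v u \<or> arc n m C u v"
        using tl[of v] 4 \<open>i = 1\<close> by (intro bexI[of _ "tl v"]) (auto simp: arc_def P_def)
    qed
  qed
  ultimately show ?thesis unfolding total_transitive_partition_def by blast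
qed

text \<open>
  A vertex \<open>w\<close> of the last part that is not a literal has neighbours, hence literals, in all
  parts. As one literal of each pair is in the first part, exactly one is not.
\<close>

lemma partition_imp_satisfies:
  assumes n: "0 < n" and M: "n + 1 \<le> M" and P: "total_transitive_partition {..<cnf_order} cnf_graph M P"
  shows "satisfies n m C (\<lambda>v. 2 * v \<in> P 1)"
proof -
  have part: "partition_on {..<cnf_order} (P ` {1..M})" and inj: "inj_on P {1..M}"
    and trans: "\<And>i j v. 1 \<le> i \<Longrightarrow> i \<le> j \<Longrightarrow> j \<le> M \<Longrightarrow> v \<in> P j \<Longrightarrow> \<exists>u \<in> P i. {u, v} \<in> cnf_graph"
    using P by (auto simp: total_transitive_partition_def)
  have first: "\<exists>a \<in> P 1. {a, u} \<in> cnf_graph" if "u < cnf_order" for u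
  proof -
    obtain j where "j \<in> {1..M}" "u \<in> P j" using partition_onD1[OF part] \<open>u < cnf_order\<close> by blast
    then show ?thesis using trans[of 1 j u] by auto
  qed
  have disj: "i = j" if "i \<in> {1..M}" "j \<in> {1..M}" "u \<in> P i" "u \<in> P j" for i j u
    using disjointD[OF partition_onD2[OF part], of "P i" "P j"] inj_onD[OF inj, of i j] that by auto
  have pair: "2 * v \<in> P 1 \<or> 2 * v + 1 \<in> P 1" if "v < n" for v
  proof -
    have "3 * n + 1 + v < cnf_order" using that by simp
    then obtain a where "a \<in> P 1" "{a, 3 * n + 1 + v} \<in> cnf_graph" using first by blast
    then show ?thesis using that unfolding in_cnf_edges arc_def by auto
  qed
  have "P M \<in> P ` {1..M}" using M by simp
  then have "P M \<noteq> {}" using partition_onD3[OF part] by metis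
  then obtain u where u: "u \<in> P M" by blast
  then obtain v where v: "v \<in> P M" "{v, u} \<in> cnf_graph" using trans[of M M u] M by auto
  \<comment> \<open>Of the two adjacent vertices \<open>u\<close> and \<open>v\<close> of the last
    part, one is not a literal because the graph is bipartite.\<close>
  obtain w where w: "w \<in> P M" "2 * n \<le> w"
    using u v unfolding in_cnf_edges by (auto dest!: arc_less)
  have "\<exists>a. a \<in> P i \<and> a < 2 * n" if i: "i \<in> {2..n + 1}" for i
  proof -
    obtain a where "a \<in> P i" "{a, w} \<in> cnf_graph" using trans[of i M w] w(1) i M by auto
    then show ?thesis using w(2) unfolding in_cnf_edges by (auto dest!: arc_less)
  qed
  then obtain a where a: "\<And>i. i \<in> {2..n + 1} \<Longrightarrow> a i \<in> P i" "\<And>i. i \<in> {2..n + 1} \<Longrightarrow> a i < 2 * n"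
    by metis
  have notin: "a i \<notin> P 1" if "i \<in> {2..n + 1}" for i
    using disj[of i 1 "a i"] a(1)[OF that] that M by auto
  \<comment> \<open>Two literals of one variable that both avoid the first part are equal, because
    the first part contains a literal of that variable.\<close>
  have "inj_on (\<lambda>i. a i div 2) {2..n + 1}"
  proof (rule inj_onI)
    fix i j assume ij: "i \<in> {2..n + 1}" "j \<in> {2..n + 1}" "a i div 2 = a j div 2"
    define v where "v = a i div 2"
    have v: "v < n" "a i = 2 * v \<or> a i = 2 * v + 1" "a j = 2 * v \<or> a j = 2 * v + 1"
      using a(2)[OF ij(1)] ij(3) by (auto simp: v_def)
    then have "a i = a j" using pair[of v] notin[OF ij(1)] notin[OF ij(2)] by auto
    then show "i = j" using disj[of i j "a i"] a(1)[OF ij(1)] a(1)[OF ij(2)] ij M by auto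
  qed
  moreover have "(\<lambda>i. a i div 2) ` {2..n + 1} \<subseteq> {..<n}" using a(2) by fastforce
  \<comment> \<open>There are \<open>n\<close> parts after the first up to part \<open>n + 1\<close>
    and \<open>n\<close> variables, so every variable has a literal outside the first part.\<close>
  ultimately have surj: "(\<lambda>i. a i div 2) ` {2..n + 1} = {..<n}"
    by (intro card_subset_eq) (auto simp: card_image)
  have one: "2 * v \<notin> P 1 \<or> 2 * v + 1 \<notin> P 1" if v: "v < n" for v
  proof -
    have "v \<in> (\<lambda>i. a i div 2) ` {2..n + 1}" using v surj by simp
    then obtain i where i: "i \<in> {2..n + 1}" "v = a i div 2" by blast
    then have "a i = 2 * v \<or> a i = 2 * v + 1" by linarith
    then show ?thesis using notin[OF i(1)] by auto
  qed
  show ?thesis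
    unfolding satisfies_def
  proof (intro allI impI)
    fix J assume J: "J < m"
    then obtain I where I: "I \<in> P 1" "{I, 4 * n + 1 + J} \<in> cnf_graph" using first[of "4 * n + 1 + J"] by auto
    then have IC: "I < 2 * n" "C I J" unfolding in_cnf_edges by (auto simp: arc_def)
    define v where "v = I div 2"
    have v: "v < n" "I = 2 * v \<or> I = 2 * v + 1" using IC by (auto simp: v_def)
    then show "\<exists>v<n. C (2 * v) J \<and> 2 * v \<in> P 1 \<or> C (2 * v + 1) J \<and> 2 * v \<notin> P 1"
      using one[of v] I IC by auto
  qed
qed

end

text \<open>The levels come from the nesting of quantifiers in \<open>B\<close>: the output position
  is variable 1, row and column are 2 and 3, the ends of an arc are 4 and 5, and the clause is 6.
  The last premise keeps the vertices of clauses from being isolated.\<close>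

theorem poly_reducible_cnf:
  fixes n m :: "bool list \<Rightarrow> nat" and C :: "bool list \<Rightarrow> nat \<Rightarrow> nat \<Rightarrow> bool"
  assumes n: "trm_definable (\<lambda>x e. n x)" and m: "trm_definable (\<lambda>x e. m x)"
    and C: "fm_definable 7 (\<lambda>x e. C x (e 4) (e 6))"
    and pos: "\<And>x. 0 < n x" and ne: "\<And>x J. J < m x \<Longrightarrow> \<exists>I<2 * n x. C x I J"
  shows "poly_reducible {x. \<exists>s. satisfies (n x) (m x) (C x) s} (max_total_transitivity_problem bipartite)"
proof -
  define N where "N x = 4 * n x + 1 + m x" for x
  define E where "E x = cnf_edges (n x) (m x) (C x)" for x
  \<comment> \<open>The delimiter and the sign are no entries of the matrix and thus
    \<open>False\<close>. Both orientations are covered by quantifying over the ends of the arc, so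
    that \<open>C\<close> occurs just once and with fixed variables.\<close>
  define B where "B x z \<longleftrightarrow> z < N x \<or> (\<exists>i<N x. \<exists>j<N x. z = N x + 1 + i * N x + j \<and>
      (\<exists>a<N x. \<exists>w<N x. (i = a \<and> j = w \<or> i = w \<and> j = a) \<and> arc (n x) (m x) (C x) a w))" for x z
  let ?f = "\<lambda>x. map (B x) [0..<N x + 1 + N x * N x + 1] @ binary (n x + 1)"
  have tN: "trm_definable (\<lambda>x e. N x)" unfolding N_def by (intro definable n m)
  have "fm_definable 2 (\<lambda>x e. B x (e 1))"
    unfolding B_def arc_def by (intro definable tN n m; simp add: C)
  then have "poly_time_computable ?f"
    by (intro poly_time_computable_definable definable tN n)
  moreover have "x \<in> {x. \<exists>s. satisfies (n x) (m x) (C x) s} \<longleftrightarrow> ?f x \<in> max_total_transitivity_problem bipartite" for x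
  proof -
    have G: "simple_graph {..<N x} (E x)" "bipartite {..<N x} (E x)" "no_isolated_vertices {..<N x} (E x)"
      unfolding N_def E_def
      by (rule simple_graph_cnf bipartite_cnf no_isolated_vertices_cnf[OF pos ne]; assumption)+
    have less: "i * N x + j < N x * N x" if "i < N x" "j < N x" for i j
      using matrix_index_less[OF that] .
    have "?f x = encode (N x) (E x) (int (n x) + 1)"
    proof (rule encode_eqI)
      have [simp]: "nat (int (n x) + 1) = Suc (n x)" by linarith
      show "length (?f x) = N x + 1 + N x * N x + 1 + length (binary (nat \<bar>int (n x) + 1\<bar>))" by simp
      show "?f x ! i" if "i < N x" for i
        using that by (simp add: nth_append B_def del: upt_Suc)
      show "\<not> ?f x ! N x"
        by (simp add: nth_append B_def del: upt_Suc)
      show "?f x ! (N x + 1 + N x * N x) \<longleftrightarrow> int (n x) + 1 < 0"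
        using less by (simp add: nth_append B_def del: upt_Suc) fastforce
      show "?f x ! (N x + 1 + N x * N x + 1 + i) = binary (nat \<bar>int (n x) + 1\<bar>) ! i" for i
        by (simp add: nth_append del: upt_Suc)
      fix i j assume ij: "i < N x" "j < N x"
      have uniq: "i' = i \<and> j' = j" if "i' < N x" "j' < N x" "i * N x + j = i' * N x + j'" for i' j'
      proof -
        have "(i * N x + j) div N x = i" "(i * N x + j) mod N x = j"
          "(i' * N x + j') div N x = i'" "(i' * N x + j') mod N x = j'"
          using that(1,2) ij by auto
        then show ?thesis using that(3) by metis
      qed
      have "?f x ! (N x + 1 + i * N x + j) \<longleftrightarrow> B x (N x + 1 + i * N x + j)"
        using less[OF ij] by (simp add: nth_append del: upt_Suc)
      also have "\<dots> \<longleftrightarrow> (\<exists>i'<N x. \<exists>j'<N x. i * N x + j = i' * N x + j' \<and>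
          (\<exists>a<N x. \<exists>w<N x. (i' = a \<and> j' = w \<or> i' = w \<and> j' = a) \<and> arc (n x) (m x) (C x) a w))"
        by (simp add: B_def add.assoc)
      also have "\<dots> \<longleftrightarrow> (\<exists>a<N x. \<exists>w<N x. (i = a \<and> j = w \<or> i = w \<and> j = a) \<and> arc (n x) (m x) (C x) a w)"
        using uniq ij by blast
      also have "\<dots> \<longleftrightarrow> {i, j} \<in> E x"
        unfolding E_def in_cnf_edges using ij by auto
      finally show "?f x ! (N x + 1 + i * N x + j) \<longleftrightarrow> {i, j} \<in> E x" .
    qed
    moreover have "encode (N x) (E x) (int (n x) + 1) \<in> max_total_transitivity_problem bipartite \<longleftrightarrow>
        (\<exists>M P. n x + 1 \<le> M \<and> total_transitive_partition {..<N x} (E x) M P)"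
    proof
      assume "encode (N x) (E x) (int (n x) + 1) \<in> max_total_transitivity_problem bipartite"
      then obtain N' E' k' M P where e: "encode (N x) (E x) (int (n x) + 1) = encode N' E' k'"
        and G': "simple_graph {..<N'} E'" and M: "int M \<ge> k'" "total_transitive_partition {..<N'} E' M P"
        unfolding max_total_transitivity_problem_def by blast
      have "n x + 1 \<le> M" "total_transitive_partition {..<N x} (E x) M P"
        using encode_inject[OF G(1) G' e] M by auto
      then show "\<exists>M P. n x + 1 \<le> M \<and> total_transitive_partition {..<N x} (E x) M P" by blast
    next
      assume "\<exists>M P. n x + 1 \<le> M \<and> total_transitive_partition {..<N x} (E x) M P"
      then obtain M P where "n x + 1 \<le> M" and P: "total_transitive_partition {..<N x} (E x) M P" by blast
      then have "int M \<ge> int (n x) + 1" by simp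
      with P show "encode (N x) (E x) (int (n x) + 1) \<in> max_total_transitivity_problem bipartite"
        using G unfolding max_total_transitivity_problem_def by blast
    qed
    moreover have "(\<exists>M P. n x + 1 \<le> M \<and> total_transitive_partition {..<N x} (E x) M P) \<longleftrightarrow>
        (\<exists>s. satisfies (n x) (m x) (C x) s)"
      using satisfies_imp_partition[OF pos, of x "m x" "C x"] partition_imp_satisfies[OF pos, of x _ "m x" "C x"]
      unfolding N_def E_def by blast
    ultimately show ?thesis by simp
  qed
  ultimately show ?thesis unfolding poly_reducible_def by blast
qed

text \<open>
  A clause template has a guard and a list of literals, whose atoms have a kind and two indices.
  All of them depend on the input and on three indices below a bound.
\<close>

type_synonym 'a indexed = "bool list \<Rightarrow> nat \<Rightarrow> nat \<Rightarrow> nat \<Rightarrow> 'a"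
type_synonym 'k literal = "bool \<times> 'k \<times> nat indexed \<times> nat indexed"
type_synonym 'k template = "bool indexed \<times> 'k literal list"

definition literal_true :: "('k \<Rightarrow> nat \<Rightarrow> nat \<Rightarrow> bool) \<Rightarrow> bool list \<Rightarrow> nat \<Rightarrow> nat \<Rightarrow> nat \<Rightarrow> 'k literal \<Rightarrow> bool" where
  "literal_true s x t p p' = (\<lambda>(b, k, f, g). s k (f x t p p') (g x t p p') = b)"

definition template_true :: "('k \<Rightarrow> nat \<Rightarrow> nat \<Rightarrow> bool) \<Rightarrow> nat \<Rightarrow> bool list \<Rightarrow> 'k template \<Rightarrow> bool" where
  "template_true s B x = (\<lambda>(g, ls). \<forall>t<B. \<forall>p<B. \<forall>p'<B. g x t p p' \<longrightarrow> (\<exists>l \<in> set ls. literal_true s x t p p' l))"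

text \<open>Levels 7, 8 and 9 are those of the three indices, which are quantified inside the
  predicate for literal 4 and clause 6. \<open>W\<close> bounds the indices of atoms, so that atoms
  can be numbered, and a nonempty list of literals provides a neighbour for the vertex of the
  clause.\<close>

definition template_definable :: "(bool list \<Rightarrow> nat) \<Rightarrow> (bool list \<Rightarrow> nat) \<Rightarrow> 'k template \<Rightarrow> bool" where
  "template_definable B W = (\<lambda>(g, ls). ls \<noteq> [] \<and> fm_definable 10 (\<lambda>x e. g x (e 7) (e 8) (e 9)) \<and>
     (\<forall>(b, k, f, h) \<in> set ls. trm_definable (\<lambda>x e. f x (e 7) (e 8) (e 9)) \<and>
        trm_definable (\<lambda>x e. h x (e 7) (e 8) (e 9)) \<and>
        (\<forall>x t p p'. t < B x \<longrightarrow> p < B x \<longrightarrow> p' < B x \<longrightarrow> f x t p p' < W x \<and> h x t p p' < W x)))"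

lemma template_definableD:
  assumes "template_definable B W tm"
  shows "snd tm \<noteq> []" "fm_definable 10 (\<lambda>x e. fst tm x (e 7) (e 8) (e 9))"
    and "(b, k, f, h) \<in> set (snd tm) \<Longrightarrow> trm_definable (\<lambda>x e. f x (e 7) (e 8) (e 9))"
    and "(b, k, f, h) \<in> set (snd tm) \<Longrightarrow> trm_definable (\<lambda>x e. h x (e 7) (e 8) (e 9))"
    and "(b, k, f, h) \<in> set (snd tm) \<Longrightarrow> t < B x \<Longrightarrow> p < B x \<Longrightarrow> p' < B x \<Longrightarrow> f x t p p' < W x \<and> h x t p p' < W x"
  using assms unfolding template_definable_def case_prod_beta by force+

lemma digits_eq:
  assumes "a < (n :: nat)" "a' < n" "a + n * c = a' + n * c'"
  shows "a = a' \<and> c = c'"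
proof
  show "a = a'" using arg_cong[OF assms(3), of "\<lambda>z. z mod n"] assms(1,2) by simp
  show "c = c'" using arg_cong[OF assms(3), of "\<lambda>z. z div n"] assms(1,2) by simp
qed

lemma digits_less: "a < (n :: nat) \<Longrightarrow> b < m \<Longrightarrow> a + n * b < n * m"
proof -
  assume "a < n" "b < m"
  then have "a + n * b < n * Suc b" by simp
  also have "\<dots> \<le> n * m" using \<open>b < m\<close> by (intro mult_le_mono2) simp
  finally show ?thesis .
qed

lemma digits_ex: "J < n * (m :: nat) \<Longrightarrow> \<exists>a<n. \<exists>b<m. J = a + n * b"
  by (intro exI[of _ "J mod n"] exI[of _ "J div n"] conjI)
    (auto intro!: mod_less_divisor gr0I simp: less_mult_imp_div_less mult.commute)

text \<open>Atoms and clause instances are numbered as digits in a mixed radix, with the finitely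
  many kinds that occur in \<open>ts\<close> coded by numbers.\<close>

theorem poly_reducible_templates:
  fixes ts :: "'k template list"
  assumes B: "trm_definable (\<lambda>x e. B x)" and W: "trm_definable (\<lambda>x e. W x)" "\<And>x. 0 < W x"
    and ts: "\<And>tm. tm \<in> set ts \<Longrightarrow> template_definable B W tm"
  shows "poly_reducible {x. \<exists>s. \<forall>tm \<in> set ts. template_true s (B x) x tm}
    (max_total_transitivity_problem bipartite)"
proof -
  define K where "K = fst ` snd ` (\<Union>tm \<in> set ts. set (snd tm))"
  have "finite K" unfolding K_def by auto
  then obtain code where code0: "bij_betw code K {0..<card K}" using ex_bij_betw_finite_nat by blast
  define nK where "nK = Suc (card K)"
  have code: "inj_on code K" "\<And>k. k \<in> K \<Longrightarrow> code k < nK"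
    using code0 bij_betwE[OF code0] by (auto simp: nK_def bij_betw_def less_Suc_eq)
  define nT where "nT = length ts"
  define var where "var x k a b = code k + nK * (a + W x * b)" for x k a b
  define lit where "lit x t p p' = (\<lambda>(b, k, f, h). 2 * var x k (f x t p p') (h x t p p') + (if b then 0 else 1))"
    for x and t p p' :: nat
  define cl where "cl x i t p p' = i + nT * (t + B x * (p + B x * p'))" for x i t p p'
  define n where "n x = nK * (W x * W x)" for x
  define m where "m x = nT * (B x * (B x * B x))" for x
  \<comment> \<open>Every number below \<open>m x\<close> has to be a clause. An instance whose
    guard fails becomes the clause of all literals, which every assignment satisfies as there is at
    least one variable.\<close>
  define C where "C x I J \<longleftrightarrow> (\<exists>t<B x. \<exists>p<B x. \<exists>p'<B x. \<exists>i \<in> set [0..<nT]. J = cl x i t p p' \<and>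
     (fst (ts ! i) x t p p' \<longrightarrow> (\<exists>l \<in> set (snd (ts ! i)). I = lit x t p p' l)))" for x I J
  have ti: "template_definable B W (ts ! i)" if "i < nT" for i
    using ts that by (simp add: nT_def)
  have litdef: "fm_definable d (\<lambda>x e. e 4 = lit x (e 7) (e 8) (e 9) l)" if "i < nT" "l \<in> set (snd (ts ! i))" for i l d
  proof -
    obtain b k f h where l: "l = (b, k, f, h)" by (cases l)
    note [definable] = template_definableD(3,4)[OF ti[OF that(1)] that(2)[unfolded l]] W(1)
    show ?thesis unfolding l lit_def var_def prod.case by (intro definable)
  qed
  have guard: "fm_definable 10 (\<lambda>x e. fst (ts ! i) x (e 7) (e 8) (e 9))" if "i < nT" for i
    by (rule template_definableD(2)[OF ti[OF that]])
  have inner: "fm_definable 10 (\<lambda>x e. \<exists>i \<in> set [0..<nT]. e 6 = cl x i (e 7) (e 8) (e 9) \<and>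
     (fst (ts ! i) x (e 7) (e 8) (e 9) \<longrightarrow> (\<exists>l \<in> set (snd (ts ! i)). e 4 = lit x (e 7) (e 8) (e 9) l)))"
  proof (rule fm_bex_list)
    fix i assume "i \<in> set [0..<nT]"
    then have i: "i < nT" by simp
    show "fm_definable 10 (\<lambda>x e. e 6 = cl x i (e 7) (e 8) (e 9) \<and>
       (fst (ts ! i) x (e 7) (e 8) (e 9) \<longrightarrow> (\<exists>l \<in> set (snd (ts ! i)). e 4 = lit x (e 7) (e 8) (e 9) l)))"
      unfolding cl_def by (rule fm_conj, (intro definable B)[1], intro fm_imp guard[OF i] fm_bex_list litdef[OF i])
  qed
  have var: "var x k a b < n x" if "k \<in> K" "a < W x" "b < W x" for x k a b
    unfolding var_def n_def by (intro digits_less code(2) that)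
  have lits: "k \<in> K \<and> f x t p p' < W x \<and> h x t p p' < W x"
    if "i < nT" "(b, k, f, h) \<in> set (snd (ts ! i))" "t < B x" "p < B x" "p' < B x" for i b k f h x t p p'
  proof -
    have "ts ! i \<in> set ts" using that(1) by (simp add: nT_def)
    then have "k \<in> K" using that(2) unfolding K_def
      by (intro image_eqI[of _ fst "(k, f, h)"] image_eqI[of _ snd "(b, k, f, h)"]) auto
    then show ?thesis using template_definableD(5)[OF ti[OF that(1)] that(2-)] by blast
  qed
  have lit_var: "lit x t p p' (b, k, f, h) = 2 * var x k (f x t p p') (h x t p p') + (if b then 0 else 1)"
    for x t p p' b k f h by (simp add: lit_def)
  have cl_less: "cl x i t p p' < m x" if "i < nT" "t < B x" "p < B x" "p' < B x" for x i t p p'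
    unfolding cl_def m_def by (intro digits_less that)
  have cl_eq: "i = i' \<and> t = t' \<and> p = q \<and> p' = q'"
    if "cl x i t p p' = cl x i' t' q q'" "i < nT" "t < B x" "p < B x" "i' < nT" "t' < B x" "q < B x"
    for x i t p p' i' t' q q'
  proof -
    note 1 = digits_eq[OF that(2,5) that(1)[unfolded cl_def]]
    note 2 = digits_eq[OF that(3,6) conjunct2[OF 1]]
    note 3 = digits_eq[OF that(4,7) conjunct2[OF 2]]
    show ?thesis using 1 2 3 by blast
  qed
  have cl_ex: "\<exists>i<nT. \<exists>t<B x. \<exists>p<B x. \<exists>p'<B x. J = cl x i t p p'" if "J < m x" for x J
    using that unfolding cl_def m_def by (metis digits_ex)
  have C_I: "C x I (cl x i t p p')"
    if "i < nT" "t < B x" "p < B x" "p' < B x"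
      "fst (ts ! i) x t p p' \<Longrightarrow> \<exists>l \<in> set (snd (ts ! i)). I = lit x t p p' l" for x i t p p' I
    unfolding C_def
    by (rule exI[of _ t], rule conjI[OF that(2)], rule exI[of _ p], rule conjI[OF that(3)],
        rule exI[of _ p'], rule conjI[OF that(4)], rule bexI[of _ i]) (use that in auto)
  have n_pos: "0 < n x" for x using W(2) by (simp add: n_def nK_def)
  have "poly_reducible {x. \<exists>s. satisfies (n x) (m x) (C x) s} (max_total_transitivity_problem bipartite)"
  proof (rule poly_reducible_cnf)
    show "trm_definable (\<lambda>x e. n x)" unfolding n_def by (intro definable W)
    show "trm_definable (\<lambda>x e. m x)" unfolding m_def by (intro definable B)
    show "0 < n x" for x by (rule n_pos)
    show "fm_definable 7 (\<lambda>x e. C x (e 4) (e 6))"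
      unfolding C_def by (rule fm_ex B)+ (use inner in simp_all)
    show "\<exists>I<2 * n x. C x I J" if J: "J < m x" for x J
    proof -
      obtain i t p p' where i: "i < nT" "t < B x" "p < B x" "p' < B x" "J = cl x i t p p'"
        using cl_ex[OF J] by blast
      have "snd (ts ! i) \<noteq> []" by (rule template_definableD(1)[OF ti[OF i(1)]])
      then obtain b k f h where l: "(b, k, f, h) \<in> set (snd (ts ! i))" by (metis list.set_sel(1) prod_cases4)
      have "lit x t p p' (b, k, f, h) < 2 * n x"
        using lits[OF i(1) l i(2-4)] var[where x = x and k = k and a = "f x t p p'" and b = "h x t p p'"] by (simp add: lit_var)
      moreover have "C x (lit x t p p' (b, k, f, h)) J"
        unfolding i(5) using i l by (intro C_I) auto
      ultimately show ?thesis by blast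
    qed
  qed
  moreover have "(\<exists>s. satisfies (n x) (m x) (C x) s) \<longleftrightarrow> (\<exists>s. \<forall>tm \<in> set ts. template_true s (B x) x tm)" for x
  proof (intro iffI; elim exE)
    fix s assume s: "satisfies (n x) (m x) (C x) s"
    define s' where "s' k a b = s (var x k a b)" for k a b
    have "\<exists>l \<in> set (snd (ts ! i)). literal_true s' x t p p' l"
      if i: "i < nT" "t < B x" "p < B x" "p' < B x" and g: "fst (ts ! i) x t p p'" for i t p p'
    proof -
      obtain v c where v: "C x (2 * v + (if c then 0 else 1)) (cl x i t p p')" "s v = c"
        using s cl_less[OF i] unfolding satisfies_def by force
      then obtain t' q q' i' where *: "t' < B x" "q < B x" "q' < B x" "i' < nT" "cl x i t p p' = cl x i' t' q q'"
        "fst (ts ! i') x t' q q' \<longrightarrow> (\<exists>l \<in> set (snd (ts ! i')). 2 * v + (if c then 0 else 1) = lit x t' q q' l)"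
        unfolding C_def by (elim exE conjE bexE) (rule that; simp)
      have "i = i' \<and> t = t' \<and> p = q \<and> p' = q'" by (rule cl_eq[OF *(5)]) (use i * in auto)
      then obtain l where l: "l \<in> set (snd (ts ! i))" "2 * v + (if c then 0 else 1) = lit x t p p' l"
        using *(6) g by auto
      obtain b k f h where l': "l = (b, k, f, h)" by (cases l)
      have "v = var x k (f x t p p') (h x t p p') \<and> c = b"
        using l(2) unfolding l' lit_var by (auto split: if_splits) presburger+
      then have "literal_true s' x t p p' l" using v(2) by (auto simp: l' literal_true_def s'_def)
      then show ?thesis using l(1) by blast
    qed
    then have "template_true s' (B x) x (ts ! i)" if "i < nT" for i
      using that unfolding template_true_def by (simp add: case_prod_beta)
    then show "\<exists>s. \<forall>tm \<in> set ts. template_true s (B x) x tm"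
      by (intro exI[of _ s']) (metis in_set_conv_nth nT_def)
  next
    fix s' assume s': "\<forall>tm \<in> set ts. template_true s' (B x) x tm"
    \<comment> \<open>The digits of the variable are decoded to recover the atom.\<close>
    define s where "s v = s' (inv_into K code (v mod nK)) (v div nK mod W x) (v div nK div W x)" for v
    have s: "s (var x k a b) = s' k a b" if "k \<in> K" "a < W x" for k a b
    proof -
      have "(code k + nK * c) mod nK = code k" "(code k + nK * c) div nK = c" for c
        using code(2)[OF that(1)] by auto
      then show ?thesis using that code(1) by (simp add: s_def var_def)
    qed
    have "\<exists>v<n x. C x (2 * v) J \<and> s v \<or> C x (2 * v + 1) J \<and> \<not> s v" if J: "J < m x" for J
    proof -
      obtain i t p p' where i: "i < nT" "t < B x" "p < B x" "p' < B x" "J = cl x i t p p'"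
        using cl_ex[OF J] by blast
      show ?thesis
      proof (cases "fst (ts ! i) x t p p'")
        case False
        then have "C x I J" for I
          unfolding i(5) using i by (intro C_I) auto
        then show ?thesis using n_pos by blast
      next
        case True
        have "template_true s' (B x) x (ts ! i)" using s' i(1) by (simp add: nT_def)
        then obtain b k f h where l: "(b, k, f, h) \<in> set (snd (ts ! i))" "literal_true s' x t p p' (b, k, f, h)"
          using True i(2-4) unfolding template_true_def case_prod_beta by (metis prod_cases4)
        define v where "v = var x k (f x t p p') (h x t p p')"
        note range = lits[OF i(1) l(1) i(2-4)]
        have "s v = b" using l(2) s range by (simp add: v_def literal_true_def)
        moreover have "v < n x" using var range by (simp add: v_def)
        moreover have "C x (lit x t p p' (b, k, f, h)) J"
          unfolding i(5) using i l by (intro C_I) auto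
        ultimately show ?thesis by (intro exI[of _ v]) (cases b; simp add: lit_var v_def[symmetric])
      qed
    qed
    then show "\<exists>s. satisfies (n x) (m x) (C x) s" unfolding satisfies_def by blast
  qed
  ultimately show ?thesis by simp
qed

section \<open>The computation tableau\<close>

text \<open>Halting becomes a transition that rewrites what it reads, so the rules of the tableau
  need no separate case for it.\<close>

definition next_act :: "machine \<Rightarrow> nat \<Rightarrow> nat list \<Rightarrow> nat \<times> (nat \<times> direction) list" where
  "next_act M q ss = (if q = halt M then (q, idle ss) else trans M q ss)"

lemma step_next_act:
  "step M c = (fst (next_act M (fst c) (map read_tape (snd c))),
     map2 act (snd (next_act M (fst c) (map read_tape (snd c)))) (snd c))"
  by (cases c) (auto simp: step_def next_act_def map2_act_idle case_prod_beta)

definition wf_config :: "machine \<Rightarrow> config \<Rightarrow> bool" where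
  "wf_config M c \<longleftrightarrow> fst c < num_states M \<and> length (snd c) = num_tapes M \<and>
     (\<forall>k<num_tapes M. \<forall>i. fst (snd c ! k) i < num_symbols M)"

lemma next_act_wf:
  assumes "turing_machine M" "q < num_states M" "length ss = num_tapes M" "set ss \<subseteq> {..<num_symbols M}"
  shows "fst (next_act M q ss) < num_states M" "length (snd (next_act M q ss)) = num_tapes M"
    "k < num_tapes M \<Longrightarrow> fst (snd (next_act M q ss) ! k) < num_symbols M"
proof -
  have *: "fst (next_act M q ss) < num_states M \<and> length (snd (next_act M q ss)) = num_tapes M \<and>
      fst ` set (snd (next_act M q ss)) \<subseteq> {..<num_symbols M}"
    using assms by (auto simp: next_act_def idle_def turing_machine_def)
  then show "fst (next_act M q ss) < num_states M" "length (snd (next_act M q ss)) = num_tapes M" by auto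
  show "fst (snd (next_act M q ss) ! k) < num_symbols M" if "k < num_tapes M"
  proof -
    have "snd (next_act M q ss) ! k \<in> set (snd (next_act M q ss))" using * that by simp
    then show ?thesis using * by blast
  qed
qed

lemma act_eq: "act a tp = ((fst tp)(snd tp := fst a), snd tp + shift (snd a))"
  by (cases a; cases tp) simp

lemma wf_config_read:
  assumes "wf_config M c"
  shows "length (map read_tape (snd c)) = num_tapes M" "set (map read_tape (snd c)) \<subseteq> {..<num_symbols M}"
  using assms by (auto simp: wf_config_def read_tape_def in_set_conv_nth) (metis fst_conv)

lemma step_nth:
  assumes "turing_machine M" "wf_config M c" "k < num_tapes M"
  shows "snd (step M c) ! k = act (snd (next_act M (fst c) (map read_tape (snd c))) ! k) (snd c ! k)"
  using assms next_act_wf(2)[OF assms(1) _ wf_config_read[OF assms(2)], of "fst c"]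
  by (simp add: step_next_act wf_config_def)

lemma wf_config_step:
  assumes M: "turing_machine M" and c: "wf_config M c"
  shows "wf_config M (step M c)"
proof -
  have q: "fst c < num_states M" using c by (simp add: wf_config_def)
  note wf = next_act_wf[OF M q wf_config_read[OF c]]
  have "fst (snd (step M c) ! k) i < num_symbols M" if "k < num_tapes M" for k i
    using wf(3)[OF that] c that by (simp add: step_nth[OF M c] act_eq wf_config_def)
  then show ?thesis using wf(1,2) c by (simp add: wf_config_def step_next_act)
qed

lemma wf_config_steps: "turing_machine M \<Longrightarrow> wf_config M c \<Longrightarrow> wf_config M ((step M ^^ t) c)"
  by (induction t) (auto intro: wf_config_step)

lemma nth_init_config:
  "k < num_tapes M \<Longrightarrow> snd (init_config M xs) ! k = input_tape (if k = 0 then xs else [])"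
  by (cases k) (auto simp: init_config_def)

lemma wf_init_config:
  assumes "turing_machine M"
  shows "wf_config M (init_config M (symbols w))"
proof -
  have "length (snd (init_config M (symbols w))) = num_tapes M" "fst (init_config M (symbols w)) < num_states M"
    using assms by (auto simp: init_config_def turing_machine_def)
  then show ?thesis
    using assms by (auto simp: wf_config_def nth_init_config input_tape_def symbols_def turing_machine_def)
qed

text \<open>What ranges over a finite set for a fixed machine belongs to the kind; times and
  positions are indices. \<open>Read\<close> and \<open>Act\<close> transmit symbols and actions
  between the transition and the individual tapes: a clause for the whole transition would mention
  the head positions of all tapes, but only three indices are available.\<close>

datatype kind = State nat | Head nat | Cell nat nat | Read nat nat | Act nat nat direction

text \<open>
  The second index of \<open>Head\<close> and \<open>Cell\<close> atoms is a position on a tape, shifted by \<open>T x + 1\<close>.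
  In \<open>move_rules\<close>, the head is at \<open>p + 1\<close>, so that the position to its left is a natural number.
\<close>

definition read_rules :: "machine \<Rightarrow> kind template list" where
  "read_rules M =
     [(\<lambda>x t p p'. True,
        [(False, Head k, \<lambda>x t p p'. t, \<lambda>x t p p'. p), (False, Cell k a, \<lambda>x t p p'. t, \<lambda>x t p p'. p),
         (True, Read k a, \<lambda>x t p p'. t, \<lambda>x t p p'. 0)]).
      k \<leftarrow> [0..<num_tapes M], a \<leftarrow> [0..<num_symbols M]]"

definition step_premises :: "machine \<Rightarrow> nat \<Rightarrow> nat list \<Rightarrow> kind literal list" where
  "step_premises M q ss = (False, State q, \<lambda>x t p p'. t, \<lambda>x t p p'. 0) #
     map (\<lambda>k. (False, Read k (ss ! k), \<lambda>x t p p'. t, \<lambda>x t p p'. 0)) [0..<num_tapes M]"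

text \<open>A separate group of templates for each state and each tuple of symbols read, and in it
  one template for each consequence, as a clause expresses an implication with a single
  conclusion.\<close>

definition step_rules :: "machine \<Rightarrow> kind template list" where
  "step_rules M =
     concat [(\<lambda>x t p p'. True, step_premises M q ss @
          [(True, State (fst (next_act M q ss)), \<lambda>x t p p'. t + 1, \<lambda>x t p p'. 0)]) #
        map (\<lambda>k. (\<lambda>x t p p'. True, step_premises M q ss @
          [(True, Act k (fst (snd (next_act M q ss) ! k)) (snd (snd (next_act M q ss) ! k)),
            \<lambda>x t p p'. t, \<lambda>x t p p'. 0)])) [0..<num_tapes M].
      q \<leftarrow> [0..<num_states M], ss \<leftarrow> List.n_lists (num_tapes M) [0..<num_symbols M]]"

definition move_rules :: "machine \<Rightarrow> kind template list" where
  "move_rules M =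
     concat [map (\<lambda>l. (\<lambda>x t p p'. True,
         [(False, Head k, \<lambda>x t p p'. t, \<lambda>x t p p'. p + 1), (False, Act k a d, \<lambda>x t p p'. t, \<lambda>x t p p'. 0), l]))
       [(True, Head k, \<lambda>x t p p'. t + 1, \<lambda>x t p p'. p + nat (shift d + 1)),
        (True, Cell k a, \<lambda>x t p p'. t + 1, \<lambda>x t p p'. p + 1)].
      k \<leftarrow> [0..<num_tapes M], a \<leftarrow> [0..<num_symbols M], d \<leftarrow> [Left, Stay, Right]]"

text \<open>The head position and the position of an untouched cell occur together here, which is
  why templates have two indices besides the time.\<close>

definition frame_rules :: "machine \<Rightarrow> kind template list" where
  "frame_rules M =
     [(\<lambda>x t p p'. p \<noteq> p',
        [(False, Head k, \<lambda>x t p p'. t, \<lambda>x t p p'. p), (False, Cell k a, \<lambda>x t p p'. t, \<lambda>x t p p'. p'),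
         (True, Cell k a, \<lambda>x t p p'. t + 1, \<lambda>x t p p'. p')]).
      k \<leftarrow> [0..<num_tapes M], a \<leftarrow> [0..<num_symbols M]]"

text \<open>Where \<^const>\<open>pair\<close> has its bits, apart from those of the second component.\<close>

definition one_at :: "bool list \<Rightarrow> nat \<Rightarrow> nat \<Rightarrow> bool" where
  "one_at x z p \<longleftrightarrow> (\<exists>i<length x. (p = z + 2 * i \<or> p = z + 2 * i + 1) \<and> has_bit x i) \<or> p = z + 2 * length x + 1"

definition zero_at :: "bool list \<Rightarrow> nat \<Rightarrow> nat \<Rightarrow> bool" where
  "zero_at x z p \<longleftrightarrow> (\<exists>i<length x. (p = z + 2 * i \<or> p = z + 2 * i + 1) \<and> \<not> has_bit x i) \<or> p = z + 2 * length x"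

text \<open>Behind the delimiter a cell may be blank or a bit, a blank is followed by blanks only,
  and from \<open>U x\<close> cells on there are only blanks. This describes an arbitrary string of
  length at most \<open>U x\<close>.\<close>

definition init_rules :: "machine \<Rightarrow> (bool list \<Rightarrow> nat) \<Rightarrow> (bool list \<Rightarrow> nat) \<Rightarrow> kind template list" where
  "init_rules M T U =
     [(\<lambda>x t p p'. True, [(True, State (start M), \<lambda>x t p p'. 0, \<lambda>x t p p'. 0)]),
      (\<lambda>x t p p'. one_at x (T x + 1) p, [(True, Cell 0 2, \<lambda>x t p p'. 0, \<lambda>x t p p'. p)]),
      (\<lambda>x t p p'. zero_at x (T x + 1) p, [(True, Cell 0 1, \<lambda>x t p p'. 0, \<lambda>x t p p'. p)]),
      (\<lambda>x t p p'. p < T x + 1 \<or> T x + 1 + 2 * length x + 2 + U x \<le> p,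
        [(True, Cell 0 0, \<lambda>x t p p'. 0, \<lambda>x t p p'. p)]),
      (\<lambda>x t p p'. T x + 1 + 2 * length x + 2 \<le> p,
        [(True, Cell 0 0, \<lambda>x t p p'. 0, \<lambda>x t p p'. p), (True, Cell 0 1, \<lambda>x t p p'. 0, \<lambda>x t p p'. p),
         (True, Cell 0 2, \<lambda>x t p p'. 0, \<lambda>x t p p'. p)]),
      (\<lambda>x t p p'. T x + 1 + 2 * length x + 2 \<le> p,
        [(False, Cell 0 0, \<lambda>x t p p'. 0, \<lambda>x t p p'. p), (True, Cell 0 0, \<lambda>x t p p'. 0, \<lambda>x t p p'. p + 1)])] @
     [(\<lambda>x t p p'. True, [(True, Head k, \<lambda>x t p p'. 0, \<lambda>x t p p'. T x + 1)]). k \<leftarrow> [0..<num_tapes M]] @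
     [(\<lambda>x t p p'. True, [(True, Cell k 0, \<lambda>x t p p'. 0, \<lambda>x t p p'. p)]). k \<leftarrow> [1..<num_tapes M]]"

text \<open>The machine does not end with the output \<open>[False]\<close>.\<close>

definition final_rules :: "machine \<Rightarrow> (bool list \<Rightarrow> nat) \<Rightarrow> kind template list" where
  "final_rules M T =
     [(\<lambda>x t p p'. True, [(False, Read (num_tapes M - 1) 1, \<lambda>x t p p'. T x, \<lambda>x t p p'. 0)])]"

section \<open>Meaning of the rules\<close>

lemmas template_simps = template_true_def literal_true_def

lemma const_bounded: "0 < B \<Longrightarrow> (\<forall>p<B. P) \<longleftrightarrow> P" for B :: nat
  by auto

lemma ball_atLeastLessThan: "(\<forall>k \<in> {m..<n}. P k) \<longleftrightarrow> (\<forall>k<n. m \<le> k \<longrightarrow> P k)" for m :: nat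
  by auto

lemma read_rules_true:
  assumes "0 < B"
  shows "(\<forall>tm \<in> set (read_rules M). template_true s B x tm) \<longleftrightarrow>
    (\<forall>k<num_tapes M. \<forall>a<num_symbols M. \<forall>t<B. \<forall>p<B.
       s (Cell k a) t p \<longrightarrow> s (Head k) t p \<longrightarrow> s (Read k a) t 0)"
  unfolding read_rules_def using assms
  by (simp add: template_simps const_bounded ball_atLeastLessThan del: all_simps ex_simps)

lemma step_rules_true:
  assumes "0 < B"
  shows "(\<forall>tm \<in> set (step_rules M). template_true s B x tm) \<longleftrightarrow>
    (\<forall>q<num_states M. \<forall>ss. length ss = num_tapes M \<and> set ss \<subseteq> {..<num_symbols M} \<longrightarrow>
      (\<forall>t<B. s (State q) t 0 \<longrightarrow> (\<forall>k<num_tapes M. s (Read k (ss ! k)) t 0) \<longrightarrow>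
        s (State (fst (next_act M q ss))) (t + 1) 0 \<and>
        (\<forall>k<num_tapes M. s (Act k (fst (snd (next_act M q ss) ! k)) (snd (snd (next_act M q ss) ! k))) t 0)))"
proof -
  let ?pre = "\<lambda>q ss t. s (State q) t 0 \<and> (\<forall>k<num_tapes M. s (Read k (ss ! k)) t 0)"
  have pre: "(\<exists>l \<in> set (step_premises M q ss). literal_true s x t p p' l) \<longleftrightarrow> \<not> ?pre q ss t" for q ss t p p'
    by (auto simp: step_premises_def literal_true_def)
  have 1: "template_true s B x (\<lambda>x t p p'. True, step_premises M q ss @ [(True, k, \<lambda>x t p p'. f t, \<lambda>x t p p'. 0)])
      \<longleftrightarrow> (\<forall>t<B. ?pre q ss t \<longrightarrow> s k (f t) 0)" for q ss k f
    unfolding template_true_def prod.case set_append bex_Un pre using assms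
    by (auto simp: literal_true_def)
  have "(\<forall>tm \<in> set (step_rules M). template_true s B x tm) \<longleftrightarrow>
    (\<forall>q<num_states M. \<forall>ss. length ss = num_tapes M \<and> set ss \<subseteq> {..<num_symbols M} \<longrightarrow>
      (\<forall>t<B. ?pre q ss t \<longrightarrow> s (State (fst (next_act M q ss))) (t + 1) 0) \<and>
      (\<forall>k<num_tapes M. \<forall>t<B. ?pre q ss t \<longrightarrow>
        s (Act k (fst (snd (next_act M q ss) ! k)) (snd (snd (next_act M q ss) ! k))) t 0))"
    unfolding step_rules_def by (simp add: 1 1[of _ _ _ "\<lambda>t. t", simplified] set_n_lists lessThan_atLeast0
        ball_atLeastLessThan)
  then show ?thesis by (simp only: all_conj_distrib imp_conjL imp_conjR) blast
qed

lemma move_rules_true: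
  assumes "0 < B"
  shows "(\<forall>tm \<in> set (move_rules M). template_true s B x tm) \<longleftrightarrow>
    (\<forall>d. \<forall>k<num_tapes M. \<forall>a<num_symbols M. \<forall>t<B. \<forall>p<B.
       s (Act k a d) t 0 \<longrightarrow> s (Head k) t (p + 1) \<longrightarrow>
       s (Head k) (t + 1) (p + nat (shift d + 1)) \<and> s (Cell k a) (t + 1) (p + 1))"
proof -
  have d: "(\<forall>d. P d) \<longleftrightarrow> P Left \<and> P Stay \<and> P Right" for P
    by (metis direction.exhaust)
  show ?thesis
    unfolding move_rules_def d using assms
    by (simp add: template_simps const_bounded ball_atLeastLessThan all_conj_distrib imp_conjR
        del: all_simps ex_simps)
      (rule iffI; elim conjE; intro conjI; assumption)
qed

lemma frame_rules_true:
  assumes "0 < B"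
  shows "(\<forall>tm \<in> set (frame_rules M). template_true s B x tm) \<longleftrightarrow>
    (\<forall>k<num_tapes M. \<forall>a<num_symbols M. \<forall>t<B. \<forall>p<B. \<forall>p'<B. p \<noteq> p' \<longrightarrow>
       s (Cell k a) t p' \<longrightarrow> s (Head k) t p \<longrightarrow> s (Cell k a) (t + 1) p')"
  unfolding frame_rules_def using assms
  by (simp add: template_simps const_bounded ball_atLeastLessThan del: all_simps ex_simps)

lemma init_rules_true:
  assumes "0 < B"
  shows "(\<forall>tm \<in> set (init_rules M T U). template_true s B x tm) \<longleftrightarrow>
    s (State (start M)) 0 0 \<and>
    (\<forall>p<B. one_at x (T x + 1) p \<longrightarrow> s (Cell 0 2) 0 p) \<and>
    (\<forall>p<B. zero_at x (T x + 1) p \<longrightarrow> s (Cell 0 1) 0 p) \<and>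
    (\<forall>p<B. p < T x + 1 \<or> T x + 1 + 2 * length x + 2 + U x \<le> p \<longrightarrow> s (Cell 0 0) 0 p) \<and>
    (\<forall>p<B. T x + 1 + 2 * length x + 2 \<le> p \<longrightarrow>
       s (Cell 0 0) 0 p \<or> s (Cell 0 1) 0 p \<or> s (Cell 0 2) 0 p) \<and>
    (\<forall>p<B. T x + 1 + 2 * length x + 2 \<le> p \<longrightarrow> s (Cell 0 0) 0 p \<longrightarrow> s (Cell 0 0) 0 (p + 1)) \<and>
    (\<forall>k<num_tapes M. s (Head k) 0 (T x + 1)) \<and>
    (\<forall>k<num_tapes M. 0 < k \<longrightarrow> (\<forall>p<B. s (Cell k 0) 0 p))"
  unfolding init_rules_def using assms
  by (simp add: template_simps const_bounded ball_atLeastLessThan ball_Un Suc_le_eq del: all_simps ex_simps)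

lemma final_rules_true:
  "0 < B \<Longrightarrow> (\<forall>tm \<in> set (final_rules M T). template_true s B x tm) \<longleftrightarrow> \<not> s (Read (num_tapes M - 1) 1) (T x) 0"
  by (auto simp: final_rules_def template_simps)


lemma abs_shift_le: "\<bar>shift d\<bar> \<le> 1"
  by (cases d) auto

lemma input_tape_pair:
  fixes z p :: nat and x u :: "bool list"
  defines "c \<equiv> fst (input_tape (symbols (pair x u))) (int p - int z)"
  shows "p < z \<Longrightarrow> c = 0" "zero_at x z p \<Longrightarrow> c = 1" "one_at x z p \<Longrightarrow> c = 2"
    "p = z + 2 * length x + 2 + i \<Longrightarrow> c = (if i < length u then if u ! i then 2 else 1 else 0)"
proof -
  have nth: "c = (if j < length (pair x u) then if pair x u ! j then 2 else 1 else 0)" if "p = z + j" for j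
    using that by (simp add: c_def input_tape_def symbols_def)
  show "c = 0" if "p < z" using that by (simp add: c_def input_tape_def)
  have bits: "c = (if x ! i then 2 else 1)" if "i < length x" "p = z + 2 * i \<or> p = z + 2 * i + 1" for i
    using that nth[of "2 * i"] nth[of "2 * i + 1"] nth_pair_doubled[OF that(1), of u] length_pair[of x u] by auto
  show "c = 1" if "zero_at x z p"
    using that bits nth[of "2 * length x"] nth_pair_rest(1)[of x u]
    by (auto simp: zero_at_def has_bit_def length_pair)
  show "c = 2" if "one_at x z p"
    using that bits nth[of "2 * length x + 1"] nth_pair_rest(2)[of x u]
    by (auto simp: one_at_def has_bit_def length_pair)
  show "c = (if i < length u then if u ! i then 2 else 1 else 0)" if "p = z + 2 * length x + 2 + i"
    using nth[of "2 * length x + 2 + i"] nth_pair_rest(3)[of x u i] that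
    by (simp add: length_pair add.assoc)
qed

lemma position_cases:
  fixes z p :: nat
  obtains "p < z" | "zero_at x z p" | "one_at x z p" | i where "p = z + 2 * length x + 2 + i"
proof -
  consider "p < z" | "z \<le> p" "p < z + 2 * length x" | "p = z + 2 * length x" | "p = z + 2 * length x + 1"
    | "z + 2 * length x + 2 \<le> p" by linarith
  then show thesis
  proof cases
    case 2
    define i where "i = (p - z) div 2"
    have "i < length x" "p = z + 2 * i \<or> p = z + 2 * i + 1" using 2 by (auto simp: i_def)
    then show ?thesis using that(2,3) unfolding zero_at_def one_at_def by blast
  next
    case 5
    then show ?thesis using that(4)[of "p - (z + 2 * length x + 2)"] by simp
  qed (use that in \<open>auto simp: zero_at_def one_at_def\<close>)
qed

section \<open>The tableau and the runs of the verifying machine\<close>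

context
  fixes M :: machine and T U :: "bool list \<Rightarrow> nat"
  assumes M: "turing_machine M"
begin

definition tableau :: "kind template list" where
  "tableau = read_rules M @ step_rules M @ move_rules M @ frame_rules M @ init_rules M T U @ final_rules M T"

text \<open>Within \<open>T x\<close> steps a head stays between \<open>- T x\<close> and
  \<open>T x\<close>. The shift by \<open>T x + 1\<close> makes these positions positive and less
  than the bound; the same bound serves for times.\<close>

abbreviation bound :: "bool list \<Rightarrow> nat" where
  "bound x \<equiv> 2 * T x + 3"

lemma bound_pos: "0 < bound x" by simp

lemmas rules_true = read_rules_true[OF bound_pos] step_rules_true[OF bound_pos]
  move_rules_true[OF bound_pos] frame_rules_true[OF bound_pos] init_rules_true[OF bound_pos]
  final_rules_true[OF bound_pos]

definition run :: "bool list \<Rightarrow> bool list \<Rightarrow> nat \<Rightarrow> config" where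
  "run x u t = (step M ^^ t) (init_config M (symbols (pair x u)))"

lemma run_wf: "wf_config M (run x u t)"
  unfolding run_def by (intro wf_config_steps wf_init_config M)

lemma run_Suc: "run x u (Suc t) = step M (run x u t)"
  by (simp add: run_def)

definition actions :: "bool list \<Rightarrow> bool list \<Rightarrow> nat \<Rightarrow> (nat \<times> direction) list" where
  "actions x u t = snd (next_act M (fst (run x u t)) (map read_tape (snd (run x u t))))"

lemma run_tape_Suc:
  "k < num_tapes M \<Longrightarrow> snd (run x u (Suc t)) ! k = act (actions x u t ! k) (snd (run x u t) ! k)"
  unfolding run_Suc actions_def by (intro step_nth M run_wf)

lemma run_state_Suc:
  "fst (run x u (Suc t)) = fst (next_act M (fst (run x u t)) (map read_tape (snd (run x u t))))"
  by (simp add: run_Suc step_next_act)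

lemma run_0: "fst (run x u 0) = start M"
  "k < num_tapes M \<Longrightarrow> snd (run x u 0) ! k = input_tape (if k = 0 then symbols (pair x u) else [])"
  by (simp_all add: run_def nth_init_config) (simp add: init_config_def)

lemma num_tapes_pos: "0 < num_tapes M"
  using M by (simp add: turing_machine_def)

text \<open>
  Apart from the choice of the symbols of \<open>u\<close>, all rules are implications, so a satisfying
  assignment contains all facts about the run on the chosen string.
\<close>

lemma tableau_sound:
  assumes s: "\<forall>tm \<in> set tableau. template_true s (bound x) x tm"
  shows "\<exists>u. length u \<le> U x \<and> read_tape (snd (run x u (T x)) ! (num_tapes M - 1)) \<noteq> 1"
proof -
  let ?B = "bound x" and ?z = "T x + 1"
  let ?e = "?z + 2 * length x + 2"
  from s have rules: "\<forall>tm \<in> set (read_rules M). template_true s ?B x tm" "\<forall>tm \<in> set (step_rules M). template_true s ?B x tm"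
    "\<forall>tm \<in> set (move_rules M). template_true s ?B x tm" "\<forall>tm \<in> set (frame_rules M). template_true s ?B x tm"
    "\<forall>tm \<in> set (init_rules M T U). template_true s ?B x tm" "\<forall>tm \<in> set (final_rules M T). template_true s ?B x tm"
    by (simp_all add: tableau_def)
  note read = rules(1)[unfolded rules_true, rule_format]
  note step = rules(2)[unfolded rules_true, rule_format]
  note move = rules(3)[unfolded rules_true, rule_format]
  note frame = rules(4)[unfolded rules_true, rule_format]
  note init = rules(5)[unfolded rules_true]
  note final = rules(6)[unfolded rules_true]
  \<comment> \<open>The length of the string chosen by \<open>s\<close>: up to the first blank
    behind the delimiter, or \<open>U x\<close> if there is none before.\<close>
  define k where "k = (LEAST k. k = U x \<or> s (Cell 0 0) 0 (?e + k))"
  have k: "k = U x \<or> s (Cell 0 0) 0 (?e + k)" unfolding k_def by (rule LeastI[of _ "U x"]) simp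
  have k_le: "k \<le> U x" unfolding k_def by (rule Least_le) simp
  have below_k: "\<not> s (Cell 0 0) 0 (?e + i)" if "i < k" for i
    using not_less_Least[OF that[unfolded k_def]] by blast
  \<comment> \<open>The assignment may mark a cell with both bits. Then the bit is taken to be
    \<open>True\<close>, and the fact required of this cell is among the true ones.\<close>
  define u where "u = map (\<lambda>i. s (Cell 0 2) 0 (?e + i)) [0..<k]"
  have above_k: "s (Cell 0 0) 0 (?e + i)" if "k \<le> i" "?e + i < ?B" for i
    using that
  proof (induction i rule: dec_induct)
    case base
    then show ?case using k init by auto
  next
    case (step i)
    then have "?e + i < ?B" "s (Cell 0 0) 0 (?e + i)" by auto
    then have "s (Cell 0 0) 0 (?e + i + 1)" using init by auto
    then show ?case by simp
  qed
  have cells0: "s (Cell 0 (fst (input_tape (symbols (pair x u))) (int p - int ?z))) 0 p" if p: "p < ?B" for p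
  proof (cases rule: position_cases[where p = p and z = ?z and x = x])
    case 1
    then show ?thesis using input_tape_pair(1)[OF 1] init p by auto
  next
    case 2
    then show ?thesis using input_tape_pair(2)[OF 2] init p by auto
  next
    case 3
    then show ?thesis using input_tape_pair(3)[OF 3] init p by auto
  next
    case (4 i)
    have "s (Cell 0 (if i < length u then if u ! i then 2 else 1 else 0)) 0 p"
    proof (cases "i < k")
      case True
      have "s (Cell 0 0) 0 p \<or> s (Cell 0 1) 0 p \<or> s (Cell 0 2) 0 p" using init p 4 by auto
      then show ?thesis using True below_k[OF True] 4 by (auto simp: u_def)
    next
      case False
      then show ?thesis using above_k[of i] 4 p by (simp add: u_def)
    qed
    then show ?thesis using input_tape_pair(4)[OF 4] by simp
  qed
  let ?c = "run x u"
  \<comment> \<open>The distance of the head from the origin is part of the invariant because it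
    keeps the shifted position at least 1 and in the range of the rules. Only the presence of facts
    is claimed; further atoms may be true.\<close>
  define inv where "inv t \<longleftrightarrow> s (State (fst (?c t))) t 0 \<and> (\<forall>k<num_tapes M. \<bar>snd (snd (?c t) ! k)\<bar> \<le> int t \<and>
      s (Head k) t (nat (snd (snd (?c t) ! k) + int ?z)) \<and>
      (\<forall>p<?B. s (Cell k (fst (snd (?c t) ! k) (int p - int ?z))) t p))" for t
  have reads: "s (Read k (read_tape (snd (?c t) ! k))) t 0" if "inv t" "t \<le> T x" "k < num_tapes M" for t k
  proof -
    define h where "h = snd (snd (?c t) ! k)"
    define p where "p = nat (h + int ?z)"
    have h: "\<bar>h\<bar> \<le> int t" "s (Head k) t p" and c: "\<And>p. p < ?B \<Longrightarrow> s (Cell k (fst (snd (?c t) ! k) (int p - int ?z))) t p"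
      using that unfolding inv_def h_def p_def by auto
    have p: "p < ?B" "int p - int ?z = h" using h(1) that(2) by (auto simp: p_def)
    have "read_tape (snd (?c t) ! k) < num_symbols M"
      using run_wf[of x u t] that(3) by (auto simp: wf_config_def read_tape_def)
    then show ?thesis
      using read[of k "read_tape (snd (?c t) ! k)" t p] c[OF p(1)] h(2) p that(2,3)
      by (simp add: read_tape_def h_def)
  qed
  have inv: "inv t" if "t \<le> T x" for t
    using that
  proof (induction t)
    case 0
    have "s (Cell k (fst (input_tape []) (int p - int ?z))) 0 p" if "0 < k" "k < num_tapes M" "p < ?B" for k p
      using that init by (simp add: input_tape_def)
    moreover have "snd (input_tape xs) = 0" for xs by (simp add: input_tape_def)
    moreover have "nat (1 + int (T x)) = Suc (T x)" by linarith
    ultimately show ?case using init cells0 unfolding inv_def by (simp add: run_0)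
  next
    case (Suc t)
    then have IH: "inv t" and t: "t \<le> T x" "t < ?B" by auto
    let ?ss = "map read_tape (snd (?c t))"
    have wf: "fst (?c t) < num_states M" "length (snd (?c t)) = num_tapes M"
      using run_wf[of x u t] by (auto simp: wf_config_def)
    note ss = wf_config_read[OF run_wf[of x u t]]
    have "s (Read k (?ss ! k)) t 0" if "k < num_tapes M" for k
      using reads[OF IH t(1) that] wf(2) that by simp
    then have next_state: "s (State (fst (?c (Suc t)))) (Suc t) 0"
      and act: "\<And>k. k < num_tapes M \<Longrightarrow> s (Act k (fst (actions x u t ! k)) (snd (actions x u t ! k))) t 0"
      using step[OF wf(1) conjI[OF ss] t(2)] IH unfolding inv_def run_state_Suc actions_def by auto
    have "\<bar>snd (snd (?c (Suc t)) ! k)\<bar> \<le> int (Suc t) \<and>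
      s (Head k) (Suc t) (nat (snd (snd (?c (Suc t)) ! k) + int ?z)) \<and>
      (\<forall>p<?B. s (Cell k (fst (snd (?c (Suc t)) ! k) (int p - int ?z))) (Suc t) p)" if k: "k < num_tapes M" for k
    proof -
      define h where "h = snd (snd (?c t) ! k)"
      define p where "p = nat (h + int ?z) - 1"
      obtain a d where ad: "actions x u t ! k = (a, d)" by fastforce
      have h: "\<bar>h\<bar> \<le> int t" "s (Head k) t (nat (h + int ?z))"
        and c: "\<And>p. p < ?B \<Longrightarrow> s (Cell k (fst (snd (?c t) ! k) (int p - int ?z))) t p"
        using IH k unfolding inv_def h_def by auto
      have p: "nat (h + int ?z) = p + 1" "p + 1 < ?B" "int p + 1 = h + int ?z" using h(1) t by (auto simp: p_def)
      have a: "a < num_symbols M" using next_act_wf(3)[OF M wf(1) ss k] ad by (simp add: actions_def)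
      have mv: "s (Head k) (t + 1) (p + nat (shift d + 1))" "s (Cell k a) (t + 1) (p + 1)"
        using move[OF k a t(2), of p d] p(2) act[OF k] ad h(2) p(1) by auto
      have tp: "fst (snd (?c (Suc t)) ! k) = (fst (snd (?c t) ! k))(h := a)" "snd (snd (?c (Suc t)) ! k) = h + shift d"
        using run_tape_Suc[OF k, of x u t] by (simp_all add: ad act_eq h_def)
      have "nat (h + shift d + int ?z) = p + nat (shift d + 1)" using p(3) abs_shift_le[of d] by linarith
      moreover have "s (Cell k (((fst (snd (?c t) ! k))(h := a)) (int p' - int ?z))) (Suc t) p'" if p': "p' < ?B" for p'
      proof (cases "p' = p + 1")
        case True
        then show ?thesis using mv(2) p(3) by auto
      next
        case False
        then have "int p' - int ?z \<noteq> h" using p(3) by linarith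
        moreover have "fst (snd (?c t) ! k) (int p' - int ?z) < num_symbols M"
          using run_wf[of x u t] k by (simp add: wf_config_def)
        ultimately show ?thesis using frame[OF k _ t(2) p(2) p' False[symmetric] c[OF p']] h(2) p(1) by simp
      qed
      ultimately show ?thesis
        unfolding tp using mv(1) h(1) abs_shift_le[of d] by auto
    qed
    then show ?case unfolding inv_def using next_state by blast
  qed
  have "\<not> s (Read (num_tapes M - 1) 1) (T x) 0" using final by simp
  then have "read_tape (snd (?c (T x)) ! (num_tapes M - 1)) \<noteq> 1"
    using reads[OF inv, of "T x" "num_tapes M - 1"] num_tapes_pos by auto
  then show ?thesis using k_le by (intro exI[of _ u]) (simp add: u_def)
qed

text \<open>The equation for \<open>Head\<close> is one of integers: times after \<open>T x\<close>
  are included, at which a head can be too far left for any natural number, and then no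
  \<open>Head\<close> atom of that tape is true.\<close>

definition run_atom :: "bool list \<Rightarrow> bool list \<Rightarrow> kind \<Rightarrow> nat \<Rightarrow> nat \<Rightarrow> bool" where
  "run_atom x u k t p = (case k of
      State q \<Rightarrow> fst (run x u t) = q
    | Head k \<Rightarrow> snd (snd (run x u t) ! k) + int (T x + 1) = int p
    | Cell k a \<Rightarrow> fst (snd (run x u t) ! k) (int p - int (T x + 1)) = a
    | Read k a \<Rightarrow> read_tape (snd (run x u t) ! k) = a
    | Act k a d \<Rightarrow> actions x u t ! k = (a, d))"

text \<open>The atoms are evaluated exactly along the run, so all implications hold at all times,
  even where the positions leave the range of the tableau; the last rule is the assumption on the
  symbol read.\<close>

lemma tableau_complete:
  assumes u: "length u \<le> U x" and final: "read_tape (snd (run x u (T x)) ! (num_tapes M - 1)) \<noteq> 1"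
  shows "\<forall>tm \<in> set tableau. template_true (run_atom x u) (bound x) x tm"
proof -
  let ?s = "run_atom x u" and ?B = "bound x" and ?z = "T x + 1"
  have "\<forall>tm \<in> set (read_rules M). template_true ?s ?B x tm"
    unfolding rules_true by (auto simp: run_atom_def read_tape_def)
      (metis add_diff_cancel_right')
  moreover have "\<forall>tm \<in> set (step_rules M). template_true ?s ?B x tm"
    unfolding rules_true
  proof (intro allI impI)
    fix q ss t
    assume ss: "length ss = num_tapes M \<and> set ss \<subseteq> {..<num_symbols M}" and q: "?s (State q) t 0"
      and reads: "\<forall>k<num_tapes M. ?s (Read k (ss ! k)) t 0"
    have "length (snd (run x u t)) = num_tapes M" using run_wf[of x u t] by (simp add: wf_config_def)
    then have "map read_tape (snd (run x u t)) = ss"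
      using ss reads by (intro nth_equalityI) (auto simp: run_atom_def)
    then show "?s (State (fst (next_act M q ss))) (t + 1) 0 \<and>
        (\<forall>k<num_tapes M. ?s (Act k (fst (snd (next_act M q ss) ! k)) (snd (snd (next_act M q ss) ! k))) t 0)"
      using q by (auto simp: run_atom_def run_state_Suc actions_def)
  qed
  moreover have "\<forall>tm \<in> set (move_rules M). template_true ?s ?B x tm"
    unfolding rules_true
  proof (intro allI impI)
    fix d k a t p
    assume k: "k < num_tapes M" and act: "?s (Act k a d) t 0" and head: "?s (Head k) t (p + 1)"
    show "?s (Head k) (t + 1) (p + nat (shift d + 1)) \<and> ?s (Cell k a) (t + 1) (p + 1)"
      using act head run_tape_Suc[OF k, of x u t] abs_shift_le[of d] by (auto simp: run_atom_def act_eq)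
  qed
  moreover have "\<forall>tm \<in> set (frame_rules M). template_true ?s ?B x tm"
    unfolding rules_true
  proof (intro allI impI)
    fix k a t p p'
    assume k: "k < num_tapes M" and "p \<noteq> p'" "?s (Cell k a) t p'" "?s (Head k) t p"
    then show "?s (Cell k a) (t + 1) p'"
      using run_tape_Suc[OF k, of x u t] by (auto simp: run_atom_def act_eq)
  qed
  moreover have "\<forall>tm \<in> set (init_rules M T U). template_true ?s ?B x tm"
  proof -
    have cell: "?s (Cell 0 a) 0 p \<longleftrightarrow> fst (input_tape (symbols (pair x u))) (int p - int ?z) = a" for a p
      using num_tapes_pos by (simp add: run_atom_def run_0)
    have rest: "?s (Cell 0 a) 0 p \<longleftrightarrow> (if i < length u then if u ! i then 2 else 1 else 0) = a"
      if "p = ?z + 2 * length x + 2 + i" for a p i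
      unfolding cell input_tape_pair(4)[OF that] ..
    have e: "p = ?z + 2 * length x + 2 + (p - (?z + 2 * length x + 2))" if "?z + 2 * length x + 2 \<le> p" for p
      using that by simp
    show ?thesis
      unfolding rules_true
    proof (intro conjI allI impI)
      show "?s (State (start M)) 0 0" by (simp add: run_atom_def run_0)
      show "?s (Cell 0 2) 0 p" if "one_at x ?z p" for p unfolding cell using that by (rule input_tape_pair(3))
      show "?s (Cell 0 1) 0 p" if "zero_at x ?z p" for p unfolding cell using that by (rule input_tape_pair(2))
      show "?s (Cell 0 0) 0 p" if "p < ?z \<or> ?z + 2 * length x + 2 + U x \<le> p" for p
        using that
      proof
        assume p: "?z + 2 * length x + 2 + U x \<le> p"
        then show ?thesis using rest[OF e, of p 0] u by simp
      next
        assume "p < ?z"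
        then show ?thesis unfolding cell by (rule input_tape_pair(1))
      qed
      fix p assume p: "?z + 2 * length x + 2 \<le> p"
      show "?s (Cell 0 0) 0 p \<or> ?s (Cell 0 1) 0 p \<or> ?s (Cell 0 2) 0 p"
        using rest[OF e[OF p]] by simp
      have p': "p + 1 = ?z + 2 * length x + 2 + (p + 1 - (?z + 2 * length x + 2))" using p by simp
      assume "?s (Cell 0 0) 0 p"
      then show "?s (Cell 0 0) 0 (p + 1)"
        using p unfolding rest[OF e[OF p]] rest[OF p'] by (auto split: if_splits)
    next
      fix k assume k: "k < num_tapes M"
      show "?s (Head k) 0 ?z" using k by (simp add: run_atom_def run_0 input_tape_def)
      show "?s (Cell k 0) 0 p" if "0 < k" for p using k that by (simp add: run_atom_def run_0 input_tape_def)
    qed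
  qed
  moreover have "\<forall>tm \<in> set (final_rules M T). template_true ?s ?B x tm"
    unfolding rules_true using final by (simp add: run_atom_def)
  ultimately show ?thesis by (auto simp: tableau_def)
qed

text \<open>An index exceeds \<open>t\<close> or \<open>p\<close> by at most 2, the largest value of
  \<open>nat (shift d + 1)\<close>, so \<open>bound x + 3\<close> is above all of them.\<close>

lemma tableau_definable:
  assumes T: "trm_definable (\<lambda>x e. T x)" and U: "trm_definable (\<lambda>x e. U x)" and tm: "tm \<in> set tableau"
  shows "template_definable bound (\<lambda>x. bound x + 3) tm"
proof -
  note [definable] = T U
  have shift: "nat (shift d + 1) \<le> 2" for d using abs_shift_le[of d] by linarith
  have "\<forall>tm \<in> set tableau. template_definable bound (\<lambda>x. bound x + 3) tm"
    unfolding tableau_def set_append ball_Un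
  proof (intro conjI)
    show "\<forall>tm \<in> set (read_rules M). template_definable bound (\<lambda>x. bound x + 3) tm"
      by (auto simp: read_rules_def template_definable_def intro!: definable)
    show "\<forall>tm \<in> set (step_rules M). template_definable bound (\<lambda>x. bound x + 3) tm"
      by (auto simp: step_rules_def step_premises_def template_definable_def intro!: definable)
    show "\<forall>tm \<in> set (move_rules M). template_definable bound (\<lambda>x. bound x + 3) tm"
      by (auto simp: move_rules_def template_definable_def intro!: definable)
    show "\<forall>tm \<in> set (frame_rules M). template_definable bound (\<lambda>x. bound x + 3) tm"
      by (auto simp: frame_rules_def template_definable_def intro!: definable)
    show "\<forall>tm \<in> set (init_rules M T U). template_definable bound (\<lambda>x. bound x + 3) tm"
      by (auto simp: init_rules_def template_definable_def one_at_def zero_at_def intro!: definable)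
    show "\<forall>tm \<in> set (final_rules M T). template_definable bound (\<lambda>x. bound x + 3) tm"
      by (auto simp: final_rules_def template_definable_def intro!: definable)
  qed
  then show ?thesis using tm by blast
qed

end

lemma poly_nat_mono: "a \<le> b \<Longrightarrow> poly p a \<le> poly p b" for p :: "nat poly"
  by (induction p) (auto intro: add_mono mult_le_mono)

text \<open>\<open>T x\<close> is the running time for the longest pair that has to be considered.
  Polynomials with natural coefficients are monotone and halted configurations do not change, so at
  time \<open>T x\<close> the answer is available for every certificate. It is a single symbol, 2
  for acceptance and 1 for rejection, and not reading 1 is therefore the same as acceptance.\<close>

theorem NP_hard_max_total_transitivity: "NP_hard (max_total_transitivity_problem bipartite)"
  unfolding NP_hard_def
proof
  fix A assume "A \<in> class_NP"
  then obtain R and r :: "nat poly" where R: "R \<in> class_P"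
    and A: "\<And>x. x \<in> A \<longleftrightarrow> (\<exists>u. length u \<le> poly r (length x) \<and> pair x u \<in> R)"
    unfolding class_NP_def by blast
  from R obtain M and q :: "nat poly" where M: "turing_machine M"
    and halts: "\<And>w. halts_with M (symbols w) (symbols [w \<in> R]) (poly q (length w))"
    unfolding class_P_def poly_time_computable_def by blast
  define U where "U x = poly r (length x)" for x :: "bool list"
  define T where "T x = poly q (2 * length x + 2 + U x)" for x
  have stay: "(step M ^^ n) c = c" if "fst c = halt M" for n c
    by (induction n) (simp_all add: step_def that)
  have accept: "read_tape (snd (run M x u (T x)) ! (num_tapes M - 1)) \<noteq> 1 \<longleftrightarrow> pair x u \<in> R"
    if u: "length u \<le> U x" for x u
  proof -
    let ?w = "pair x u"
    let ?c = "(step M ^^ poly q (length ?w)) (init_config M (symbols ?w))"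
    have c: "fst ?c = halt M" "holds_string (last (snd ?c)) (symbols [?w \<in> R])"
      using halts[of ?w] by (auto simp: halts_with_def Let_def)
    have "poly q (length ?w) \<le> T x" unfolding T_def using u by (intro poly_nat_mono) (simp add: length_pair)
    then have "T x = (T x - poly q (length ?w)) + poly q (length ?w)" by simp
    then have run: "run M x u (T x) = ?c"
      unfolding run_def[OF M] by (metis c(1) funpow_add o_apply stay)
    have "length (snd ?c) = num_tapes M" "0 < num_tapes M"
      using run_wf[OF M, of x u "T x"] num_tapes_pos[OF M] unfolding run by (auto simp: wf_config_def)
    then have "last (snd ?c) = snd ?c ! (num_tapes M - 1)" by (metis last_conv_nth length_greater_0_conv)
    then have "read_tape (snd ?c ! (num_tapes M - 1)) = (if ?w \<in> R then 2 else 1)"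
      using c(2) by (auto simp: holds_string_def read_tape_def symbols_def)
    then show ?thesis unfolding run by simp
  qed
  have U: "trm_definable (\<lambda>x e. U x)" unfolding U_def by (intro definable)
  have T: "trm_definable (\<lambda>x e. T x)" unfolding T_def by (intro definable U)
  have "x \<in> A \<longleftrightarrow> (\<exists>s. \<forall>tm \<in> set (tableau M T U). template_true s (2 * T x + 3) x tm)" for x
    using tableau_sound[OF M, where T = T and U = U and x = x]
      tableau_complete[OF M, where T = T and U = U and x = x] accept[of _ x]
    unfolding A U_def[symmetric] by blast
  then have "A = {x. \<exists>s. \<forall>tm \<in> set (tableau M T U). template_true s (2 * T x + 3) x tm}" by blast
  moreover have "poly_reducible {x. \<exists>s. \<forall>tm \<in> set (tableau M T U). template_true s (2 * T x + 3) x tm}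
      (max_total_transitivity_problem bipartite)"
    by (rule poly_reducible_templates[where W = "\<lambda>x. 2 * T x + 3 + 3", OF _ _ _ tableau_definable[OF M T U]])
      (intro definable T | simp)+
  ultimately show "poly_reducible A (max_total_transitivity_problem bipartite)" by simp
qed

theorem theorem4: "NP_complete (max_total_transitivity_problem bipartite)"
  unfolding NP_complete_def using max_total_transitivity_in_NP NP_hard_max_total_transitivity by blast

end
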